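(* Let $(R,\mathfrak m)$ be a Noetherian local ring, $I$ an ideal of $R$, and $M,N$ finitely generated $R$-modules. Let $I_M=\operatorname{ann}_R(M/IM)$ and $n=\dim(N)$. Then $$\bigcup_{j\ge 0}\operatorname{Supp}(H^j_I(M,N))=\bigcup_{0\le j\le n}\operatorname{Supp}(H^j_{I_M}(N))=\bigcup_{0\le j\le n}\operatorname{Supp}(H^j_I(M,N)).$$
   Context: For an ideal $I$ and $j\ge 0$, the generalized local cohomology module is $H^j_I(M,N)=\varinjlim_n \operatorname{Ext}^j_R(M/I^nM,N)$; $H^j_{\mathfrak a}(N)=H^j_{\mathfrak a}(R,N)$ is the ordinary local cohomology module of $N$ with respect to an ideal $\mathfrak a$. *)

theory Defs
  imports
    "HOL-Library.FSet"
    "HOL-Library.Extended_Real"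
    "HOL-Algebra.Ideal_Product"
    "HOL-Algebra.Module"
    "HOL-Algebra.Ring_Divisibility"
begin

section \<open>Modules\<close>

text \<open>The \<open>mult\<close> and \<open>one\<close> fields that a module record inherits from \<open>ring\<close> play no role and
  are left \<open>undefined\<close>. A homomorphism is required to be \<open>undefined\<close> outside the carrier of its
  domain, so that equality of homomorphisms is equality of HOL functions.\<close>

definition regular_module :: "('r, 'a) ring_scheme \<Rightarrow> ('r, 'r) module" where
  "regular_module R =
     \<lparr>carrier = carrier R, monoid.mult = undefined, one = undefined,
      zero = \<zero>\<^bsub>R\<^esub>, add = add R, smult = monoid.mult R\<rparr>"

definition module_span ::
    "('r, 'a) ring_scheme \<Rightarrow> ('r, 'm, 'k) module_scheme \<Rightarrow> 'm set \<Rightarrow> 'm set" where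
  "module_span R M S = \<Inter>{H. submodule H R M \<and> S \<subseteq> H}"

definition fin_gen_module :: "('r, 'a) ring_scheme \<Rightarrow> ('r, 'm, 'k) module_scheme \<Rightarrow> bool" where
  "fin_gen_module R M \<longleftrightarrow>
     module R M \<and> (\<exists>A. finite A \<and> A \<subseteq> carrier M \<and> module_span R M A = carrier M)"

definition ideal_smult ::
    "('r, 'a) ring_scheme \<Rightarrow> 'r set \<Rightarrow> ('r, 'm, 'k) module_scheme \<Rightarrow> 'm set" where
  "ideal_smult R I M = module_span R M {a \<odot>\<^bsub>M\<^esub> x | a x. a \<in> I \<and> x \<in> carrier M}"

definition annihilator :: "('r, 'a) ring_scheme \<Rightarrow> ('r, 'm, 'k) module_scheme \<Rightarrow> 'r set" where
  "annihilator R M = {r \<in> carrier R. \<forall>x \<in> carrier M. r \<odot>\<^bsub>M\<^esub> x = \<zero>\<^bsub>M\<^esub>}"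

text \<open>In the quotient module, in the localization and in the direct limit below, an operation on
  classes is written as the union, over all representatives, of the resulting classes. Whenever the
  operation is well defined these all coincide, and the union is that common class.\<close>

definition quotient_module :: "('r, 'm, 'k) module_scheme \<Rightarrow> 'm set \<Rightarrow> ('r, 'm set) module" where
  "quotient_module M H =
     \<lparr>carrier = a_rcosets\<^bsub>M\<^esub> H, monoid.mult = undefined, one = undefined,
      zero = H, add = set_add M, smult = (\<lambda>r X. \<Union>x\<in>X. H +>\<^bsub>M\<^esub> (r \<odot>\<^bsub>M\<^esub> x))\<rparr>"

definition hom_module ::
    "('r, 'a) ring_scheme \<Rightarrow> ('r, 'm, 'k) module_scheme \<Rightarrow> ('r, 'n, 'l) module_scheme
      \<Rightarrow> ('r, 'm \<Rightarrow> 'n) module" where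
  "hom_module R M N =
     \<lparr>carrier = {f \<in> carrier M \<rightarrow>\<^sub>E carrier N.
        (\<forall>x \<in> carrier M. \<forall>y \<in> carrier M. f (x \<oplus>\<^bsub>M\<^esub> y) = f x \<oplus>\<^bsub>N\<^esub> f y) \<and>
        (\<forall>r \<in> carrier R. \<forall>x \<in> carrier M. f (r \<odot>\<^bsub>M\<^esub> x) = r \<odot>\<^bsub>N\<^esub> f x)},
      monoid.mult = undefined, one = undefined,
      zero = (\<lambda>x\<in>carrier M. \<zero>\<^bsub>N\<^esub>),
      add = (\<lambda>f g. \<lambda>x\<in>carrier M. f x \<oplus>\<^bsub>N\<^esub> g x),
      smult = (\<lambda>r f. \<lambda>x\<in>carrier M. r \<odot>\<^bsub>N\<^esub> f x)\<rparr>"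


section \<open>Localization, support and dimension\<close>

text \<open>The class of the fraction \<open>x / s\<close> in the localization of \<open>M\<close> at the prime \<open>P\<close>.\<close>

definition fraction ::
    "('r, 'a) ring_scheme \<Rightarrow> 'r set \<Rightarrow> ('r, 'm, 'k) module_scheme \<Rightarrow> 'm \<Rightarrow> 'r \<Rightarrow> ('m \<times> 'r) set" where
  "fraction R P M x s =
     {(y, t). y \<in> carrier M \<and> t \<in> carrier R - P \<and>
        (\<exists>u \<in> carrier R - P. u \<odot>\<^bsub>M\<^esub> (t \<odot>\<^bsub>M\<^esub> x) = u \<odot>\<^bsub>M\<^esub> (s \<odot>\<^bsub>M\<^esub> y))}"

text \<open>Only the \<open>R\<close>-module structure of the localization is recorded.\<close>

definition localization ::
    "('r, 'a) ring_scheme \<Rightarrow> 'r set \<Rightarrow> ('r, 'm, 'k) module_scheme \<Rightarrow> ('r, ('m \<times> 'r) set) module" where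
  "localization R P M =
     \<lparr>carrier = {fraction R P M x s | x s. x \<in> carrier M \<and> s \<in> carrier R - P},
      monoid.mult = undefined, one = undefined,
      zero = fraction R P M \<zero>\<^bsub>M\<^esub> \<one>\<^bsub>R\<^esub>,
      add = (\<lambda>X Y. \<Union>(x, s)\<in>X. \<Union>(y, t)\<in>Y.
               fraction R P M (t \<odot>\<^bsub>M\<^esub> x \<oplus>\<^bsub>M\<^esub> s \<odot>\<^bsub>M\<^esub> y) (s \<otimes>\<^bsub>R\<^esub> t)),
      smult = (\<lambda>r X. \<Union>(x, s)\<in>X. fraction R P M (r \<odot>\<^bsub>M\<^esub> x) s)\<rparr>"

definition Supp :: "('r, 'a) ring_scheme \<Rightarrow> ('r, 'm, 'k) module_scheme \<Rightarrow> 'r set set" where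
  "Supp R M =
     {P. primeideal P R \<and> carrier (localization R P M) \<noteq> {\<zero>\<^bsub>localization R P M\<^esub>}}"

text \<open>The supremum is taken in \<^typ>\<open>ereal\<close>: the zero ring, having no primes, has dimension \<open>-\<infinity>\<close>.\<close>

definition krull_dim :: "('r, 'a) ring_scheme \<Rightarrow> ereal" where
  "krull_dim R =
     Sup {ereal (real k) | k. \<exists>P :: nat \<Rightarrow> 'r set.
            (\<forall>i\<le>k. primeideal (P i) R) \<and> (\<forall>i<k. P i \<subset> P (Suc i))}"

definition module_dim :: "('r, 'a) ring_scheme \<Rightarrow> ('r, 'm, 'k) module_scheme \<Rightarrow> ereal" where
  "module_dim R M = krull_dim (R Quot annihilator R M)"

definition noetherian_local_ring :: "('r, 'a) ring_scheme \<Rightarrow> 'r set \<Rightarrow> bool" where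
  "noetherian_local_ring R \<mm> \<longleftrightarrow>
     cring R \<and> noetherian_ring R \<and> maximalideal \<mm> R \<and> (\<forall>J. maximalideal J R \<longrightarrow> J = \<mm>)"


section \<open>The standard free resolution\<close>

definition free_module :: "('r, 'a) ring_scheme \<Rightarrow> 'x set \<Rightarrow> ('r, 'x \<Rightarrow> 'r) module" where
  "free_module R X =
     \<lparr>carrier = {h. range h \<subseteq> carrier R \<and> finite {x. h x \<noteq> \<zero>\<^bsub>R\<^esub>} \<and> {x. h x \<noteq> \<zero>\<^bsub>R\<^esub>} \<subseteq> X},
      monoid.mult = undefined, one = undefined,
      zero = (\<lambda>_. \<zero>\<^bsub>R\<^esub>),
      add = (\<lambda>g h x. g x \<oplus>\<^bsub>R\<^esub> h x),
      smult = (\<lambda>r h x. r \<otimes>\<^bsub>R\<^esub> h x)\<rparr>"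

definition free_basis :: "('r, 'a) ring_scheme \<Rightarrow> 'x \<Rightarrow> 'x \<Rightarrow> 'r" where
  "free_basis R x = (\<lambda>y. if y = x then \<one>\<^bsub>R\<^esub> else \<zero>\<^bsub>R\<^esub>)"

text \<open>The linear extension to a free module of a map \<open>g\<close>, given on the basis, into a module \<open>M\<close>.\<close>

definition lin_ext ::
    "('r, 'a) ring_scheme \<Rightarrow> ('r, 'm, 'k) module_scheme \<Rightarrow> ('x \<Rightarrow> 'm) \<Rightarrow> ('x \<Rightarrow> 'r) \<Rightarrow> 'm" where
  "lin_ext R M g h = (\<Oplus>\<^bsub>M\<^esub>x \<in> {x. h x \<noteq> \<zero>\<^bsub>R\<^esub>}. h x \<odot>\<^bsub>M\<^esub> g x)"

text \<open>The standard (functorial) free resolution of \<open>M\<close> is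
  \<open>\<dots> \<rightarrow> F\<^sub>2 \<rightarrow> F\<^sub>1 \<rightarrow> F\<^sub>0 \<rightarrow> M \<rightarrow> 0\<close>, where \<open>F\<^sub>0\<close> is free on the underlying set of \<open>M\<close>, \<open>F\<^sub>1\<close> is free
  on the underlying set of \<open>ker (F\<^sub>0 \<rightarrow> M)\<close>, and \<open>F\<^sub>n\<^sub>+\<^sub>1\<close> is free on the underlying set of
  \<open>ker (F\<^sub>n \<rightarrow> F\<^sub>n\<^sub>-\<^sub>1)\<close> for \<open>n > 0\<close>; every map sends a basis element to the element it stands for.

  The following datatype houses the bases of all the \<open>F\<^sub>n\<close> in one type. A finitely supported
  function \<open>h\<close> is encoded as the label \<open>Cycle\<close> of its graph over its support.\<close>

datatype ('r, 'm) res_gen = Elem 'm | Cycle "(('r, 'm) res_gen \<times> 'r) fset"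

definition cycle_gen ::
    "('r, 'a) ring_scheme \<Rightarrow> (('r, 'm) res_gen \<Rightarrow> 'r) \<Rightarrow> ('r, 'm) res_gen" where
  "cycle_gen R h = Cycle (Abs_fset {(x, h x) | x. h x \<noteq> \<zero>\<^bsub>R\<^esub>})"

definition gen_cycle ::
    "('r, 'a) ring_scheme \<Rightarrow> ('r, 'm) res_gen \<Rightarrow> (('r, 'm) res_gen \<Rightarrow> 'r)" where
  "gen_cycle R = the_inv_into (carrier (free_module R UNIV)) (cycle_gen R)"

primrec gen_elem :: "('r, 'm) res_gen \<Rightarrow> 'm" where
  "gen_elem (Elem x) = x"

definition res_augmentation ::
    "('r, 'a) ring_scheme \<Rightarrow> ('r, 'm, 'k) module_scheme \<Rightarrow> (('r, 'm) res_gen \<Rightarrow> 'r) \<Rightarrow> 'm" where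
  "res_augmentation R M = lin_ext R M gen_elem"

text \<open>The differential \<open>F\<^sub>n\<^sub>+\<^sub>1 \<rightarrow> F\<^sub>n\<close> is given by the same formula for all \<open>n\<close>.\<close>

definition res_boundary ::
    "('r, 'a) ring_scheme \<Rightarrow> (('r, 'm) res_gen \<Rightarrow> 'r) \<Rightarrow> (('r, 'm) res_gen \<Rightarrow> 'r)" where
  "res_boundary R = lin_ext R (free_module R UNIV) (gen_cycle R)"

primrec res_basis ::
    "('r, 'a) ring_scheme \<Rightarrow> ('r, 'm, 'k) module_scheme \<Rightarrow> nat \<Rightarrow> ('r, 'm) res_gen set" where
  "res_basis R M 0 = Elem ` carrier M"
| "res_basis R M (Suc n) =
     cycle_gen R ` {h \<in> carrier (free_module R (res_basis R M n)).
       if n = 0 then res_augmentation R M h = \<zero>\<^bsub>M\<^esub>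
       else res_boundary R h = \<zero>\<^bsub>free_module R (UNIV :: ('r, 'm) res_gen set)\<^esub>}"

definition std_res ::
    "('r, 'a) ring_scheme \<Rightarrow> ('r, 'm, 'k) module_scheme \<Rightarrow> nat \<Rightarrow> ('r, ('r, 'm) res_gen \<Rightarrow> 'r) module"
  where "std_res R M n = free_module R (res_basis R M n)"

text \<open>The chain map induced by a homomorphism \<open>f\<close>: the linear map sending the basis element that
  stands for \<open>z\<close> to the basis element that stands for the image of \<open>z\<close> one degree lower.\<close>

definition free_map ::
    "('r, 'a) ring_scheme \<Rightarrow> ('x \<Rightarrow> 'y) \<Rightarrow> ('x \<Rightarrow> 'r) \<Rightarrow> ('y \<Rightarrow> 'r)" where
  "free_map R \<sigma> = lin_ext R (free_module R UNIV) (\<lambda>x. free_basis R (\<sigma> x))"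

primrec res_gen_map ::
    "('r, 'a) ring_scheme \<Rightarrow> ('m \<Rightarrow> 'p) \<Rightarrow> nat \<Rightarrow> ('r, 'm) res_gen \<Rightarrow> ('r, 'p) res_gen" where
  "res_gen_map R f 0 = (\<lambda>c. Elem (f (gen_elem c)))"
| "res_gen_map R f (Suc n) =
     (\<lambda>c. cycle_gen R (free_map R (res_gen_map R f n) (gen_cycle R c)))"

definition std_res_map ::
    "('r, 'a) ring_scheme \<Rightarrow> ('m \<Rightarrow> 'p) \<Rightarrow> nat
      \<Rightarrow> (('r, 'm) res_gen \<Rightarrow> 'r) \<Rightarrow> (('r, 'p) res_gen \<Rightarrow> 'r)" where
  "std_res_map R f n = free_map R (res_gen_map R f n)"


section \<open>Ext\<close>

definition ext_coboundary ::
    "('r, 'a) ring_scheme \<Rightarrow> ('r, 'm, 'k) module_scheme \<Rightarrow> nat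
      \<Rightarrow> ((('r, 'm) res_gen \<Rightarrow> 'r) \<Rightarrow> 'n) \<Rightarrow> ((('r, 'm) res_gen \<Rightarrow> 'r) \<Rightarrow> 'n)" where
  "ext_coboundary R M j \<phi> = (\<lambda>h \<in> carrier (std_res R M (Suc j)). \<phi> (res_boundary R h))"

definition ext_cochains ::
    "('r, 'a) ring_scheme \<Rightarrow> ('r, 'm, 'k) module_scheme \<Rightarrow> ('r, 'n, 'l) module_scheme \<Rightarrow> nat
      \<Rightarrow> ('r, (('r, 'm) res_gen \<Rightarrow> 'r) \<Rightarrow> 'n) module" where
  "ext_cochains R M N j = hom_module R (std_res R M j) N"

definition ext_cocycles ::
    "('r, 'a) ring_scheme \<Rightarrow> ('r, 'm, 'k) module_scheme \<Rightarrow> ('r, 'n, 'l) module_scheme \<Rightarrow> nat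
      \<Rightarrow> ((('r, 'm) res_gen \<Rightarrow> 'r) \<Rightarrow> 'n) set" where
  "ext_cocycles R M N j =
     {\<phi> \<in> carrier (ext_cochains R M N j).
        ext_coboundary R M j \<phi> = \<zero>\<^bsub>ext_cochains R M N (Suc j)\<^esub>}"

primrec ext_coboundaries ::
    "('r, 'a) ring_scheme \<Rightarrow> ('r, 'm, 'k) module_scheme \<Rightarrow> ('r, 'n, 'l) module_scheme \<Rightarrow> nat
      \<Rightarrow> ((('r, 'm) res_gen \<Rightarrow> 'r) \<Rightarrow> 'n) set" where
  "ext_coboundaries R M N 0 = {\<zero>\<^bsub>ext_cochains R M N 0\<^esub>}"
| "ext_coboundaries R M N (Suc j) = ext_coboundary R M j ` carrier (ext_cochains R M N j)"

definition Ext ::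
    "('r, 'a) ring_scheme \<Rightarrow> nat \<Rightarrow> ('r, 'm, 'k) module_scheme \<Rightarrow> ('r, 'n, 'l) module_scheme
      \<Rightarrow> ('r, ((('r, 'm) res_gen \<Rightarrow> 'r) \<Rightarrow> 'n) set) module" where
  "Ext R j M N =
     quotient_module ((ext_cochains R M N j)\<lparr>carrier := ext_cocycles R M N j\<rparr>)
       (ext_coboundaries R M N j)"

text \<open>The map \<open>Ext\<^sup>j(M', N) \<rightarrow> Ext\<^sup>j(M, N)\<close> induced by \<open>f : M \<rightarrow> M'\<close>.\<close>

definition Ext_map ::
    "('r, 'a) ring_scheme \<Rightarrow> nat \<Rightarrow> ('r, 'm, 'k) module_scheme \<Rightarrow> ('m \<Rightarrow> 'p)
      \<Rightarrow> ('r, 'n, 'l) module_scheme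
      \<Rightarrow> ((('r, 'p) res_gen \<Rightarrow> 'r) \<Rightarrow> 'n) set \<Rightarrow> ((('r, 'm) res_gen \<Rightarrow> 'r) \<Rightarrow> 'n) set" where
  "Ext_map R j M f N X =
     (\<Union>\<phi>\<in>X. ext_coboundaries R M N j +>\<^bsub>ext_cochains R M N j\<^esub>
                (\<lambda>h \<in> carrier (std_res R M j). \<phi> (std_res_map R f j h)))"


section \<open>Generalized local cohomology\<close>

text \<open>The direct limit of a sequence of modules \<open>A n\<close> with transition maps
  \<open>t m n : A m \<rightarrow> A n\<close> for \<open>m \<le> n\<close>.\<close>

definition limit_class ::
    "(nat \<Rightarrow> ('r, 'b, 'k) module_scheme) \<Rightarrow> (nat \<Rightarrow> nat \<Rightarrow> 'b \<Rightarrow> 'b) \<Rightarrow> nat \<Rightarrow> 'b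
      \<Rightarrow> (nat \<times> 'b) set" where
  "limit_class A t m x =
     {(n, y). y \<in> carrier (A n) \<and> (\<exists>k\<ge>max m n. t m k x = t n k y)}"

definition direct_limit ::
    "(nat \<Rightarrow> ('r, 'b, 'k) module_scheme) \<Rightarrow> (nat \<Rightarrow> nat \<Rightarrow> 'b \<Rightarrow> 'b)
      \<Rightarrow> ('r, (nat \<times> 'b) set) module" where
  "direct_limit A t =
     \<lparr>carrier = {limit_class A t m x | m x. x \<in> carrier (A m)},
      monoid.mult = undefined, one = undefined,
      zero = limit_class A t 0 \<zero>\<^bsub>A 0\<^esub>,
      add = (\<lambda>X Y. \<Union>(m, x)\<in>X. \<Union>(n, y)\<in>Y.
               limit_class A t (max m n) (t m (max m n) x \<oplus>\<^bsub>A (max m n)\<^esub> t n (max m n) y)),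
      smult = (\<lambda>r X. \<Union>(m, x)\<in>X. limit_class A t m (r \<odot>\<^bsub>A m\<^esub> x))\<rparr>"

definition power_smult ::
    "('r, 'a) ring_scheme \<Rightarrow> 'r set \<Rightarrow> ('r, 'm, 'k) module_scheme \<Rightarrow> nat \<Rightarrow> 'm set" where
  "power_smult R I M n = ideal_smult R (I [^]\<^bsub>ideals_set R\<^esub> n) M"

text \<open>The transition map from index \<open>m\<close> to index \<open>n \<ge> m\<close> is induced by the projection
  \<open>M / I\<^sup>n M \<rightarrow> M / I\<^sup>m M\<close>, which sends a coset \<open>X\<close> to the coset \<open>I\<^sup>m M + X\<close>.\<close>

definition gen_local_cohomology ::
    "('r, 'a) ring_scheme \<Rightarrow> 'r set \<Rightarrow> nat \<Rightarrow> ('r, 'm, 'k) module_scheme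
      \<Rightarrow> ('r, 'n, 'l) module_scheme
      \<Rightarrow> ('r, (nat \<times> ((('r, 'm set) res_gen \<Rightarrow> 'r) \<Rightarrow> 'n) set) set) module" where
  "gen_local_cohomology R I j M N =
     direct_limit
       (\<lambda>n. Ext R j (quotient_module M (power_smult R I M n)) N)
       (\<lambda>m n. Ext_map R j (quotient_module M (power_smult R I M n))
                (\<lambda>X. power_smult R I M m <+>\<^bsub>M\<^esub> X) N)"

definition local_cohomology ::
    "('r, 'a) ring_scheme \<Rightarrow> 'r set \<Rightarrow> nat \<Rightarrow> ('r, 'n, 'l) module_scheme
      \<Rightarrow> ('r, (nat \<times> ((('r, 'r set) res_gen \<Rightarrow> 'r) \<Rightarrow> 'n) set) set) module" where
  "local_cohomology R I j N = gen_local_cohomology R I j (regular_module R) N"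

end

theory Submission
  imports Defs
begin

text \<open>All three unions are the set of primes \<open>P\<close> containing \<open>I\<^sub>M\<close> and \<open>ann N\<close>; as \<open>ann (R/I\<^sub>M) = I\<^sub>M\<close>, one
  argument covers ordinary and generalized local cohomology.

  Every element of \<open>ann A\<close> or \<open>ann N\<close> kills \<open>Ext(A, N)\<close>, and \<open>r\<^sup>n\<close> kills \<open>M/I\<^sup>nM\<close> for \<open>r \<in> I\<^sub>M\<close>; so a prime in
  the support contains \<open>I\<^sub>M\<close> and \<open>ann N\<close>. Conversely, for such a \<open>P\<close>, one finds by Noetherian induction
  on the submodule \<open>K\<close> of \<open>N\<close> a chain of primes \<open>(K : N) \<subseteq> Q\<^sub>0 \<subset> \<dots> \<subset> Q\<^sub>j \<subseteq> P\<close> whose length \<open>j\<close> is a degree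
  in which the cohomology of \<open>N/K\<close> survives at \<open>P\<close>. If some \<open>x \<in> I\<^sub>M\<close> is regular on \<open>N/K\<close> locally at \<open>P\<close>, pass to
  \<open>K + xN\<close>: the long exact sequence moves the degree by at most one, and a move is paid for by a prime below
  \<open>Q\<^sub>0\<close> that avoids \<open>x\<close>. Otherwise prime avoidance puts \<open>I\<^sub>M\<close> into an associated prime \<open>Q = (K : z)\<close>, and a map
  \<open>M/IM \<rightarrow> R/Q \<rightarrow> N/K\<close> is nonzero in degree \<open>0\<close>. Only the long exact sequence in the second variable occurs.\<close>

section \<open>Prime ideals and associated primes\<close>

text \<open>No vanishing theorem above dim N enters: the bound \<open>n\<close> comes from the
  chain. For K = 0 its primes contain ann N, so its length is at most dim N, and one surviving
  degree per prime makes the unions over all j and over the j up to n agree. In the induction no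
  localization of N/K is formed: being zero at P means being killed by one s outside P, and a chase
  multiplies such elements up. The new prime exists for this reason. As x kills N/(K + xN), it lies
  in the lowest prime Q_0 of the chain for K + xN. On the other hand x is regular on N/K at Q_0 too,
  since the s belonging to P is outside Q_0. Inverting x thus leaves a nonzero module, and a prime
  of its support lies above (K : N), inside Q_0, and avoids x. Nakayama's lemma keeps (K + xN : N)
  inside P, so the induction hypothesis applies to K + xN. In degree 0 the transition maps restrict
  homomorphisms along surjections M/I^nM to M/I^mM; they are injective, also locally at P, so a
  nonzero homomorphism survives in the limit.\<close>

lemma primeideal_notin_mult:
  assumes "primeideal P R" "a \<in> carrier R - P" "b \<in> carrier R - P"
  shows "a \<otimes>\<^bsub>R\<^esub> b \<in> carrier R - P"
proof -
  interpret primeideal P R by fact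
  show ?thesis using assms(2,3) I_prime by auto
qed

lemma primeideal_one_notin:
  assumes "primeideal P R"
  shows "\<one>\<^bsub>R\<^esub> \<in> carrier R - P"
proof -
  interpret primeideal P R by fact
  show ?thesis using I_notcarr one_imp_carrier by auto
qed

lemma (in abelian_monoid) add_add_swap:
  assumes "a \<in> carrier G" "b \<in> carrier G" "c \<in> carrier G" "d \<in> carrier G"
  shows "(a \<oplus> b) \<oplus> (c \<oplus> d) = (a \<oplus> c) \<oplus> (b \<oplus> d)"
  using assms by (simp add: a_assoc a_lcomm)

lemma (in abelian_group) diff_zero:
  assumes "a \<in> carrier G"
  shows "a \<ominus> \<zero> = a"
proof -
  have "\<ominus> \<zero> = \<zero>" using r_neg[of \<zero>] l_zero[of "\<ominus> \<zero>"] by simp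
  then show ?thesis using assms by (simp add: a_minus_def)
qed

lemma (in abelian_group) diff_add_cancel:
  assumes "a \<in> carrier G" "b \<in> carrier G"
  shows "a \<ominus> b \<oplus> b = a"
  using assms by (simp add: a_minus_def a_assoc l_neg)

lemma (in abelian_group) diff_diff_cancel:
  assumes "a \<in> carrier G" "b \<in> carrier G"
  shows "a \<ominus> (a \<ominus> b) = b"
proof -
  have "a \<ominus> (a \<ominus> b) = (a \<oplus> \<ominus> a) \<oplus> b" using assms by (simp add: a_minus_def minus_add a_assoc)
  then show ?thesis using assms by (simp add: r_neg)
qed

lemma (in abelian_group) diff_eq_zero_iff:
  assumes "a \<in> carrier G" "b \<in> carrier G"
  shows "a \<ominus> b = \<zero> \<longleftrightarrow> a = b"
proof
  assume "a \<ominus> b = \<zero>"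
  then show "a = b" using diff_add_cancel[OF assms] assms by simp
qed (use assms in \<open>simp add: a_minus_def r_neg\<close>)

lemma (in module) submoduleI_smult:
  assumes "H \<subseteq> carrier M" "\<zero>\<^bsub>M\<^esub> \<in> H" "\<And>a b. a \<in> H \<Longrightarrow> b \<in> H \<Longrightarrow> a \<oplus>\<^bsub>M\<^esub> b \<in> H"
    and smult: "\<And>a x. a \<in> carrier R \<Longrightarrow> x \<in> H \<Longrightarrow> a \<odot>\<^bsub>M\<^esub> x \<in> H"
  shows "submodule H R M"
proof (rule submoduleI[OF assms(1,2) _ assms(3,4)])
  fix x assume x: "x \<in> H"
  then have "x \<in> carrier M" using assms(1) by blast
  then have "\<ominus>\<^bsub>M\<^esub> x = (\<ominus> \<one>) \<odot>\<^bsub>M\<^esub> x" by (simp add: smult_l_minus)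
  then show "\<ominus>\<^bsub>M\<^esub> x \<in> H" using smult[OF _ x] by simp
qed

text \<open>The union of a nonempty chain of ideals in a Noetherian ring is a member of the chain,
  so it stays in \<open>S\<close> and Zorn's lemma applies to an arbitrary nonempty family.\<close>

lemma (in noetherian_ring) maximal_ideal_exists:
  assumes "S \<noteq> {}" "\<And>J. J \<in> S \<Longrightarrow> ideal J R"
  shows "\<exists>Q\<in>S. \<forall>J\<in>S. Q \<subseteq> J \<longrightarrow> J = Q"
proof (rule subset_Zorn_nonempty[OF assms(1)])
  fix C assume C: "C \<noteq> {}" "subset.chain S C"
  then have "subset.chain {I. ideal I R} C"
    using assms(2) by (auto simp: subset.chain_def)
  then have "\<Union>C \<in> C" using ideal_chain_is_trivial C(1) by blast
  then show "\<Union>C \<in> S" using C(2) by (auto simp: subset.chain_def)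
qed

text \<open>Q is maximal among the ideals that contain \<open>J\<close> and miss the
  multiplicatively closed \<open>S\<close>. For a, b outside Q both Q + (a) and Q + (b) meet
  \<open>S\<close>; the product of two meeting elements lies in Q + (ab), hence would lie in Q if ab
  did.\<close>

lemma (in cring) prime_ideal_disjoint:
  assumes "noetherian_ring R" "ideal J R" "S \<subseteq> carrier R" "S \<noteq> {}" "J \<inter> S = {}"
    and mult: "\<And>a b. a \<in> S \<Longrightarrow> b \<in> S \<Longrightarrow> a \<otimes> b \<in> S"
  obtains Q where "primeideal Q R" "J \<subseteq> Q" "Q \<inter> S = {}"
proof -
  interpret noetherian_ring R by fact
  have "\<exists>Q\<in>{Q. ideal Q R \<and> J \<subseteq> Q \<and> Q \<inter> S = {}}.
      \<forall>L\<in>{Q. ideal Q R \<and> J \<subseteq> Q \<and> Q \<inter> S = {}}. Q \<subseteq> L \<longrightarrow> L = Q"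
    using assms(2,5) by (intro maximal_ideal_exists) auto
  then obtain Q where Q: "ideal Q R" "J \<subseteq> Q" "Q \<inter> S = {}"
    and max: "\<And>L. ideal L R \<Longrightarrow> J \<subseteq> L \<Longrightarrow> L \<inter> S = {} \<Longrightarrow> Q \<subseteq> L \<Longrightarrow> L = Q"
    by (smt (verit) mem_Collect_eq)
  interpret Q: ideal Q R using Q by simp
  have big: "\<exists>q\<in>Q. \<exists>r\<in>carrier R. q \<oplus> r \<otimes> a \<in> S" if a: "a \<in> carrier R" "a \<notin> Q" for a
  proof -
    have pa: "ideal (PIdl a) R" using a cgenideal_ideal by simp
    have "ideal (Q <+>\<^bsub>R\<^esub> PIdl a) R" by (rule add_ideals) (use Q pa in auto)
    moreover have sub: "Q \<subseteq> Q <+>\<^bsub>R\<^esub> PIdl a"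
    proof
      fix q assume "q \<in> Q"
      then have "q = q \<oplus> \<zero>" "\<zero> \<in> PIdl a"
        using ideal.Icarr[OF Q.is_ideal] additive_subgroup.zero_closed[OF ideal.axioms(1)[OF pa]] by auto
      then show "q \<in> Q <+>\<^bsub>R\<^esub> PIdl a" using \<open>q \<in> Q\<close> unfolding set_add_def' by blast
    qed
    moreover have "a \<in> Q <+>\<^bsub>R\<^esub> PIdl a"
    proof -
      have "a = \<zero> \<oplus> a" "a \<in> PIdl a" "\<zero> \<in> Q" using a cgenideal_self by auto
      then show ?thesis unfolding set_add_def' by blast
    qed
    ultimately have "(Q <+>\<^bsub>R\<^esub> PIdl a) \<inter> S \<noteq> {}"
      using max[of "Q <+>\<^bsub>R\<^esub> PIdl a"] a Q by auto
    then show ?thesis unfolding set_add_def' cgenideal_def by blast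
  qed
  have "primeideal Q R"
  proof (rule primeidealI[OF Q.is_ideal cring_axioms])
    show "carrier R \<noteq> Q" using assms(3,4) Q by auto
    fix a b assume ab: "a \<in> carrier R" "b \<in> carrier R" "a \<otimes> b \<in> Q"
    show "a \<in> Q \<or> b \<in> Q"
    proof (rule ccontr)
      assume "\<not> (a \<in> Q \<or> b \<in> Q)"
      then obtain q r q' r' where 1: "q \<in> Q" "r \<in> carrier R" "q \<oplus> r \<otimes> a \<in> S"
        "q' \<in> Q" "r' \<in> carrier R" "q' \<oplus> r' \<otimes> b \<in> S"
        using big ab by metis
      have qc: "q \<in> carrier R" "q' \<in> carrier R" using 1 Q.Icarr by auto
      have "(q \<oplus> r \<otimes> a) \<otimes> (q' \<oplus> r' \<otimes> b)
         = (q \<otimes> (q' \<oplus> r' \<otimes> b)) \<oplus> (q' \<otimes> (r \<otimes> a)) \<oplus> ((r \<otimes> r') \<otimes> (a \<otimes> b))"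
        using 1 ab qc by algebra
      also have "\<dots> \<in> Q"
      proof (intro Q.a_closed)
        show "q \<otimes> (q' \<oplus> r' \<otimes> b) \<in> Q" using 1 ab qc by (rule_tac Q.I_r_closed) auto
        show "q' \<otimes> (r \<otimes> a) \<in> Q" using 1 ab qc by (rule_tac Q.I_r_closed) auto
        show "(r \<otimes> r') \<otimes> (a \<otimes> b) \<in> Q" using 1 ab by (rule_tac Q.I_l_closed) simp_all
      qed
      finally show False using mult[OF 1(3,6)] Q by auto
    qed
  qed
  then show thesis using that Q by blast
qed

text \<open>If no member contains \<open>J\<close>, then by induction no proper subfamily covers
  \<open>J\<close>. For a fixed member Q, some a in \<open>J\<close> avoids all other members and so
  lies in Q, and some b in \<open>J\<close> lies in all others but not in Q; then a + b is in
  \<open>J\<close> and in no member.\<close>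

lemma prime_avoidance:
  assumes "finite \<Q>" "\<And>Q. Q \<in> \<Q> \<Longrightarrow> primeideal Q R" "ideal J R" "J \<subseteq> \<Union>\<Q>"
  shows "\<exists>Q\<in>\<Q>. J \<subseteq> Q"
  using assms
proof (induction \<Q> rule: finite_psubset_induct)
  case (psubset \<Q>)
  interpret J: ideal J R by fact
  show ?case
  proof (rule ccontr)
    assume no: "\<not> ?case"
    obtain Q where Q: "Q \<in> \<Q>" using subsetD[OF psubset.prems(3) additive_subgroup.zero_closed[OF J.additive_subgroup_axioms]]
    by (elim UnionE)
    interpret Q: primeideal Q R using psubset.prems Q by auto
    have sub: "\<not> J \<subseteq> \<Union>\<T>" if "\<T> \<subset> \<Q>" for \<T>
      using psubset.IH[OF that] psubset.prems no that by blast
    \<comment> \<open>A member contained in Q could be dropped from the cover.\<close>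
    have anti: "\<not> Q' \<subseteq> Q" if "Q' \<in> \<Q> - {Q}" for Q'
    proof
      assume "Q' \<subseteq> Q"
      then have "\<Union>(\<Q> - {Q'}) = \<Union>\<Q>" using that Q by auto
      then show False using sub[of "\<Q> - {Q'}"] that psubset.prems(3) by auto
    qed
    \<comment> \<open>b is a product of one element of \<open>J\<close> outside Q and, for each
      other member Q', one element of Q' outside Q; it stays outside Q because Q is prime.\<close>
    have pr: "\<exists>b \<in> J - Q. \<forall>Q'\<in>\<T>. b \<in> Q'" if "finite \<T>" "\<T> \<subseteq> \<Q> - {Q}" for \<T>
      using that
    proof (induction \<T>)
      case empty
      then show ?case using no Q by blast
    next
      case (insert Q' \<T>)
      then obtain b where b: "b \<in> J - Q" "\<forall>Q'\<in>\<T>. b \<in> Q'" by auto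
      obtain c where c: "c \<in> Q'" "c \<notin> Q" using anti[of Q'] insert.prems by auto
      interpret Q': ideal Q' R using psubset.prems insert.prems primeideal.axioms(1) by auto
      have carr: "b \<in> carrier R" "c \<in> carrier R" using b c J.Icarr Q'.Icarr by auto
      have "b \<otimes>\<^bsub>R\<^esub> c \<in> J - Q" using b c carr Q.I_prime J.I_r_closed by blast
      moreover have "b \<otimes>\<^bsub>R\<^esub> c \<in> Q''" if "Q'' \<in> insert Q' \<T>" for Q''
      proof (cases "Q'' = Q'")
        case True then show ?thesis using Q'.I_l_closed c carr by auto
      next
        case False
        then have "Q'' \<in> \<Q>" "b \<in> Q''" using that b insert.prems by auto
        then have "ideal Q'' R" "b \<in> Q''" using psubset.prems(1) primeideal.axioms(1) by auto
        then show ?thesis using carr ideal.I_r_closed by metis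
      qed
      ultimately show ?case by blast
    qed
    obtain b where b: "b \<in> J" "b \<notin> Q" "\<forall>Q'\<in>\<Q> - {Q}. b \<in> Q'"
      using pr[of "\<Q> - {Q}"] psubset.hyps by auto
    obtain a where a: "a \<in> J" "a \<notin> \<Union>(\<Q> - {Q})" using sub[of "\<Q> - {Q}"] Q by auto
    have aQ: "a \<in> Q" using a psubset.prems(3) by auto
    have carr: "a \<in> carrier R" "b \<in> carrier R" using a b J.Icarr by auto
    have "a \<oplus>\<^bsub>R\<^esub> b \<in> J" using a b by auto
    then obtain Q' where Q': "Q' \<in> \<Q>" "a \<oplus>\<^bsub>R\<^esub> b \<in> Q'" using psubset.prems(3) by auto
    interpret Q': primeideal Q' R using psubset.prems Q' by auto
    show False
    proof (cases "Q' = Q")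
      case True
      then have "(a \<oplus>\<^bsub>R\<^esub> b) \<ominus>\<^bsub>R\<^esub> a \<in> Q" using Q' aQ by (simp add: a_minus_def)
      moreover have "(a \<oplus>\<^bsub>R\<^esub> b) \<ominus>\<^bsub>R\<^esub> a = b" using carr by algebra
      ultimately show False using b by simp
    next
      case False
      then have "(a \<oplus>\<^bsub>R\<^esub> b) \<ominus>\<^bsub>R\<^esub> b \<in> Q'" using Q' b by (simp add: a_minus_def)
      moreover have "(a \<oplus>\<^bsub>R\<^esub> b) \<ominus>\<^bsub>R\<^esub> b = a" using carr by algebra
      ultimately show False using a False Q' by auto
    qed
  qed
qed

section \<open>Colon ideals, that is, annihilators in M/K, and enlargements of a submodule\<close>

definition colon :: "('r, 'a) ring_scheme \<Rightarrow> ('r, 'm, 'k) module_scheme \<Rightarrow> 'm set \<Rightarrow> 'm \<Rightarrow> 'r set" where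
  "colon R M K y = {r \<in> carrier R. r \<odot>\<^bsub>M\<^esub> y \<in> K}"

definition colon_all :: "('r, 'a) ring_scheme \<Rightarrow> ('r, 'm, 'k) module_scheme \<Rightarrow> 'm set \<Rightarrow> 'r set" where
  "colon_all R M K = {r \<in> carrier R. \<forall>y \<in> carrier M. r \<odot>\<^bsub>M\<^esub> y \<in> K}"

definition add_span :: "('r, 'a) ring_scheme \<Rightarrow> ('r, 'm, 'k) module_scheme \<Rightarrow> 'm set \<Rightarrow> 'm \<Rightarrow> 'm set" where
  "add_span R M K y = {k \<oplus>\<^bsub>M\<^esub> r \<odot>\<^bsub>M\<^esub> y | k r. k \<in> K \<and> r \<in> carrier R}"

definition add_mult :: "('r, 'm, 'k) module_scheme \<Rightarrow> 'm set \<Rightarrow> 'r \<Rightarrow> 'm set" where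
  "add_mult M K x = {k \<oplus>\<^bsub>M\<^esub> x \<odot>\<^bsub>M\<^esub> y | k y. k \<in> K \<and> y \<in> carrier M}"

context module begin

lemma submodule_diff:
  assumes "submodule H R M" "a \<in> H" "b \<in> H"
  shows "a \<ominus>\<^bsub>M\<^esub> b \<in> H"
  using submoduleE[OF assms(1)] assms(2,3) by (simp add: a_minus_def)

lemma submodule_zero:
  assumes "submodule H R M"
  shows "\<zero>\<^bsub>M\<^esub> \<in> H"
proof -
  interpret subgroup H "add_monoid M" using submodule.axioms(1)[OF assms] .
  show ?thesis using one_closed by simp
qed

lemma submodule_cancel:
  assumes "submodule H R M" "a \<in> carrier M" "b \<in> H" "a \<oplus>\<^bsub>M\<^esub> b \<in> H"
  shows "a \<in> H"
proof -
  have "a \<oplus>\<^bsub>M\<^esub> b \<ominus>\<^bsub>M\<^esub> b \<in> H" using submodule_diff assms by blast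
  moreover have "b \<in> carrier M" using assms submoduleE(1) by blast
  ultimately show ?thesis using assms(2) by (simp add: a_minus_def M.a_assoc M.r_neg)
qed

lemma smult_minus:
  assumes "a \<in> carrier R" "x \<in> carrier M" "y \<in> carrier M"
  shows "a \<odot>\<^bsub>M\<^esub> (x \<ominus>\<^bsub>M\<^esub> y) = a \<odot>\<^bsub>M\<^esub> x \<ominus>\<^bsub>M\<^esub> a \<odot>\<^bsub>M\<^esub> y"
  using assms by (simp add: a_minus_def smult_r_distr smult_r_minus)

lemma minus_smult:
  assumes "a \<in> carrier R" "b \<in> carrier R" "x \<in> carrier M"
  shows "(a \<ominus> b) \<odot>\<^bsub>M\<^esub> x = a \<odot>\<^bsub>M\<^esub> x \<ominus>\<^bsub>M\<^esub> b \<odot>\<^bsub>M\<^esub> x"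
  using assms by (simp add: a_minus_def smult_l_distr smult_l_minus)

lemma smult_commute:
  assumes "a \<in> carrier R" "b \<in> carrier R" "x \<in> carrier M"
  shows "a \<odot>\<^bsub>M\<^esub> (b \<odot>\<^bsub>M\<^esub> x) = b \<odot>\<^bsub>M\<^esub> (a \<odot>\<^bsub>M\<^esub> x)"
  using assms by (metis m_comm smult_assoc1)

lemma colon_ideal:
  assumes "submodule K R M" "y \<in> carrier M"
  shows "ideal (colon R M K y) R"
proof (rule idealI[OF R.ring_axioms])
  note E = submoduleE[OF assms(1)] submodule_zero[OF assms(1)]
  show "subgroup (colon R M K y) (add_monoid R)"
    unfolding colon_def
    apply (rule group.subgroupI[OF R.add.group_axioms])
    using E assms by (auto simp: smult_l_distr smult_l_minus  simp flip: a_inv_def)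
next
  note E = submoduleE[OF assms(1)]
  fix a x assume a: "a \<in> colon R M K y" "x \<in> carrier R"
  then show "x \<otimes> a \<in> colon R M K y" using E assms by (auto simp: colon_def smult_assoc1)
  then show "a \<otimes> x \<in> colon R M K y" using a by (auto simp: colon_def m_comm)
qed

lemma colon_all_ideal:
  assumes "submodule K R M"
  shows "ideal (colon_all R M K) R"
proof (rule idealI[OF R.ring_axioms])
  note E = submoduleE[OF assms(1)] submodule_zero[OF assms(1)]
  show "subgroup (colon_all R M K) (add_monoid R)"
    unfolding colon_all_def
    apply (rule group.subgroupI[OF R.add.group_axioms])
    using E assms by (auto simp: smult_l_distr smult_l_minus  simp flip: a_inv_def)
next
  note E = submoduleE[OF assms(1)]
  fix a x assume a: "a \<in> colon_all R M K" "x \<in> carrier R"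
  then show "x \<otimes> a \<in> colon_all R M K" using E assms by (auto simp: colon_all_def smult_assoc1)
  then show "a \<otimes> x \<in> colon_all R M K" using a by (auto simp: colon_all_def m_comm)
qed

lemma add_span_submodule:
  assumes "submodule K R M" "y \<in> carrier M"
  shows "submodule (add_span R M K y) R M" and "K \<subseteq> add_span R M K y" and "y \<in> add_span R M K y"
proof -
  note E = submoduleE[OF assms(1)]
  have Kc: "\<And>x. x \<in> K \<Longrightarrow> x \<in> carrier M" using E by auto
  show "K \<subseteq> add_span R M K y"
  proof
    fix k assume "k \<in> K"
    then have "k = k \<oplus>\<^bsub>M\<^esub> \<zero> \<odot>\<^bsub>M\<^esub> y" using Kc assms by simp
    then show "k \<in> add_span R M K y" using \<open>k \<in> K\<close> unfolding add_span_def by blast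
  qed
  then have z: "\<zero>\<^bsub>M\<^esub> \<in> add_span R M K y" using submodule_zero[OF assms(1)] by auto
  have "y = \<zero>\<^bsub>M\<^esub> \<oplus>\<^bsub>M\<^esub> \<one> \<odot>\<^bsub>M\<^esub> y" using assms by simp
  then show "y \<in> add_span R M K y" using submodule_zero[OF assms(1)] unfolding add_span_def by blast
  show "submodule (add_span R M K y) R M"
  proof (rule submoduleI[OF _ z])
    show "add_span R M K y \<subseteq> carrier M" using Kc assms by (auto simp: add_span_def)
  next
    fix a assume "a \<in> add_span R M K y"
    then obtain k r where 1: "k \<in> K" "r \<in> carrier R" "a = k \<oplus>\<^bsub>M\<^esub> r \<odot>\<^bsub>M\<^esub> y" unfolding add_span_def by blast
    then have "\<ominus>\<^bsub>M\<^esub> a = \<ominus>\<^bsub>M\<^esub> k \<oplus>\<^bsub>M\<^esub> (\<ominus> r) \<odot>\<^bsub>M\<^esub> y" using assms Kc by (simp add: smult_l_minus M.minus_add)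
    then show "\<ominus>\<^bsub>M\<^esub> a \<in> add_span R M K y" using 1 E unfolding add_span_def by blast
    fix c assume c: "c \<in> carrier R"
    then have "c \<odot>\<^bsub>M\<^esub> a = c \<odot>\<^bsub>M\<^esub> k \<oplus>\<^bsub>M\<^esub> (c \<otimes> r) \<odot>\<^bsub>M\<^esub> y" using 1 assms Kc by (simp add: smult_r_distr smult_assoc1)
    then show "c \<odot>\<^bsub>M\<^esub> a \<in> add_span R M K y" using 1 E c unfolding add_span_def by blast
  next
    fix a b assume "a \<in> add_span R M K y" "b \<in> add_span R M K y"
    then obtain k r l s where 1: "k \<in> K" "r \<in> carrier R" "a = k \<oplus>\<^bsub>M\<^esub> r \<odot>\<^bsub>M\<^esub> y"
      "l \<in> K" "s \<in> carrier R" "b = l \<oplus>\<^bsub>M\<^esub> s \<odot>\<^bsub>M\<^esub> y" unfolding add_span_def by blast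
    then have "a \<oplus>\<^bsub>M\<^esub> b = (k \<oplus>\<^bsub>M\<^esub> l) \<oplus>\<^bsub>M\<^esub> (r \<oplus> s) \<odot>\<^bsub>M\<^esub> y"
      using assms(2) Kc M.add_add_swap[of k "r \<odot>\<^bsub>M\<^esub> y" l "s \<odot>\<^bsub>M\<^esub> y"] by (simp add: smult_l_distr)
    moreover have "k \<oplus>\<^bsub>M\<^esub> l \<in> K" "r \<oplus> s \<in> carrier R" using 1 E(5) by auto
    ultimately show "a \<oplus>\<^bsub>M\<^esub> b \<in> add_span R M K y" unfolding add_span_def by blast
  qed
qed

lemma add_mult_submodule:
  assumes "submodule K R M" "x \<in> carrier R"
  shows "submodule (add_mult M K x) R M" and "K \<subseteq> add_mult M K x"
    and "\<And>y. y \<in> carrier M \<Longrightarrow> x \<odot>\<^bsub>M\<^esub> y \<in> add_mult M K x"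
proof -
  note E = submoduleE[OF assms(1)]
  have Kc: "\<And>x. x \<in> K \<Longrightarrow> x \<in> carrier M" using E by auto
  show "K \<subseteq> add_mult M K x"
  proof
    fix k assume "k \<in> K"
    then have "k = k \<oplus>\<^bsub>M\<^esub> x \<odot>\<^bsub>M\<^esub> \<zero>\<^bsub>M\<^esub>" using Kc assms by simp
    then show "k \<in> add_mult M K x" using \<open>k \<in> K\<close> unfolding add_mult_def by blast
  qed
  then have z: "\<zero>\<^bsub>M\<^esub> \<in> add_mult M K x" using submodule_zero[OF assms(1)] by auto
  show "x \<odot>\<^bsub>M\<^esub> y \<in> add_mult M K x" if "y \<in> carrier M" for y
  proof -
    have "x \<odot>\<^bsub>M\<^esub> y = \<zero>\<^bsub>M\<^esub> \<oplus>\<^bsub>M\<^esub> x \<odot>\<^bsub>M\<^esub> y" using assms that by simp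
    then show ?thesis using submodule_zero[OF assms(1)] that unfolding add_mult_def by blast
  qed
  show "submodule (add_mult M K x) R M"
  proof (rule submoduleI[OF _ z])
    show "add_mult M K x \<subseteq> carrier M" using Kc assms by (auto simp: add_mult_def)
  next
    fix a assume "a \<in> add_mult M K x"
    then obtain k y where 1: "k \<in> K" "y \<in> carrier M" "a = k \<oplus>\<^bsub>M\<^esub> x \<odot>\<^bsub>M\<^esub> y" unfolding add_mult_def by blast
    then have "\<ominus>\<^bsub>M\<^esub> a = \<ominus>\<^bsub>M\<^esub> k \<oplus>\<^bsub>M\<^esub> x \<odot>\<^bsub>M\<^esub> (\<ominus>\<^bsub>M\<^esub> y)" using assms Kc by (simp add: smult_r_minus M.minus_add)
    then show "\<ominus>\<^bsub>M\<^esub> a \<in> add_mult M K x" using 1 E M.a_inv_closed unfolding add_mult_def by blast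
    fix c assume c: "c \<in> carrier R"
    then have "c \<odot>\<^bsub>M\<^esub> a = c \<odot>\<^bsub>M\<^esub> k \<oplus>\<^bsub>M\<^esub> x \<odot>\<^bsub>M\<^esub> (c \<odot>\<^bsub>M\<^esub> y)" using 1 assms Kc smult_commute[of x c y]
      by (simp add: smult_r_distr)
    then show "c \<odot>\<^bsub>M\<^esub> a \<in> add_mult M K x" using 1 E c smult_closed unfolding add_mult_def by blast
  next
    fix a b assume "a \<in> add_mult M K x" "b \<in> add_mult M K x"
    then obtain k r l s where 1: "k \<in> K" "r \<in> carrier M" "a = k \<oplus>\<^bsub>M\<^esub> x \<odot>\<^bsub>M\<^esub> r"
      "l \<in> K" "s \<in> carrier M" "b = l \<oplus>\<^bsub>M\<^esub> x \<odot>\<^bsub>M\<^esub> s" unfolding add_mult_def by blast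
    then have "a \<oplus>\<^bsub>M\<^esub> b = (k \<oplus>\<^bsub>M\<^esub> l) \<oplus>\<^bsub>M\<^esub> x \<odot>\<^bsub>M\<^esub> (r \<oplus>\<^bsub>M\<^esub> s)"
      using assms(2) Kc M.add_add_swap[of k "x \<odot>\<^bsub>M\<^esub> r" l "x \<odot>\<^bsub>M\<^esub> s"] by (simp add: smult_r_distr)
    moreover have "k \<oplus>\<^bsub>M\<^esub> l \<in> K" "r \<oplus>\<^bsub>M\<^esub> s \<in> carrier M" using 1 E(5) by auto
    ultimately show "a \<oplus>\<^bsub>M\<^esub> b \<in> add_mult M K x" unfolding add_mult_def by blast
  qed
qed

end

section \<open>Noetherian modules and Nakayama's lemma at a prime\<close>

locale noetherian_module = module +
  assumes submodule_chain: "C \<noteq> {} \<Longrightarrow> subset.chain {K. submodule K R M} C \<Longrightarrow> \<Union>C \<in> C"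
begin

text \<open>The chain condition says that a nonempty chain contains its union. This is the upper
  bound that Zorn's lemma asks for, inside any family \<open>S\<close>.\<close>

lemma maximal_submodule:
  assumes "S \<noteq> {}" "\<And>K. K \<in> S \<Longrightarrow> submodule K R M"
  shows "\<exists>K\<in>S. \<forall>L\<in>S. K \<subseteq> L \<longrightarrow> L = K"
proof (rule subset_Zorn_nonempty[OF assms(1)])
  fix C assume C: "C \<noteq> {}" "subset.chain S C"
  then have "subset.chain {K. submodule K R M} C"
    using assms(2) by (auto simp: subset.chain_def)
  then have "\<Union>C \<in> C" using submodule_chain C(1) by blast
  then show "\<Union>C \<in> S" using C(2) by (auto simp: subset.chain_def)
qed

text \<open>A maximal submodule violating \<Phi> would satisfy the hypothesis of
  \<open>step\<close>.\<close>

lemma submodule_induct [consumes 1, case_names step]: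
  assumes "submodule K R M"
    and step: "\<And>K. submodule K R M \<Longrightarrow> (\<And>L. submodule L R M \<Longrightarrow> K \<subset> L \<Longrightarrow> \<Phi> L) \<Longrightarrow> \<Phi> K"
  shows "\<Phi> K"
proof (rule ccontr)
  assume "\<not> \<Phi> K"
  then have "\<exists>K\<in>{K. submodule K R M \<and> \<not> \<Phi> K}. \<forall>L\<in>{K. submodule K R M \<and> \<not> \<Phi> K}. K \<subseteq> L \<longrightarrow> L = K"
    using assms(1) by (intro maximal_submodule) auto
  then obtain K' where K': "submodule K' R M" "\<not> \<Phi> K'"
    and max: "\<forall>L\<in>{K. submodule K R M \<and> \<not> \<Phi> K}. K' \<subseteq> L \<longrightarrow> L = K'" by (elim bexE CollectE conjE)
  have "\<Phi> K'"
  proof (rule step[OF K'(1)])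
    fix L assume "submodule L R M" "K' \<subset> L"
    then show "\<Phi> L" using max by blast
  qed
  then show False using K'(2) by contradiction
qed

text \<open>The P-torsion of M/K is finitely generated, so one denominator kills all of it. Here
  \<open>s\<close> is chosen with {y. sy in K} maximal: the set for ts contains the one for s, hence
  equals it, and it contains every y with ty in K.\<close>

lemma uniform_annihilator:
  assumes "submodule K R M" "primeideal P R"
  obtains s where "s \<in> carrier R - P"
    "\<And>y t. y \<in> carrier M \<Longrightarrow> t \<in> carrier R - P \<Longrightarrow> t \<odot>\<^bsub>M\<^esub> y \<in> K \<Longrightarrow> s \<odot>\<^bsub>M\<^esub> y \<in> K"
proof -
  note E = submoduleE[OF assms(1)] submodule_zero[OF assms(1)]
  define U where "U s = {y \<in> carrier M. s \<odot>\<^bsub>M\<^esub> y \<in> K}" for s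
  have "\<exists>L\<in>U ` (carrier R - P). \<forall>L'\<in>U ` (carrier R - P). L \<subseteq> L' \<longrightarrow> L' = L"
  proof (rule maximal_submodule)
    show "U ` (carrier R - P) \<noteq> {}" using primeideal_one_notin[OF assms(2)] by auto
    fix L assume "L \<in> U ` (carrier R - P)"
    then obtain s where s: "s \<in> carrier R" "L = U s" by auto
    show "submodule L R M" unfolding s(2)
      by (rule submoduleI) (use E s(1) in \<open>auto simp: U_def smult_r_distr smult_r_minus smult_commute[OF s(1)]\<close>)
  qed
  then obtain s where s: "s \<in> carrier R - P"
    and max: "\<And>t. t \<in> carrier R - P \<Longrightarrow> U s \<subseteq> U t \<Longrightarrow> U t = U s" by auto
  show thesis
  proof (rule that[OF s])
    fix y t assume y: "y \<in> carrier M" and t: "t \<in> carrier R - P" and ty: "t \<odot>\<^bsub>M\<^esub> y \<in> K"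
    have ts: "t \<otimes> s \<in> carrier R - P" using primeideal_notin_mult[OF assms(2)] s t by simp
    have "U s \<subseteq> U (t \<otimes> s)" using s t E by (auto simp: U_def smult_assoc1)
    then have "U (t \<otimes> s) = U s" using max ts by simp
    moreover have "y \<in> U (t \<otimes> s)" using s t y ty E smult_commute[of t s y] by (auto simp: U_def smult_assoc1)
    ultimately show "s \<odot>\<^bsub>M\<^esub> y \<in> K" by (auto simp: U_def)
  qed
qed

text \<open>Locally at \<open>P\<close>, \<open>M/U\<close> is a one-dimensional vector space over the residue field. This yields both
  Nakayama's lemma and, below, a nonzero map from \<open>M/PM\<close> to \<open>R/P\<close>.\<close>

lemma maximal_avoiding_submodule:
  assumes K: "submodule K R M" and P: "primeideal P R" and KP: "colon_all R M K \<subseteq> P"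
  obtains U where "submodule U R M" "K \<subseteq> U" "colon_all R M U \<subseteq> P"
    "\<And>p y. p \<in> P \<Longrightarrow> y \<in> carrier M \<Longrightarrow> p \<odot>\<^bsub>M\<^esub> y \<in> U"
    "\<And>u y. u \<in> carrier R - P \<Longrightarrow> y \<in> carrier M \<Longrightarrow> u \<odot>\<^bsub>M\<^esub> y \<in> U \<Longrightarrow> y \<in> U"
    "\<And>m. m \<in> carrier M - U \<Longrightarrow> \<exists>u \<in> carrier R - P. \<forall>y \<in> carrier M. \<exists>r \<in> carrier R. u \<odot>\<^bsub>M\<^esub> y \<ominus>\<^bsub>M\<^esub> r \<odot>\<^bsub>M\<^esub> m \<in> U"
proof -
  interpret P: primeideal P R by fact
  let ?S = "{U. submodule U R M \<and> K \<subseteq> U \<and> colon_all R M U \<subseteq> P}"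
  have "\<exists>U\<in>?S. \<forall>L\<in>?S. U \<subseteq> L \<longrightarrow> L = U"
    using K KP by (intro maximal_submodule) auto
  then obtain U where U: "submodule U R M" "K \<subseteq> U" "colon_all R M U \<subseteq> P"
    and max: "\<forall>L\<in>?S. U \<subseteq> L \<longrightarrow> L = U" by (elim bexE CollectE conjE)
  note E = submoduleE[OF U(1)] submodule_zero[OF U(1)]
  \<comment> \<open>U + Rm is strictly larger than U, so by maximality some u outside P sends M into
    U + Rm.\<close>
  have big: "\<exists>u \<in> carrier R - P. \<forall>y \<in> carrier M. \<exists>k\<in>U. \<exists>r \<in> carrier R. u \<odot>\<^bsub>M\<^esub> y = k \<oplus>\<^bsub>M\<^esub> r \<odot>\<^bsub>M\<^esub> m"
    if m: "m \<in> carrier M - U" for m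
  proof -
    have mc: "m \<in> carrier M" using m by simp
    note A = add_span_submodule[OF U(1) mc]
    have "add_span R M U m \<noteq> U" using A(3) m by blast
    then have "add_span R M U m \<notin> ?S" using max A(2) by blast
    then have "\<not> colon_all R M (add_span R M U m) \<subseteq> P" using A U by blast
    then show ?thesis unfolding colon_all_def add_span_def by blast
  qed
  \<comment> \<open>If uy is in U but y is not, then vM lies in U + Ry for some v outside P, so uv
    sends M into U and lies in P, which is impossible.\<close>
  have tf: "y \<in> U" if u: "u \<in> carrier R - P" and y: "y \<in> carrier M" and uy: "u \<odot>\<^bsub>M\<^esub> y \<in> U" for u y
  proof (rule ccontr)
    assume "y \<notin> U"
    then obtain v where v: "v \<in> carrier R - P"
      "\<forall>z \<in> carrier M. \<exists>k\<in>U. \<exists>r\<in>carrier R. v \<odot>\<^bsub>M\<^esub> z = k \<oplus>\<^bsub>M\<^esub> r \<odot>\<^bsub>M\<^esub> y"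
      using big[OF DiffI[OF y]] by blast
    have "u \<otimes> v \<in> colon_all R M U"
      unfolding colon_all_def
    proof (intro CollectI conjI ballI)
      show "u \<otimes> v \<in> carrier R" using u v by auto
      fix z assume z: "z \<in> carrier M"
      obtain k r where k: "k \<in> U" "r \<in> carrier R" "v \<odot>\<^bsub>M\<^esub> z = k \<oplus>\<^bsub>M\<^esub> r \<odot>\<^bsub>M\<^esub> y" using bspec[OF v(2) z] by blast
      have "(u \<otimes> v) \<odot>\<^bsub>M\<^esub> z = u \<odot>\<^bsub>M\<^esub> k \<oplus>\<^bsub>M\<^esub> r \<odot>\<^bsub>M\<^esub> (u \<odot>\<^bsub>M\<^esub> y)"
        using k u v(1) y z E(1) smult_commute[of u r y] by (auto simp: smult_assoc1 smult_r_distr)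
      also have "\<dots> \<in> U" using E k u uy by auto
      finally show "(u \<otimes> v) \<odot>\<^bsub>M\<^esub> z \<in> U" .
    qed
    then show False using U(3) primeideal_notin_mult[OF P] u v by blast
  qed
  \<comment> \<open>If py were outside U, \<open>big\<close> with m = py, applied to y itself, gives
    uy = k + rpy. Then u - rp is outside P and sends y into U, so y and hence py lie in U.\<close>
  have PM: "p \<odot>\<^bsub>M\<^esub> y \<in> U" if p: "p \<in> P" and y: "y \<in> carrier M" for p y
  proof (rule ccontr)
    have pc: "p \<in> carrier R" using p P.Icarr by auto
    assume n: "p \<odot>\<^bsub>M\<^esub> y \<notin> U"
    have "p \<odot>\<^bsub>M\<^esub> y \<in> carrier M - U" using n pc y by simp
    from big[OF this] obtain u where u: "u \<in> carrier R - P"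
      "\<forall>z \<in> carrier M. \<exists>k\<in>U. \<exists>r\<in>carrier R. u \<odot>\<^bsub>M\<^esub> z = k \<oplus>\<^bsub>M\<^esub> r \<odot>\<^bsub>M\<^esub> (p \<odot>\<^bsub>M\<^esub> y)"
      by blast
    then obtain k r where k: "k \<in> U" "r \<in> carrier R" "u \<odot>\<^bsub>M\<^esub> y = k \<oplus>\<^bsub>M\<^esub> r \<odot>\<^bsub>M\<^esub> (p \<odot>\<^bsub>M\<^esub> y)" using y by blast
    have kc: "k \<in> carrier M" using k E(1) by auto
    have "(u \<ominus> r \<otimes> p) \<odot>\<^bsub>M\<^esub> y = k"
      using k u(1) pc y kc by (simp add: minus_smult smult_assoc1 a_minus_def M.a_assoc M.r_neg smult_l_distr smult_l_minus)
    then have "(u \<ominus> r \<otimes> p) \<odot>\<^bsub>M\<^esub> y \<in> U" using k by simp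
    moreover have "u \<ominus> r \<otimes> p \<in> carrier R - P"
    proof -
      have rp: "r \<otimes> p \<in> P" using p k by (simp add: P.I_l_closed)
      have uc: "u \<in> carrier R" using u(1) by simp
      have "u \<ominus> r \<otimes> p \<oplus> r \<otimes> p = u" using uc pc k(2) by algebra
      then have "u \<ominus> r \<otimes> p \<notin> P" using rp u(1) P.a_closed by fastforce
      then show ?thesis using u pc k by auto
    qed
    ultimately have "y \<in> U" using tf y by blast
    then show False using n E(4) pc by blast
  qed
  show thesis
  proof (rule that[OF U PM tf])
    fix m assume m: "m \<in> carrier M - U"
    from big[OF m] obtain u where u: "u \<in> carrier R - P"
      "\<forall>z \<in> carrier M. \<exists>k\<in>U. \<exists>r\<in>carrier R. u \<odot>\<^bsub>M\<^esub> z = k \<oplus>\<^bsub>M\<^esub> r \<odot>\<^bsub>M\<^esub> m"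
      by blast
    have "\<exists>r\<in>carrier R. u \<odot>\<^bsub>M\<^esub> y \<ominus>\<^bsub>M\<^esub> r \<odot>\<^bsub>M\<^esub> m \<in> U" if y: "y \<in> carrier M" for y
    proof -
      obtain k r where k: "k \<in> U" "r \<in> carrier R" "u \<odot>\<^bsub>M\<^esub> y = k \<oplus>\<^bsub>M\<^esub> r \<odot>\<^bsub>M\<^esub> m" using bspec[OF u(2) y] by blast
      then have "u \<odot>\<^bsub>M\<^esub> y \<ominus>\<^bsub>M\<^esub> r \<odot>\<^bsub>M\<^esub> m = k" using m E(1)
        by (auto simp: a_minus_def M.a_assoc M.r_neg)
      then have "u \<odot>\<^bsub>M\<^esub> y \<ominus>\<^bsub>M\<^esub> r \<odot>\<^bsub>M\<^esub> m \<in> U" using k(1) by simp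
      then show ?thesis using k(2) by (rule_tac bexI)
    qed
    then show "\<exists>u \<in> carrier R - P. \<forall>y \<in> carrier M. \<exists>r \<in> carrier R. u \<odot>\<^bsub>M\<^esub> y \<ominus>\<^bsub>M\<^esub> r \<odot>\<^bsub>M\<^esub> m \<in> U"
      using u(1) by blast
  qed
qed

text \<open>The submodule U of \<open>maximal_avoiding_submodule\<close> contains K and PM, hence K
  + xM, and (U : M) is still inside P. This keeps P in the support when x is divided out.\<close>

lemma nakayama:
  assumes K: "submodule K R M" and P: "primeideal P R" and KP: "colon_all R M K \<subseteq> P" and x: "x \<in> P"
  shows "colon_all R M (add_mult M K x) \<subseteq> P"
proof -
  obtain U where U: "submodule U R M" "K \<subseteq> U" "colon_all R M U \<subseteq> P"
    "\<And>p y. p \<in> P \<Longrightarrow> y \<in> carrier M \<Longrightarrow> p \<odot>\<^bsub>M\<^esub> y \<in> U"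
    using maximal_avoiding_submodule[OF K P KP] by metis
  have "add_mult M K x \<subseteq> U" using U(2) U(4)[OF x] submoduleE(5)[OF U(1)] by (auto simp: add_mult_def)
  then show ?thesis using U(3) by (auto simp: colon_all_def)
qed

section \<open>Associated primes of M/K\<close>

definition assoc_primes :: "'c set \<Rightarrow> 'a set set" where
  "assoc_primes K = {Q. primeideal Q R \<and> (\<exists>y \<in> carrier M. Q = colon R M K y)}"

text \<open>The prime is (K : z), maximal among the element annihilators that contain (K : y) and
  stay inside P. The confinement to P makes the usual primality argument two-step: a larger
  annihilator must leave P, and an element of it outside P then serves as a new multiplier.\<close>

lemma assoc_prime_exists:
  assumes "noetherian_ring R" and K: "submodule K R M" and P: "primeideal P R"
    and y: "y \<in> carrier M" "colon R M K y \<subseteq> P"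
  obtains Q where "Q \<in> assoc_primes K" "colon R M K y \<subseteq> Q" "Q \<subseteq> P"
proof -
  interpret noetherian_ring R by fact
  interpret P: primeideal P R by fact
  let ?S = "{colon R M K z | z. z \<in> carrier M \<and> colon R M K z \<subseteq> P \<and> colon R M K y \<subseteq> colon R M K z}"
  have "\<exists>Q\<in>?S. \<forall>L\<in>?S. Q \<subseteq> L \<longrightarrow> L = Q"
    using y K by (intro maximal_ideal_exists) (auto intro: colon_ideal)
  then obtain z where z: "z \<in> carrier M" "colon R M K z \<subseteq> P" "colon R M K y \<subseteq> colon R M K z"
    and max0: "\<forall>L\<in>?S. colon R M K z \<subseteq> L \<longrightarrow> L = colon R M K z" by blast
  have max: "colon R M K w = colon R M K z"
    if w: "w \<in> carrier M" "colon R M K w \<subseteq> P" "colon R M K z \<subseteq> colon R M K w" for w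
  proof -
    have "colon R M K w \<in> ?S" using w subset_trans[OF z(3) w(3)] by (intro CollectI exI[of _ w] conjI refl)
    from bspec[OF max0 this] show ?thesis using w(3) by (rule mp)
  qed
  note E = submoduleE[OF K]
  interpret Q: ideal "colon R M K z" R using colon_ideal K z by blast
  have "primeideal (colon R M K z) R"
  proof (rule primeidealI[OF Q.is_ideal R.is_cring])
    show "carrier R \<noteq> colon R M K z" using z(2) P.I_notcarr P.Icarr by blast
    fix a b assume a: "a \<in> carrier R" and b: "b \<in> carrier R" and ab: "a \<otimes> b \<in> colon R M K z"
    show "a \<in> colon R M K z \<or> b \<in> colon R M K z"
    proof (rule ccontr)
      assume n: "\<not> ?thesis"
      let ?z = "b \<odot>\<^bsub>M\<^esub> z"
      have 1: "colon R M K z \<subseteq> colon R M K ?z"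
      proof
        fix r assume "r \<in> colon R M K z"
        then have r: "r \<in> carrier R" "r \<odot>\<^bsub>M\<^esub> z \<in> K" unfolding colon_def by blast+
        have vr: "b \<odot>\<^bsub>M\<^esub> (r \<odot>\<^bsub>M\<^esub> z) \<in> K" by (rule E(4)[OF _ r(2)]) (use b in simp)
        have "r \<odot>\<^bsub>M\<^esub> (b \<odot>\<^bsub>M\<^esub> z) = b \<odot>\<^bsub>M\<^esub> (r \<odot>\<^bsub>M\<^esub> z)" by (rule smult_commute) (use r b z in simp_all)
        then show "r \<in> colon R M K ?z" using r(1) vr unfolding colon_def by simp
      qed
      have "a \<otimes> b \<odot>\<^bsub>M\<^esub> z \<in> K" using ab unfolding colon_def by blast
      then have "a \<in> colon R M K ?z" unfolding colon_def using a b z(1) smult_assoc1[of a b z] by simp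
      then have "colon R M K ?z \<noteq> colon R M K z" using n by blast
      moreover have "?z \<in> carrier M" using b z(1) by simp
      ultimately have "\<not> colon R M K ?z \<subseteq> P" using max[OF _ _ 1] by blast
      then obtain s where "s \<in> colon R M K ?z" "s \<notin> P" by blast
      then have s: "s \<in> carrier R - P" "s \<odot>\<^bsub>M\<^esub> ?z \<in> K" unfolding colon_def by simp_all
      \<comment> \<open>(K : bz) strictly contains (K : z), because of a, so it has an element s
        outside P. Now b sends sz into K, so (K : sz) is too large as well and yields t outside P;
        then ts lies in (K : z) although it is outside P.\<close>
      let ?w = "s \<odot>\<^bsub>M\<^esub> z"
      have 2: "colon R M K z \<subseteq> colon R M K ?w"
      proof
        fix r assume "r \<in> colon R M K z"
        then have r: "r \<in> carrier R" "r \<odot>\<^bsub>M\<^esub> z \<in> K" unfolding colon_def by blast+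
        have vr: "s \<odot>\<^bsub>M\<^esub> (r \<odot>\<^bsub>M\<^esub> z) \<in> K" by (rule E(4)[OF _ r(2)]) (use s in simp)
        have "r \<odot>\<^bsub>M\<^esub> (s \<odot>\<^bsub>M\<^esub> z) = s \<odot>\<^bsub>M\<^esub> (r \<odot>\<^bsub>M\<^esub> z)" by (rule smult_commute) (use r s z in simp_all)
        then show "r \<in> colon R M K ?w" using r(1) vr unfolding colon_def by simp
      qed
      have "b \<odot>\<^bsub>M\<^esub> ?w = s \<odot>\<^bsub>M\<^esub> ?z" by (rule smult_commute) (use s b z in simp_all)
      then have "b \<in> colon R M K ?w" using s(2) b unfolding colon_def by simp
      then have "colon R M K ?w \<noteq> colon R M K z" using n by blast
      moreover have "?w \<in> carrier M" using s z(1) by simp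
      ultimately have "\<not> colon R M K ?w \<subseteq> P" using max[OF _ _ 2] by blast
      then obtain t where "t \<in> colon R M K ?w" "t \<notin> P" by blast
      then have t: "t \<in> carrier R - P" "t \<odot>\<^bsub>M\<^esub> ?w \<in> K" unfolding colon_def by simp_all
      then have "t \<otimes> s \<in> colon R M K z" using s(1) z(1) smult_assoc1[of t s z] unfolding colon_def by simp
      then show False using z(2) primeideal_notin_mult[OF P t(1) s(1)] by blast
    qed
  qed
  then show thesis using that[of "colon R M K z"] z by (auto simp: assoc_primes_def)
qed

text \<open>Noetherian induction: choose y with Q1 = (K : y) prime. The submodule of M/K generated
  by y is R/Q1, all of whose nonzero elements have annihilator Q1; an associated prime of M/K is
  therefore Q1 or associated to M/(K + Ry).\<close>

lemma finite_assoc_primes: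
  assumes "noetherian_ring R" and K: "submodule K R M"
  shows "finite (assoc_primes K)"
  using K
proof (induction rule: submodule_induct)
  case (step K)
  note K = step(1) note E = submoduleE[OF K]
  show ?case
  proof (cases "assoc_primes K = {}")
    case False
    then obtain y Q1 where y: "y \<in> carrier M" and Q1: "Q1 = colon R M K y" "primeideal Q1 R"
      by (auto simp: assoc_primes_def)
    interpret Q1: primeideal Q1 R by fact
    note A = add_span_submodule[OF K y]
    have "y \<notin> K"
    proof
      assume "y \<in> K"
      then have "\<one> \<in> Q1" unfolding Q1 using y by (simp add: colon_def)
      then show False using primeideal_one_notin[OF Q1(2)] by simp
    qed
    then have fin: "finite (assoc_primes (add_span R M K y))" using step(2)[OF A(1)] A by blast
    have "assoc_primes K \<subseteq> insert Q1 (assoc_primes (add_span R M K y))"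
    proof
      fix Q assume "Q \<in> assoc_primes K"
      then obtain z where z: "z \<in> carrier M" and Q: "Q = colon R M K z" "primeideal Q R"
        by (auto simp: assoc_primes_def)
      interpret Q: primeideal Q R by fact
      show "Q \<in> insert Q1 (assoc_primes (add_span R M K y))"
      proof (cases "\<exists>r \<in> carrier R. r \<odot>\<^bsub>M\<^esub> z \<in> add_span R M K y \<and> r \<odot>\<^bsub>M\<^esub> z \<notin> K")
        case True
        then obtain r k a where r: "r \<in> carrier R" "r \<odot>\<^bsub>M\<^esub> z \<notin> K" and k: "k \<in> K" "a \<in> carrier R"
          and eq: "r \<odot>\<^bsub>M\<^esub> z = k \<oplus>\<^bsub>M\<^esub> a \<odot>\<^bsub>M\<^esub> y" by (auto simp: add_span_def)
        have kc: "k \<in> carrier M" using k E(1) by auto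
        have rQ: "r \<notin> Q" using r(2) unfolding Q(1) by (simp add: colon_def)
        have aQ: "a \<notin> Q1"
          using r(2) k(1) E(5) unfolding Q1(1) eq by (auto simp: colon_def)
        have iff: "c \<odot>\<^bsub>M\<^esub> (r \<odot>\<^bsub>M\<^esub> z) \<in> K \<longleftrightarrow> c \<odot>\<^bsub>M\<^esub> (a \<odot>\<^bsub>M\<^esub> y) \<in> K" if c: "c \<in> carrier R" for c
        proof -
          have e: "c \<odot>\<^bsub>M\<^esub> (r \<odot>\<^bsub>M\<^esub> z) = c \<odot>\<^bsub>M\<^esub> (a \<odot>\<^bsub>M\<^esub> y) \<oplus>\<^bsub>M\<^esub> c \<odot>\<^bsub>M\<^esub> k"
            using c k y kc unfolding eq by (simp add: smult_r_distr M.a_comm)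
          have ck: "c \<odot>\<^bsub>M\<^esub> k \<in> K" using c k(1) E(4) by blast
          have "c \<odot>\<^bsub>M\<^esub> (a \<odot>\<^bsub>M\<^esub> y) \<in> carrier M" using c k(2) y by simp
          then show ?thesis unfolding e using submodule_cancel[OF K _ ck] E(5)[OF _ ck] by blast
        qed
        \<comment> \<open>rz and ay agree modulo K. Since r is outside the prime Q and a outside the
          prime Q1, passing from z to rz and from y to ay changes neither annihilator.\<close>
        have "c \<in> Q \<longleftrightarrow> c \<in> Q1" for c
        proof (cases "c \<in> carrier R")
          case c: True
          have "c \<in> Q \<longleftrightarrow> c \<otimes> r \<in> Q"
            using Q.I_prime[OF c r(1)] Q.I_r_closed[of c r] rQ r(1) by blast
          also have "\<dots> \<longleftrightarrow> c \<odot>\<^bsub>M\<^esub> (r \<odot>\<^bsub>M\<^esub> z) \<in> K" using c r z unfolding Q by (auto simp: colon_def smult_assoc1)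
          also have "\<dots> \<longleftrightarrow> c \<otimes> a \<in> Q1" using iff[OF c] c k y unfolding Q1 by (auto simp: colon_def smult_assoc1)
          also have "\<dots> \<longleftrightarrow> c \<in> Q1"
            using Q1.I_prime[OF c k(2)] Q1.I_r_closed[of c a] aQ k(2) by blast
          finally show ?thesis .
        next
          case False then show ?thesis using Q.Icarr Q1.Icarr by auto
        qed
        then show ?thesis by auto
      next
        case False
        then have "Q = colon R M (add_span R M K y) z" unfolding Q using A(2) by (auto simp: colon_def)
        then show ?thesis using Q(2) z by (auto simp: assoc_primes_def)
      qed
    qed
    then show ?thesis using fin finite_subset by blast
  qed auto
qed

text \<open>The associated primes inside P are those visible in the localization of M/K at P. Prime
  avoidance gives either one containing \<open>J\<close>, or an x in \<open>J\<close> outside all of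
  them, which is regular there; \<open>uniform_annihilator\<close> then supplies one s for all
  y.\<close>

lemma regular_or_assoc_prime:
  assumes "noetherian_ring R" and K: "submodule K R M" and P: "primeideal P R" and J: "ideal J R" "J \<subseteq> P"
  obtains (regular) x s where "x \<in> J" "s \<in> carrier R - P"
      "\<And>y. y \<in> carrier M \<Longrightarrow> x \<odot>\<^bsub>M\<^esub> y \<in> K \<Longrightarrow> s \<odot>\<^bsub>M\<^esub> y \<in> K"
    | (assoc) z where "z \<in> carrier M" "primeideal (colon R M K z) R" "J \<subseteq> colon R M K z" "colon R M K z \<subseteq> P"
proof (cases "J \<subseteq> \<Union>{Q \<in> assoc_primes K. Q \<subseteq> P}")
  case True
  have "\<exists>Q\<in>{Q \<in> assoc_primes K. Q \<subseteq> P}. J \<subseteq> Q"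
  proof (rule prime_avoidance[OF _ _ J(1) True])
    show "finite {Q \<in> assoc_primes K. Q \<subseteq> P}" using finite_assoc_primes[OF assms(1) K] by simp
  qed (auto simp: assoc_primes_def)
  then show thesis using assoc by (auto simp: assoc_primes_def)
next
  case False
  then obtain x where x: "x \<in> J" "\<And>Q. Q \<in> assoc_primes K \<Longrightarrow> Q \<subseteq> P \<Longrightarrow> x \<notin> Q" by auto
  have xc: "x \<in> carrier R" using x ideal.Icarr[OF J(1)] by auto
  obtain s where s: "s \<in> carrier R - P"
    "\<And>y t. y \<in> carrier M \<Longrightarrow> t \<in> carrier R - P \<Longrightarrow> t \<odot>\<^bsub>M\<^esub> y \<in> K \<Longrightarrow> s \<odot>\<^bsub>M\<^esub> y \<in> K"
    using uniform_annihilator[OF K P] by metis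
  show thesis
  proof (rule regular[OF x(1) s(1)])
    fix y assume y: "y \<in> carrier M" "x \<odot>\<^bsub>M\<^esub> y \<in> K"
    \<comment> \<open>Otherwise (K : y) lies in an associated prime inside P, and x, an element of
      (K : y), would belong to it.\<close>
    have "\<not> colon R M K y \<subseteq> P"
    proof
      assume "colon R M K y \<subseteq> P"
      then obtain Q where Q: "Q \<in> assoc_primes K" "colon R M K y \<subseteq> Q" "Q \<subseteq> P"
        using assoc_prime_exists[OF assms(1) K P y(1)] by metis
      then show False using x(2)[of Q] y xc by (auto simp: colon_def)
    qed
    then obtain t where "t \<in> carrier R - P" "t \<odot>\<^bsub>M\<^esub> y \<in> K" by (auto simp: colon_def)
    then show "s \<odot>\<^bsub>M\<^esub> y \<in> K" using s(2) y(1) by blast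
  qed
qed

text \<open>Multiplication by x is injective on the localization of M/K at P, which is nonzero, so
  inverting x as well leaves a nonzero module. The prime is one of its support: it contains (K : M)
  and misses all products x^n u with u outside P.\<close>

lemma smaller_prime_avoiding:
  assumes "noetherian_ring R" and K: "submodule K R M" and P: "primeideal P R"
    and x: "x \<in> carrier R" and s: "s \<in> carrier R - P"
    and reg: "\<And>y. y \<in> carrier M \<Longrightarrow> x \<odot>\<^bsub>M\<^esub> y \<in> K \<Longrightarrow> s \<odot>\<^bsub>M\<^esub> y \<in> K"
    and KP: "colon_all R M K \<subseteq> P"
  obtains Q where "primeideal Q R" "colon_all R M K \<subseteq> Q" "Q \<subseteq> P" "x \<notin> Q"
proof -
  note E = submoduleE[OF K]
  let ?S = "{x [^] (n::nat) \<otimes> u | n u. u \<in> carrier R - P}"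
  \<comment> \<open>Each factor x is traded for one factor s, so x^n u in (K : M) would force s^n u
    in (K : M).\<close>
  have pw: "x [^] (n::nat) \<odot>\<^bsub>M\<^esub> y \<in> K \<Longrightarrow> s [^] n \<odot>\<^bsub>M\<^esub> y \<in> K" if "y \<in> carrier M" for n y
    using that
  proof (induction n arbitrary: y)
    case (Suc n)
    have sc: "s \<in> carrier R" using s by simp
    have "x [^] n \<odot>\<^bsub>M\<^esub> (x \<odot>\<^bsub>M\<^esub> y) \<in> K" using Suc.prems x by (simp add: smult_assoc1)
    then have "s [^] n \<odot>\<^bsub>M\<^esub> (x \<odot>\<^bsub>M\<^esub> y) \<in> K" using Suc.IH x Suc.prems by auto
    then have "x \<odot>\<^bsub>M\<^esub> (s [^] n \<odot>\<^bsub>M\<^esub> y) \<in> K" using smult_commute x s Suc.prems by auto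
    then have "s \<odot>\<^bsub>M\<^esub> (s [^] n \<odot>\<^bsub>M\<^esub> y) \<in> K" using reg s Suc.prems by auto
    then show ?case using smult_commute[of s "s [^] n" y] sc Suc.prems by (simp add: smult_assoc1)
  qed (use x s in auto)
  have sn: "s [^] (n::nat) \<in> carrier R - P" for n
  proof (induction n)
    case 0 show ?case using primeideal_one_notin[OF P] by simp
  next
    case (Suc n) then show ?case using primeideal_notin_mult[OF P Suc s] by simp
  qed
  have "colon_all R M K \<inter> ?S = {}"
  proof (rule ccontr)
    assume "\<not> ?thesis"
    then obtain n u where u: "u \<in> carrier R - P" "x [^] (n::nat) \<otimes> u \<in> colon_all R M K" by blast
    have "s [^] n \<otimes> u \<in> colon_all R M K"
      unfolding colon_all_def
    proof (intro CollectI conjI ballI)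
      show "s [^] n \<otimes> u \<in> carrier R" using s u by auto
      fix y assume y: "y \<in> carrier M"
      have "x [^] n \<odot>\<^bsub>M\<^esub> (u \<odot>\<^bsub>M\<^esub> y) \<in> K" using u x y by (auto simp: colon_all_def smult_assoc1)
      then have "s [^] n \<odot>\<^bsub>M\<^esub> (u \<odot>\<^bsub>M\<^esub> y) \<in> K" using pw u y by auto
      then show "(s [^] n \<otimes> u) \<odot>\<^bsub>M\<^esub> y \<in> K" using s u y by (auto simp: smult_assoc1)
    qed
    then show False using KP primeideal_notin_mult[OF P sn u(1)] by blast
  qed
  then obtain Q where Q: "primeideal Q R" "colon_all R M K \<subseteq> Q" "Q \<inter> ?S = {}"
  proof (rule_tac R.prime_ideal_disjoint[OF assms(1) colon_all_ideal[OF K], of ?S], goal_cases)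
    case 1 then show ?case using x by auto
  next
    case 2 then show ?case using primeideal_one_notin[OF P] by blast
  next
    case (4 a b)
    then obtain n u m v where 5: "a = x [^] (n::nat) \<otimes> u" "u \<in> carrier R - P"
      "b = x [^] (m::nat) \<otimes> v" "v \<in> carrier R - P" by blast
    then have "a \<otimes> b = x [^] (n + m) \<otimes> (u \<otimes> v)" using x
      by (simp add: R.nat_pow_mult[symmetric] m_ac)
    then show ?case using primeideal_notin_mult[OF P 5(2,4)] by blast
  qed auto
  \<comment> \<open>The exponent 0 in \<open>?S\<close> excludes everything outside P; further
    below, the exponent 1 with u = 1 excludes x.\<close>
  have "u \<in> P" if "u \<in> Q" for u
  proof (rule ccontr)
    assume "u \<notin> P"
    moreover have uc: "u \<in> carrier R" using that Q(1) by (meson ideal.Icarr primeideal.axioms(1))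
    ultimately have "x [^] (0::nat) \<otimes> u \<in> ?S" by blast
    then show False using Q(3) that uc by auto
  qed
  moreover have "x \<notin> Q"
  proof
    assume "x \<in> Q"
    moreover have "x [^] (1::nat) \<otimes> \<one> \<in> ?S" using primeideal_one_notin[OF P] by blast
    ultimately show False using Q(3) x by auto
  qed
  ultimately show thesis using that Q by blast
qed

end

section \<open>Finitely generated modules over a Noetherian ring are Noetherian\<close>

context module begin

lemma submodule_Inter:
  assumes "\<And>H. H \<in> S \<Longrightarrow> submodule H R M" "S \<noteq> {}"
  shows "submodule (\<Inter>S) R M"
proof (rule submoduleI)
  show "\<Inter>S \<subseteq> carrier M" using assms submoduleE(1) by blast
  show "\<zero>\<^bsub>M\<^esub> \<in> \<Inter>S" using assms submodule_zero by blast
  show "\<ominus>\<^bsub>M\<^esub> a \<in> \<Inter>S" if "a \<in> \<Inter>S" for a using that assms submoduleE(3) by blast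
  show "a \<oplus>\<^bsub>M\<^esub> b \<in> \<Inter>S" if "a \<in> \<Inter>S" "b \<in> \<Inter>S" for a b using that assms submoduleE(5) by blast
  show "a \<odot>\<^bsub>M\<^esub> x \<in> \<Inter>S" if "a \<in> carrier R" "x \<in> \<Inter>S" for a x using that assms submoduleE(4) by blast
qed

lemma module_span_submodule:
  assumes "A \<subseteq> carrier M"
  shows "submodule (module_span R M A) R M"
  unfolding module_span_def
  by (rule submodule_Inter) (use assms carrier_is_submodule in auto)

lemma module_span_superset: "A \<subseteq> module_span R M A"
  by (auto simp: module_span_def)

lemma module_span_minimal: "submodule H R M \<Longrightarrow> A \<subseteq> H \<Longrightarrow> module_span R M A \<subseteq> H"
  by (auto simp: module_span_def)

lemma zero_submodule: "submodule {\<zero>\<^bsub>M\<^esub>} R M"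
  by (rule submoduleI) auto

lemma module_span_insert:
  assumes "A \<subseteq> carrier M" "g \<in> carrier M"
  shows "module_span R M (insert g A) \<subseteq> add_span R M (module_span R M A) g"
proof -
  note A = add_span_submodule[OF module_span_submodule[OF assms(1)] assms(2)]
  show ?thesis
    by (rule module_span_minimal[OF A(1)]) (use A(2,3) module_span_superset[of A] in blast)
qed

text \<open>Stabilization generator by generator. On the span H of the earlier generators the chain
  is bounded by K1; the coefficients r with rg in K + H form a chain of ideals of R, largest at K2.
  The larger of K1 and K2 then works for the enlarged span.\<close>

lemma submodule_chain_stable_on_span:
  assumes "noetherian_ring R" "finite A" "A \<subseteq> carrier M" "C \<noteq> {}" "subset.chain {K. submodule K R M} C"
  shows "\<exists>K0\<in>C. \<forall>K\<in>C. K \<inter> module_span R M A \<subseteq> K0"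
  using assms(2,3)
proof (induction A)
  case empty
  have "module_span R M {} \<subseteq> {\<zero>\<^bsub>M\<^esub>}" by (rule module_span_minimal[OF zero_submodule]) simp
  moreover have "\<zero>\<^bsub>M\<^esub> \<in> K" if "K \<in> C" for K
    using that assms(5) submodule_zero by (auto simp: subset.chain_def)
  ultimately show ?case using assms(4) by blast
next
  case (insert g A)
  interpret noetherian_ring R by fact
  let ?H = "module_span R M A"
  have Ac: "A \<subseteq> carrier M" and g: "g \<in> carrier M" and H: "submodule ?H R M" using insert.prems module_span_submodule by auto
  note HE = submoduleE[OF H] submodule_zero[OF H]
  have sub: "submodule K R M" if "K \<in> C" for K using that assms(5) by (auto simp: subset.chain_def)
  have comp: "K \<subseteq> L \<or> L \<subseteq> K" if "K \<in> C" "L \<in> C" for K L using that assms(5) by (auto simp: subset.chain_def)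
  obtain K1 where K1: "K1 \<in> C" "\<forall>K\<in>C. K \<inter> ?H \<subseteq> K1" using insert by auto
  define J where "J K = {r \<in> carrier R. \<exists>h\<in>?H. r \<odot>\<^bsub>M\<^esub> g \<oplus>\<^bsub>M\<^esub> h \<in> K}" for K
  have J: "ideal (J K) R" if "K \<in> C" for K
  proof -
    note KE = submoduleE[OF sub[OF that]] submodule_zero[OF sub[OF that]]
    \<comment> \<open>\<open>H_plus K\<close> is K + H, which makes \<open>J K\<close> a colon
      ideal.\<close>
    have "J K = colon R M (H_plus K) g" if "H_plus = (\<lambda>K. {x \<in> carrier M. \<exists>h\<in>?H. x \<oplus>\<^bsub>M\<^esub> h \<in> K})" for H_plus
      unfolding that J_def colon_def using g by auto
    moreover have "submodule {x \<in> carrier M. \<exists>h\<in>?H. x \<oplus>\<^bsub>M\<^esub> h \<in> K} R M"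
    proof (rule submoduleI)
      show "\<zero>\<^bsub>M\<^esub> \<in> {x \<in> carrier M. \<exists>h\<in>?H. x \<oplus>\<^bsub>M\<^esub> h \<in> K}" using HE KE by force
    next
      fix a assume "a \<in> {x \<in> carrier M. \<exists>h\<in>?H. x \<oplus>\<^bsub>M\<^esub> h \<in> K}"
      then obtain h where h: "a \<in> carrier M" "h \<in> ?H" "a \<oplus>\<^bsub>M\<^esub> h \<in> K" by auto
      then have hc: "h \<in> carrier M" using HE(1) by auto
      have "\<ominus>\<^bsub>M\<^esub> (a \<oplus>\<^bsub>M\<^esub> h) \<in> K" using h KE(3) by simp
      then have "\<ominus>\<^bsub>M\<^esub> a \<oplus>\<^bsub>M\<^esub> \<ominus>\<^bsub>M\<^esub> h \<in> K" using h hc by (simp add: M.minus_add)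
      then show "\<ominus>\<^bsub>M\<^esub> a \<in> {x \<in> carrier M. \<exists>h\<in>?H. x \<oplus>\<^bsub>M\<^esub> h \<in> K}"
        using h(1) HE(3)[OF h(2)] by auto
      fix c assume c: "c \<in> carrier R"
      have "c \<odot>\<^bsub>M\<^esub> (a \<oplus>\<^bsub>M\<^esub> h) \<in> K" using c h KE(4) by simp
      then have "c \<odot>\<^bsub>M\<^esub> a \<oplus>\<^bsub>M\<^esub> c \<odot>\<^bsub>M\<^esub> h \<in> K" using c h hc by (simp add: smult_r_distr)
      then show "c \<odot>\<^bsub>M\<^esub> a \<in> {x \<in> carrier M. \<exists>h\<in>?H. x \<oplus>\<^bsub>M\<^esub> h \<in> K}"
        using h(1) c HE(4)[OF c h(2)] by auto
    next
      fix a b assume "a \<in> {x \<in> carrier M. \<exists>h\<in>?H. x \<oplus>\<^bsub>M\<^esub> h \<in> K}" "b \<in> {x \<in> carrier M. \<exists>h\<in>?H. x \<oplus>\<^bsub>M\<^esub> h \<in> K}"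
      then obtain h k where h: "a \<in> carrier M" "h \<in> ?H" "a \<oplus>\<^bsub>M\<^esub> h \<in> K"
        "b \<in> carrier M" "k \<in> ?H" "b \<oplus>\<^bsub>M\<^esub> k \<in> K" by auto
      have hc: "h \<in> carrier M" "k \<in> carrier M" using HE(1) h by auto
      have "(a \<oplus>\<^bsub>M\<^esub> h) \<oplus>\<^bsub>M\<^esub> (b \<oplus>\<^bsub>M\<^esub> k) \<in> K" using h KE(5) by simp
      then have "(a \<oplus>\<^bsub>M\<^esub> b) \<oplus>\<^bsub>M\<^esub> (h \<oplus>\<^bsub>M\<^esub> k) \<in> K"
        using M.add_add_swap[of a h b k] h(1,4) hc by simp
      then show "a \<oplus>\<^bsub>M\<^esub> b \<in> {x \<in> carrier M. \<exists>h\<in>?H. x \<oplus>\<^bsub>M\<^esub> h \<in> K}"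
        using h(1,4) HE(5)[OF h(2,5)] by blast
    qed auto
    ultimately show ?thesis using colon_ideal g by auto
  qed
  have "subset.chain {I. ideal I R} (J ` C)"
  proof -
    have "J K \<subseteq> J L \<or> J L \<subseteq> J K" if "K \<in> C" "L \<in> C" for K L
      using comp[OF that] unfolding J_def by blast
    then show ?thesis using J by (auto simp: subset_chain_def)
  qed
  then have "\<Union>(J ` C) \<in> J ` C" using assms(4) by (intro ideal_chain_is_trivial) auto
  then obtain K2 where K2: "K2 \<in> C" "\<And>K. K \<in> C \<Longrightarrow> J K \<subseteq> J K2" by blast
  obtain K0 where K0: "K0 \<in> C" "K1 \<subseteq> K0" "K2 \<subseteq> K0" using comp[OF K1(1) K2(1)] K1(1) K2(1) by blast
  have "K \<inter> module_span R M (insert g A) \<subseteq> K0" if K: "K \<in> C" for K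
  proof (cases "K \<subseteq> K0")
    case False
    then have K0K: "K0 \<subseteq> K" using comp K K0 by blast
    show ?thesis
    proof
      fix y assume y: "y \<in> K \<inter> module_span R M (insert g A)"
      then have "y \<in> add_span R M ?H g"
        using subsetD[OF module_span_insert[OF Ac g]] by simp
      then obtain h r where h: "h \<in> ?H" "r \<in> carrier R" "y = h \<oplus>\<^bsub>M\<^esub> r \<odot>\<^bsub>M\<^esub> g"
        unfolding add_span_def by blast
      have hc: "h \<in> carrier M" using h HE(1) by auto
      have yr: "y = r \<odot>\<^bsub>M\<^esub> g \<oplus>\<^bsub>M\<^esub> h" using h hc g by (simp add: M.a_comm)
      then have "r \<in> J K" using y h unfolding J_def by auto
      then have "r \<in> J K2" using K2 K by blast
      then obtain h' where h': "h' \<in> ?H" "r \<odot>\<^bsub>M\<^esub> g \<oplus>\<^bsub>M\<^esub> h' \<in> K2" unfolding J_def by blast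
      have hc': "h' \<in> carrier M" using h' HE(1) by auto
      let ?y = "r \<odot>\<^bsub>M\<^esub> g \<oplus>\<^bsub>M\<^esub> h'"
      have y0: "?y \<in> K0" using h' K0 by auto
      \<comment> \<open>y and \<open>?y\<close> have the same coefficient at g, so their difference
        lies in H as well as in K and is caught by K1.\<close>
      have e: "y = (h \<ominus>\<^bsub>M\<^esub> h') \<oplus>\<^bsub>M\<^esub> ?y"
      proof -
        have "(h \<ominus>\<^bsub>M\<^esub> h') \<oplus>\<^bsub>M\<^esub> (h' \<oplus>\<^bsub>M\<^esub> r \<odot>\<^bsub>M\<^esub> g) = h \<oplus>\<^bsub>M\<^esub> ((\<ominus>\<^bsub>M\<^esub> h' \<oplus>\<^bsub>M\<^esub> h') \<oplus>\<^bsub>M\<^esub> r \<odot>\<^bsub>M\<^esub> g)"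
          using hc hc' g h by (simp add: a_minus_def M.a_assoc)
        then show ?thesis using hc hc' g h by (simp add: M.r_neg M.a_comm)
      qed
      have "h \<ominus>\<^bsub>M\<^esub> h' \<in> K"
        by (rule submodule_cancel[OF sub[OF K], of _ ?y]) (use hc hc' e y y0 K0K in auto)
      moreover have "h \<ominus>\<^bsub>M\<^esub> h' \<in> ?H" using submodule_diff[OF H] h h' by blast
      ultimately have "h \<ominus>\<^bsub>M\<^esub> h' \<in> K0" using K1(2) K K0 by blast
      then show "y \<in> K0" using e y0 submoduleE(5)[OF sub[OF K0(1)]] by simp
    qed
  qed auto
  then show ?case using K0(1) by blast
qed

lemma noetherian_moduleI:
  assumes "noetherian_ring R" "fin_gen_module R M"
  shows "noetherian_module R M"
proof
  fix C assume C: "C \<noteq> {}" "subset.chain {K. submodule K R M} C"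
  obtain A where A: "finite A" "A \<subseteq> carrier M" "module_span R M A = carrier M"
    using assms(2) by (auto simp: fin_gen_module_def)
  obtain K0 where K0: "K0 \<in> C" "\<forall>K\<in>C. K \<inter> carrier M \<subseteq> K0"
    using submodule_chain_stable_on_span[OF assms(1) A(1,2) C] A(3) by auto
  have "\<Union>C = K0"
  proof
    show "\<Union>C \<subseteq> K0"
    proof
      fix x assume "x \<in> \<Union>C"
      then obtain K where K: "x \<in> K" "K \<in> C" by blast
      then have "submodule K R M" using C(2) by (auto simp: subset.chain_def)
      then show "x \<in> K0" using submoduleE(1) K K0 by blast
    qed
  qed (use K0 in blast)
  then show "\<Union>C \<in> C" using K0 by simp
qed

end

section \<open>Linear maps and the standard resolution\<close>

definition module_map ::
  "('r, 'a) ring_scheme \<Rightarrow> ('r, 'm, 'k) module_scheme \<Rightarrow> ('r, 'n, 'l) module_scheme \<Rightarrow> ('m \<Rightarrow> 'n) \<Rightarrow> bool" where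
  "module_map R M N f \<longleftrightarrow> f \<in> carrier M \<rightarrow> carrier N \<and>
     (\<forall>x \<in> carrier M. \<forall>y \<in> carrier M. f (x \<oplus>\<^bsub>M\<^esub> y) = f x \<oplus>\<^bsub>N\<^esub> f y) \<and>
     (\<forall>r \<in> carrier R. \<forall>x \<in> carrier M. f (r \<odot>\<^bsub>M\<^esub> x) = r \<odot>\<^bsub>N\<^esub> f x)"

lemma hom_module_carrier_iff:
  "f \<in> carrier (hom_module R M N) \<longleftrightarrow> module_map R M N f \<and> f \<in> extensional (carrier M)"
  by (auto simp: hom_module_def module_map_def PiE_def)

lemma module_mapD:
  assumes "module_map R M N f"
  shows "x \<in> carrier M \<Longrightarrow> f x \<in> carrier N"
    and "x \<in> carrier M \<Longrightarrow> y \<in> carrier M \<Longrightarrow> f (x \<oplus>\<^bsub>M\<^esub> y) = f x \<oplus>\<^bsub>N\<^esub> f y"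
    and "r \<in> carrier R \<Longrightarrow> x \<in> carrier M \<Longrightarrow> f (r \<odot>\<^bsub>M\<^esub> x) = r \<odot>\<^bsub>N\<^esub> f x"
  using assms by (auto simp: module_map_def)

lemma module_map_comp:
  assumes "module_map R L M f" "module_map R M N g"
  shows "module_map R L N (\<lambda>x. g (f x))"
  using assms by (auto simp: module_map_def Pi_iff)

lemma module_map_zero:
  assumes "module R M" "module R N" "module_map R M N f"
  shows "f \<zero>\<^bsub>M\<^esub> = \<zero>\<^bsub>N\<^esub>"
proof -
  interpret M: module R M by fact
  interpret N: module R N by fact
  have "f (\<zero>\<^bsub>R\<^esub> \<odot>\<^bsub>M\<^esub> \<zero>\<^bsub>M\<^esub>) = \<zero>\<^bsub>R\<^esub> \<odot>\<^bsub>N\<^esub> f \<zero>\<^bsub>M\<^esub>"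
    by (rule module_mapD(3)[OF assms(3)]) simp_all
  then show ?thesis using module_mapD(1)[OF assms(3)] by simp
qed

lemma module_map_cong:
  assumes "module R M" "module_map R M N f" "\<And>x. x \<in> carrier M \<Longrightarrow> g x = f x"
  shows "module_map R M N g"
proof -
  interpret M: module R M by fact
  show ?thesis using assms(2,3) by (auto simp: module_map_def Pi_iff)
qed

lemma module_map_submodule_vimage:
  assumes "module R M" "module R N" "module_map R M N f" "submodule K R N"
  shows "submodule {x \<in> carrier M. f x \<in> K} R M"
proof -
  interpret M: module R M by fact
  interpret N: module R N by fact
  note D = module_mapD[OF assms(3)] and E = N.submoduleE[OF assms(4)]
  have neg: "f (\<ominus>\<^bsub>M\<^esub> x) = \<ominus>\<^bsub>N\<^esub> f x" if x: "x \<in> carrier M" for x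
  proof -
    have "\<ominus>\<^bsub>M\<^esub> x = (\<ominus>\<^bsub>R\<^esub> \<one>\<^bsub>R\<^esub>) \<odot>\<^bsub>M\<^esub> x" using x by (simp add: M.smult_l_minus)
    then have "f (\<ominus>\<^bsub>M\<^esub> x) = (\<ominus>\<^bsub>R\<^esub> \<one>\<^bsub>R\<^esub>) \<odot>\<^bsub>N\<^esub> f x" using D(3) x by simp
    then show ?thesis using D(1)[OF x] by (simp add: N.smult_l_minus)
  qed
  show ?thesis
    by (rule M.submoduleI)
      (use D E N.submodule_zero[OF assms(4)] module_map_zero[OF assms(1-3)] neg in auto)
qed

section \<open>Free modules\<close>

context cring begin

lemma free_module_simps [simp]:
  "\<zero>\<^bsub>free_module R X\<^esub> = (\<lambda>_. \<zero>)"
  "(g \<oplus>\<^bsub>free_module R X\<^esub> h) = (\<lambda>x. g x \<oplus> h x)"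
  "r \<odot>\<^bsub>free_module R X\<^esub> h = (\<lambda>x. r \<otimes> h x)"
  by (simp_all add: free_module_def)

lemma free_module_carrierI:
  assumes "\<And>x. h x \<in> carrier R" "finite {x. h x \<noteq> \<zero>}" "\<And>x. h x \<noteq> \<zero> \<Longrightarrow> x \<in> X"
  shows "h \<in> carrier (free_module R X)"
  using assms by (auto simp: free_module_def)

lemma free_module_carrierD:
  assumes "h \<in> carrier (free_module R X)"
  shows "h x \<in> carrier R" "finite {x. h x \<noteq> \<zero>}" "h x \<noteq> \<zero> \<Longrightarrow> x \<in> X"
  using assms by (auto simp: free_module_def)

lemma free_module_mono: "X \<subseteq> Y \<Longrightarrow> carrier (free_module R X) \<subseteq> carrier (free_module R Y)"
  by (auto simp: free_module_def)

lemma free_add_closed: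
  assumes "g \<in> carrier (free_module R X)" "h \<in> carrier (free_module R X)"
  shows "(\<lambda>x. g x \<oplus> h x) \<in> carrier (free_module R X)"
proof (rule free_module_carrierI)
  note g = free_module_carrierD[OF assms(1)] and h = free_module_carrierD[OF assms(2)]
  show "g x \<oplus> h x \<in> carrier R" for x using g h by simp
  have s: "{x. g x \<oplus> h x \<noteq> \<zero>} \<subseteq> {x. g x \<noteq> \<zero>} \<union> {x. h x \<noteq> \<zero>}" using g h by auto
  then show "finite {x. g x \<oplus> h x \<noteq> \<zero>}" using g(2) h(2) finite_subset by blast
  show "x \<in> X" if "g x \<oplus> h x \<noteq> \<zero>" for x using that s g(3) h(3) by blast
qed

lemma free_smult_closed:
  assumes "r \<in> carrier R" "h \<in> carrier (free_module R X)"
  shows "(\<lambda>x. r \<otimes> h x) \<in> carrier (free_module R X)"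
proof (rule free_module_carrierI)
  note h = free_module_carrierD[OF assms(2)]
  show "r \<otimes> h x \<in> carrier R" for x using assms(1) h by simp
  have s: "{x. r \<otimes> h x \<noteq> \<zero>} \<subseteq> {x. h x \<noteq> \<zero>}" using assms(1) by auto
  then show "finite {x. r \<otimes> h x \<noteq> \<zero>}" using h(2) finite_subset by blast
  show "x \<in> X" if "r \<otimes> h x \<noteq> \<zero>" for x using that s h(3) by blast
qed

lemma free_zero_closed: "(\<lambda>_. \<zero>) \<in> carrier (free_module R X)"
  by (rule free_module_carrierI) auto

lemma free_module_module: "module R (free_module R X)"
proof (rule moduleI)
  note D = free_module_carrierD(1)
  show "abelian_group (free_module R X)"
  proof (rule abelian_groupI)
    fix h assume h: "h \<in> carrier (free_module R X)"
    have "(\<lambda>x. (\<ominus> \<one>) \<otimes> h x) \<in> carrier (free_module R X)" using h by (intro free_smult_closed) auto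
    moreover have "(\<lambda>x. (\<ominus> \<one>) \<otimes> h x) \<oplus>\<^bsub>free_module R X\<^esub> h = \<zero>\<^bsub>free_module R X\<^esub>"
      using D[OF h] by (auto simp: l_minus l_neg)
    ultimately show "\<exists>g\<in>carrier (free_module R X). g \<oplus>\<^bsub>free_module R X\<^esub> h = \<zero>\<^bsub>free_module R X\<^esub>"
      by blast
  next
    fix g h assume g: "g \<in> carrier (free_module R X)" and h: "h \<in> carrier (free_module R X)"
    show "g \<oplus>\<^bsub>free_module R X\<^esub> h \<in> carrier (free_module R X)" using free_add_closed[OF g h] by simp
    show "g \<oplus>\<^bsub>free_module R X\<^esub> h = h \<oplus>\<^bsub>free_module R X\<^esub> g"
      using a_comm[OF D[OF g] D[OF h]] by simp
    fix k assume k: "k \<in> carrier (free_module R X)"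
    show "g \<oplus>\<^bsub>free_module R X\<^esub> h \<oplus>\<^bsub>free_module R X\<^esub> k
      = g \<oplus>\<^bsub>free_module R X\<^esub> (h \<oplus>\<^bsub>free_module R X\<^esub> k)"
      using a_assoc[OF D[OF g] D[OF h] D[OF k]] by simp
  next
    show "\<zero>\<^bsub>free_module R X\<^esub> \<in> carrier (free_module R X)" using free_zero_closed by simp
    show "\<zero>\<^bsub>free_module R X\<^esub> \<oplus>\<^bsub>free_module R X\<^esub> h = h" if "h \<in> carrier (free_module R X)" for h
      using D[OF that] by simp
  qed
next
  note D = free_module_carrierD(1)
  fix a b h g assume a: "a \<in> carrier R" and b: "b \<in> carrier R" and h: "h \<in> carrier (free_module R X)"
    and g: "g \<in> carrier (free_module R X)"
  show "a \<odot>\<^bsub>free_module R X\<^esub> h \<in> carrier (free_module R X)" using free_smult_closed[OF a h] by simp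
  show "(a \<oplus> b) \<odot>\<^bsub>free_module R X\<^esub> h = a \<odot>\<^bsub>free_module R X\<^esub> h \<oplus>\<^bsub>free_module R X\<^esub> b \<odot>\<^bsub>free_module R X\<^esub> h"
    using a b D[OF h] by (simp add: l_distr)
  show "a \<odot>\<^bsub>free_module R X\<^esub> (h \<oplus>\<^bsub>free_module R X\<^esub> g)
    = a \<odot>\<^bsub>free_module R X\<^esub> h \<oplus>\<^bsub>free_module R X\<^esub> a \<odot>\<^bsub>free_module R X\<^esub> g"
    using a D[OF h] D[OF g] by (simp add: r_distr)
  show "(a \<otimes> b) \<odot>\<^bsub>free_module R X\<^esub> h = a \<odot>\<^bsub>free_module R X\<^esub> (b \<odot>\<^bsub>free_module R X\<^esub> h)"
    using a b D[OF h] by (simp add: m_assoc)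
next
  show "\<one> \<odot>\<^bsub>free_module R X\<^esub> h = h" if "h \<in> carrier (free_module R X)" for h
    using free_module_carrierD(1)[OF that] by simp
qed (rule is_cring)

lemma free_basis_closed: "x \<in> X \<Longrightarrow> free_basis R x \<in> carrier (free_module R X)"
proof (rule free_module_carrierI)
  have "{y. free_basis R x y \<noteq> \<zero>} \<subseteq> {x}" by (auto simp: free_basis_def)
  then show "finite {y. free_basis R x y \<noteq> \<zero>}" using finite_subset by blast
qed (auto simp: free_basis_def split: if_splits)

lemma free_module_induct [consumes 1, case_names zero add]:
  assumes "h \<in> carrier (free_module R X)"
    and zero: "\<Phi> \<zero>\<^bsub>free_module R X\<^esub>"
    and add: "\<And>x r g. x \<in> X \<Longrightarrow> r \<in> carrier R \<Longrightarrow> g \<in> carrier (free_module R X) \<Longrightarrow> \<Phi> g \<Longrightarrow>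
      \<Phi> (g \<oplus>\<^bsub>free_module R X\<^esub> r \<odot>\<^bsub>free_module R X\<^esub> free_basis R x)"
  shows "\<Phi> h"
proof -
  have "finite S \<Longrightarrow> (\<forall>h. h \<in> carrier (free_module R X) \<longrightarrow> {x. h x \<noteq> \<zero>} \<subseteq> S \<longrightarrow> \<Phi> h)" for S
  proof (induction S rule: finite_induct)
    case empty
    show ?case
    proof (intro allI impI)
      fix h :: "'c \<Rightarrow> 'a" assume "{x. h x \<noteq> \<zero>} \<subseteq> {}"
      then have "h = (\<lambda>_. \<zero>)" by (intro ext) blast
      then show "\<Phi> h" using zero by simp
    qed
  next
    case (insert x S)
    show ?case
    proof (intro allI impI)
      fix h assume h: "h \<in> carrier (free_module R X)" and s: "{x. h x \<noteq> \<zero>} \<subseteq> insert x S"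
      note D = free_module_carrierD[OF h]
      let ?g = "h(x := \<zero>)"
      have g: "?g \<in> carrier (free_module R X)"
      proof (rule free_module_carrierI)
        have "{y. ?g y \<noteq> \<zero>} \<subseteq> {y. h y \<noteq> \<zero>}" by auto
        then show "finite {y. ?g y \<noteq> \<zero>}" using D(2) finite_subset by blast
        show "y \<in> X" if "?g y \<noteq> \<zero>" for y using that D(3) by (cases "y = x") auto
      qed (use D in auto)
      have "{y. ?g y \<noteq> \<zero>} \<subseteq> S" using s by auto
      then have g2: "\<Phi> ?g" using insert.IH g by blast
      show "\<Phi> h"
      proof (cases "h x = \<zero>")
        case True then have "?g = h" by auto
        then show ?thesis using g2 by simp
      next
        case False
        have "?g \<oplus>\<^bsub>free_module R X\<^esub> h x \<odot>\<^bsub>free_module R X\<^esub> free_basis R x = h"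
          using D(1) by (auto simp: free_basis_def)
        then show ?thesis using add[OF D(3)[OF False] D(1) g g2, of x] by simp
      qed
    qed
  qed
  from this[OF free_module_carrierD(2)[OF assms(1)]] show ?thesis using assms(1) by blast
qed

text \<open>A linear condition modulo \<open>K\<close> may be checked on the basis. With varying
  \<open>K\<close> this serves for codomains of maps, for cycles, and for congruences between
  cochains.\<close>

lemma module_map_free_mem:
  assumes N: "module R N" and f: "module_map R (free_module R X) N f" and K: "submodule K R N"
    and b: "\<And>x. x \<in> X \<Longrightarrow> f (free_basis R x) \<in> K" and h: "h \<in> carrier (free_module R X)"
  shows "f h \<in> K"
proof -
  interpret N: module R N by fact
  interpret F: module R "free_module R X" by (rule free_module_module)
  note E = N.submoduleE[OF K]
  show ?thesis using h
  proof (induction h rule: free_module_induct)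
    case zero
    show ?case using module_map_zero[OF F.module_axioms N f] N.submodule_zero[OF K] by simp
  next
    case (add x r g)
    have e: "free_basis R x \<in> carrier (free_module R X)" by (rule free_basis_closed[OF add(1)])
    have "f (g \<oplus>\<^bsub>free_module R X\<^esub> r \<odot>\<^bsub>free_module R X\<^esub> free_basis R x) = f g \<oplus>\<^bsub>N\<^esub> r \<odot>\<^bsub>N\<^esub> f (free_basis R x)"
      using module_mapD[OF f] add(2,3) e F.smult_closed by metis
    also have "\<dots> \<in> K" using E add b by auto
    finally show ?case .
  qed
qed

lemma module_map_free_eq:
  assumes N: "module R N" and f: "module_map R (free_module R X) N f" and g: "module_map R (free_module R X) N g"
    and b: "\<And>x. x \<in> X \<Longrightarrow> f (free_basis R x) = g (free_basis R x)" and h: "h \<in> carrier (free_module R X)"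
  shows "f h = g h"
proof -
  interpret F: module R "free_module R X" by (rule free_module_module)
  show ?thesis using h
  proof (induction h rule: free_module_induct)
    case zero
    show ?case using module_map_zero[OF F.module_axioms N f] module_map_zero[OF F.module_axioms N g] by simp
  next
    case (add x r k)
    have e: "free_basis R x \<in> carrier (free_module R X)" by (rule free_basis_closed[OF add(1)])
    have lin: "u (k \<oplus>\<^bsub>free_module R X\<^esub> r \<odot>\<^bsub>free_module R X\<^esub> free_basis R x) = u k \<oplus>\<^bsub>N\<^esub> r \<odot>\<^bsub>N\<^esub> u (free_basis R x)"
      if "module_map R (free_module R X) N u" for u
      using module_mapD[OF that] add(2,3) e F.smult_closed by metis
    show ?case unfolding lin[OF f] lin[OF g] using add(1,4) b by simp
  qed
qed

end

section \<open>Linear extension from a basis\<close>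

context module begin

lemma module_map_add:
  assumes "module R L" "module_map R L M f" "module_map R L M g"
  shows "module_map R L M (\<lambda>x. f x \<oplus>\<^bsub>M\<^esub> g x)"
proof -
  interpret L: module R L by fact
  note F = module_mapD[OF assms(2)] and G = module_mapD[OF assms(3)]
  show ?thesis unfolding module_map_def
  proof (intro conjI ballI)
    fix x y assume "x \<in> carrier L" "y \<in> carrier L"
    then show "f (x \<oplus>\<^bsub>L\<^esub> y) \<oplus>\<^bsub>M\<^esub> g (x \<oplus>\<^bsub>L\<^esub> y) = f x \<oplus>\<^bsub>M\<^esub> g x \<oplus>\<^bsub>M\<^esub> (f y \<oplus>\<^bsub>M\<^esub> g y)"
      using F G M.add_add_swap[of "f x" "f y" "g x" "g y"] by simp
  qed (use F G in \<open>auto simp: smult_r_distr\<close>)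
qed

lemma module_map_smult:
  assumes "module R L" "module_map R L M f" "r \<in> carrier R"
  shows "module_map R L M (\<lambda>x. r \<odot>\<^bsub>M\<^esub> f x)"
proof -
  interpret L: module R L by fact
  note F = module_mapD[OF assms(2)]
  show ?thesis unfolding module_map_def
    using F assms(3) by (auto simp: smult_r_distr intro: smult_commute)
qed

lemma module_map_minus:
  assumes "module R L" "module_map R L M f" "module_map R L M g"
  shows "module_map R L M (\<lambda>x. f x \<ominus>\<^bsub>M\<^esub> g x)"
proof -
  have "module_map R L M (\<lambda>x. f x \<oplus>\<^bsub>M\<^esub> (\<ominus> \<one>) \<odot>\<^bsub>M\<^esub> g x)"
    by (intro module_map_add module_map_smult assms) auto
  then show ?thesis
    by (rule module_map_cong[OF assms(1)])
      (use module_mapD(1)[OF assms(3)] in \<open>simp add: smult_l_minus a_minus_def\<close>)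
qed

text \<open>Two functions and their sum have different supports; summing over a common finite set is
  what makes \<open>lin_ext\<close> visibly additive.\<close>

lemma lin_ext_eq:
  assumes "finite A" "{x. h x \<noteq> \<zero>} \<subseteq> A" "\<And>x. h x \<in> carrier R" "\<And>x. x \<in> A \<Longrightarrow> g x \<in> carrier M"
  shows "lin_ext R M g h = (\<Oplus>\<^bsub>M\<^esub>x \<in> A. h x \<odot>\<^bsub>M\<^esub> g x)"
  unfolding lin_ext_def
  by (rule M.add.finprod_mono_neutral_cong_left) (use assms in auto)

lemma lin_ext_hom:
  assumes "\<And>x. x \<in> X \<Longrightarrow> g x \<in> carrier M"
  shows "module_map R (free_module R X) M (lin_ext R M g)"
  unfolding module_map_def
proof (intro conjI ballI Pi_I)
  fix h assume h: "h \<in> carrier (free_module R X)"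
  note H = R.free_module_carrierD[OF h]
  have "h x \<odot>\<^bsub>M\<^esub> g x \<in> carrier M" if "h x \<noteq> \<zero>" for x using that H assms by auto
  then show "lin_ext R M g h \<in> carrier M" unfolding lin_ext_def by (intro M.finsum_closed) auto
  fix r assume r: "r \<in> carrier R"
  have "lin_ext R M g (\<lambda>x. r \<otimes> h x) = (\<Oplus>\<^bsub>M\<^esub>x \<in> {x. h x \<noteq> \<zero>}. (r \<otimes> h x) \<odot>\<^bsub>M\<^esub> g x)"
    by (rule lin_ext_eq) (use H r assms in auto)
  also have "\<dots> = (\<Oplus>\<^bsub>M\<^esub>x \<in> {x. h x \<noteq> \<zero>}. r \<odot>\<^bsub>M\<^esub> (h x \<odot>\<^bsub>M\<^esub> g x))"
    by (rule M.finsum_cong') (use H r assms in \<open>auto simp: smult_assoc1\<close>)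
  also have "\<dots> = r \<odot>\<^bsub>M\<^esub> lin_ext R M g h" unfolding lin_ext_def
    by (rule finsum_smult_ldistr[symmetric]) (use H r assms in auto)
  finally show "lin_ext R M g (r \<odot>\<^bsub>free_module R X\<^esub> h) = r \<odot>\<^bsub>M\<^esub> lin_ext R M g h" by simp
next
  fix h k assume h: "h \<in> carrier (free_module R X)" and k: "k \<in> carrier (free_module R X)"
  note H = R.free_module_carrierD[OF h] and K = R.free_module_carrierD[OF k]
  let ?A = "{x. h x \<noteq> \<zero>} \<union> {x. k x \<noteq> \<zero>}"
  have A: "finite ?A" "\<And>x. x \<in> ?A \<Longrightarrow> g x \<in> carrier M" using H K assms by auto
  have "lin_ext R M g (\<lambda>x. h x \<oplus> k x) = (\<Oplus>\<^bsub>M\<^esub>x \<in> ?A. (h x \<oplus> k x) \<odot>\<^bsub>M\<^esub> g x)"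
    by (rule lin_ext_eq[OF A(1) _ _ A(2)]) (use H K in auto)
  also have "\<dots> = (\<Oplus>\<^bsub>M\<^esub>x \<in> ?A. h x \<odot>\<^bsub>M\<^esub> g x \<oplus>\<^bsub>M\<^esub> k x \<odot>\<^bsub>M\<^esub> g x)"
    by (rule M.finsum_cong') (use H(1) K(1) A(2) in \<open>auto simp: smult_l_distr\<close>)
  also have "\<dots> = (\<Oplus>\<^bsub>M\<^esub>x \<in> ?A. h x \<odot>\<^bsub>M\<^esub> g x) \<oplus>\<^bsub>M\<^esub> (\<Oplus>\<^bsub>M\<^esub>x \<in> ?A. k x \<odot>\<^bsub>M\<^esub> g x)"
    by (rule M.finsum_addf) (use H(1) K(1) A(2) in auto)
  also have "(\<Oplus>\<^bsub>M\<^esub>x \<in> ?A. h x \<odot>\<^bsub>M\<^esub> g x) = lin_ext R M g h"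
    by (rule lin_ext_eq[OF A(1) _ _ A(2), symmetric]) (use H in auto)
  also have "(\<Oplus>\<^bsub>M\<^esub>x \<in> ?A. k x \<odot>\<^bsub>M\<^esub> g x) = lin_ext R M g k"
    by (rule lin_ext_eq[OF A(1) _ _ A(2), symmetric]) (use K in auto)
  finally show "lin_ext R M g (h \<oplus>\<^bsub>free_module R X\<^esub> k) = lin_ext R M g h \<oplus>\<^bsub>M\<^esub> lin_ext R M g k" by simp
qed

lemma lin_ext_basis:
  assumes "g x \<in> carrier M"
  shows "lin_ext R M g (free_basis R x) = g x"
proof -
  have "lin_ext R M g (free_basis R x) = (\<Oplus>\<^bsub>M\<^esub>y \<in> {x}. free_basis R x y \<odot>\<^bsub>M\<^esub> g y)"
    by (rule lin_ext_eq) (use assms in \<open>auto simp: free_basis_def split: if_splits\<close>)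
  also have "\<dots> = free_basis R x x \<odot>\<^bsub>M\<^esub> g x" using assms by (simp add: free_basis_def)
  finally show ?thesis using assms by (simp add: free_basis_def)
qed

end

text \<open>The functions whose labels \<open>cycle_gen\<close> form the basis one degree higher.
  Speaking of cycles instead of labels keeps the datatype out of the arguments.\<close>

definition res_cycles ::
  "('r, 'a) ring_scheme \<Rightarrow> ('r, 'm, 'k) module_scheme \<Rightarrow> nat \<Rightarrow> (('r, 'm) res_gen \<Rightarrow> 'r) set" where
  "res_cycles R M n = {h \<in> carrier (std_res R M n).
     if n = 0 then res_augmentation R M h = \<zero>\<^bsub>M\<^esub> else res_boundary R h = (\<lambda>_. \<zero>\<^bsub>R\<^esub>)}"

context cring begin

lemma free_module_submodule_cong:
  assumes "submodule K R (free_module R X)" "X \<subseteq> Y"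
  shows "submodule K R (free_module R Y)"
proof -
  interpret X: module R "free_module R X" by (rule free_module_module)
  interpret Y: module R "free_module R Y" by (rule free_module_module)
  note E = X.submoduleE[OF assms(1)]
  show ?thesis
    by (rule Y.submoduleI_smult)
      (use E(1,4,5) X.submodule_zero[OF assms(1)] free_module_mono[OF assms(2)] in auto)
qed

lemma free_module_submodule: "X \<subseteq> Y \<Longrightarrow> submodule (carrier (free_module R X)) R (free_module R Y)"
  using free_module_submodule_cong[OF module.carrier_is_submodule[OF free_module_module]] .

lemma module_map_free_cod:
  assumes "module_map R L (free_module R Y) f" "\<And>x. x \<in> carrier L \<Longrightarrow> f x \<in> carrier (free_module R X)"
  shows "module_map R L (free_module R X) f"
  using assms by (auto simp: module_map_def)

text \<open>The functions are zero off the recorded graph, so the graph determines them; finiteness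
  of the supports makes \<open>Abs_fset\<close> injective on these graphs.\<close>

lemma inj_on_cycle_gen: "inj_on (cycle_gen R) (carrier (free_module R UNIV))"
proof (rule inj_onI)
  fix h k :: "('a, 'c) res_gen \<Rightarrow> 'a"
  assume h: "h \<in> carrier (free_module R UNIV)" and k: "k \<in> carrier (free_module R UNIV)"
    and eq: "cycle_gen R h = cycle_gen R k"
  have fin: "finite {(x, u x) | x. u x \<noteq> \<zero>}" if "u \<in> carrier (free_module R UNIV)" for u :: "('a, 'c) res_gen \<Rightarrow> 'a"
  proof -
    have "{(x, u x) | x. u x \<noteq> \<zero>} = (\<lambda>x. (x, u x)) ` {x. u x \<noteq> \<zero>}" by auto
    then show ?thesis using free_module_carrierD(2)[OF that] by simp
  qed
  have "{(x, h x) | x. h x \<noteq> \<zero>} = {(x, k x) | x. k x \<noteq> \<zero>}"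
    using eq Abs_fset_inject[of "{(x, h x) | x. h x \<noteq> \<zero>}" "{(x, k x) | x. k x \<noteq> \<zero>}"] fin[OF h] fin[OF k]
    by (simp add: cycle_gen_def)
  then have gr: "\<And>x y. (h x = y \<and> y \<noteq> \<zero>) = (k x = y \<and> y \<noteq> \<zero>)" by (simp add: set_eq_iff) metis
  show "h = k"
  proof
    fix x show "h x = k x" using gr[of x "h x"] gr[of x "k x"] by metis
  qed
qed

lemma gen_cycle_cycle_gen:
  assumes "h \<in> carrier (free_module R X)"
  shows "gen_cycle R (cycle_gen R h) = h"
proof -
  have "h \<in> carrier (free_module R UNIV)" using assms free_module_mono[of X UNIV] by auto
  then show ?thesis unfolding gen_cycle_def by (rule the_inv_into_f_f[OF inj_on_cycle_gen])
qed

lemma free_map_basis: "free_map R \<sigma> (free_basis R x) = free_basis R (\<sigma> x)"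
proof -
  interpret F: module R "free_module R UNIV" by (rule free_module_module)
  show ?thesis unfolding free_map_def by (rule F.lin_ext_basis) (simp add: free_basis_closed)
qed

lemma free_map_hom:
  assumes "\<And>x. x \<in> X \<Longrightarrow> \<sigma> x \<in> Y"
  shows "module_map R (free_module R X) (free_module R Y) (free_map R \<sigma>)"
proof -
  interpret F: module R "free_module R UNIV" by (rule free_module_module)
  have h: "module_map R (free_module R X) (free_module R UNIV) (free_map R \<sigma>)"
    unfolding free_map_def by (rule F.lin_ext_hom) (simp add: free_basis_closed)
  show ?thesis
  proof (rule module_map_free_cod[OF h])
    show "free_map R \<sigma> k \<in> carrier (free_module R Y)" if "k \<in> carrier (free_module R X)" for k
      by (rule module_map_free_mem[OF F.module_axioms h free_module_submodule[OF subset_UNIV] _ that])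
        (simp add: free_map_basis free_basis_closed assms)
  qed
qed

end

section \<open>Exactness and projectivity of the standard resolution\<close>

context module begin

lemma std_res_module: "module R (std_res R M n)"
  unfolding std_res_def by (rule R.free_module_module)

lemma res_basis_Suc: "res_basis R M (Suc n) = cycle_gen R ` res_cycles R M n"
  by (simp add: res_cycles_def std_res_def)

lemma augmentation_hom: "module_map R (std_res R M 0) M (res_augmentation R M)"
  unfolding std_res_def res_augmentation_def by (rule lin_ext_hom) auto

lemma augmentation_basis: "x \<in> carrier M \<Longrightarrow> res_augmentation R M (free_basis R (Elem x)) = x"
  unfolding res_augmentation_def by (subst lin_ext_basis) auto

lemma res_cycles_subset: "res_cycles R M n \<subseteq> carrier (std_res R M n)"
  by (auto simp: res_cycles_def)

lemma gen_cycle_res_basis: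
  assumes "z \<in> res_cycles R M n"
  shows "gen_cycle R (cycle_gen R z) = z"
  using assms res_cycles_subset[of n] R.gen_cycle_cycle_gen[of z] by (auto simp: std_res_def)

text \<open>This is the exactness of the resolution, with a preimage that requires no
  choice.\<close>

lemma boundary_basis:
  assumes "z \<in> res_cycles R M n"
  shows "res_boundary R (free_basis R (cycle_gen R z)) = z"
proof -
  interpret F: module R "free_module R UNIV" by (rule R.free_module_module)
  have "z \<in> carrier (free_module R UNIV)"
    using assms res_cycles_subset[of n] R.free_module_mono[OF subset_UNIV] unfolding std_res_def by blast
  then show ?thesis unfolding res_boundary_def
    by (subst F.lin_ext_basis) (simp_all add: gen_cycle_res_basis[OF assms])
qed

text \<open>The codomain is at first the free module on all labels; that the image lies in degree n
  is known only after \<open>boundary_in_cycles\<close>.\<close>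

lemma boundary_hom_UNIV: "module_map R (std_res R M (Suc n)) (free_module R UNIV) (res_boundary R)"
proof -
  interpret F: module R "free_module R UNIV" by (rule R.free_module_module)
  show ?thesis unfolding std_res_def res_boundary_def
  proof (rule F.lin_ext_hom)
    fix x assume "x \<in> res_basis R M (Suc n)"
    then obtain z where z: "z \<in> res_cycles R M n" "x = cycle_gen R z" by (auto simp only: res_basis_Suc)
    then show "gen_cycle R x \<in> carrier (free_module R UNIV)"
      using gen_cycle_res_basis[OF z(1)] res_cycles_subset[of n] R.free_module_mono[OF subset_UNIV]
      unfolding std_res_def by auto
  qed
qed

lemma res_cycles_submodule: "submodule (res_cycles R M n) R (std_res R M n)"
proof (cases n)
  case 0
  have "submodule {h \<in> carrier (std_res R M 0). res_augmentation R M h \<in> {\<zero>\<^bsub>M\<^esub>}} R (std_res R M 0)"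
    by (rule module_map_submodule_vimage[OF std_res_module module_axioms augmentation_hom zero_submodule])
  then show ?thesis by (simp add: res_cycles_def 0)
next
  case (Suc m)
  interpret F: module R "free_module R UNIV" by (rule R.free_module_module)
  have "submodule {h \<in> carrier (std_res R M (Suc m)). res_boundary R h \<in> {\<zero>\<^bsub>free_module R UNIV\<^esub>}} R (std_res R M (Suc m))"
    by (rule module_map_submodule_vimage[OF std_res_module F.module_axioms boundary_hom_UNIV F.zero_submodule])
  then show ?thesis by (simp add: res_cycles_def Suc)
qed

text \<open>The boundary sends each basis element to the cycle it stands for, and the cycles form a
  submodule. That the boundary lands in degree n and squares to zero both follow from this.\<close>

lemma boundary_in_cycles:
  assumes "h \<in> carrier (std_res R M (Suc n))"
  shows "res_boundary R h \<in> res_cycles R M n"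
proof -
  interpret F: module R "free_module R UNIV" by (rule R.free_module_module)
  have "submodule (res_cycles R M n) R (free_module R UNIV)"
    using R.free_module_submodule_cong[OF _ subset_UNIV] res_cycles_submodule[of n] unfolding std_res_def by blast
  then show ?thesis
    by (rule R.module_map_free_mem[OF F.module_axioms boundary_hom_UNIV[unfolded std_res_def] _ _ assms[unfolded std_res_def]])
      (auto simp only: res_basis_Suc boundary_basis)
qed

lemma boundary_hom: "module_map R (std_res R M (Suc n)) (std_res R M n) (res_boundary R)"
  unfolding std_res_def
  by (rule R.module_map_free_cod[OF boundary_hom_UNIV[unfolded std_res_def]])
    (use boundary_in_cycles res_cycles_subset in \<open>auto simp: std_res_def\<close>)

lemma boundary_closed: "h \<in> carrier (std_res R M (Suc n)) \<Longrightarrow> res_boundary R h \<in> carrier (std_res R M n)"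
  using boundary_in_cycles res_cycles_subset by blast

lemma boundary_boundary:
  assumes "h \<in> carrier (std_res R M (Suc (Suc n)))"
  shows "res_boundary R (res_boundary R h) = (\<lambda>_. \<zero>)"
  using boundary_in_cycles[OF assms] by (simp add: res_cycles_def)

lemma std_res_basis_closed: "x \<in> res_basis R M n \<Longrightarrow> free_basis R x \<in> carrier (std_res R M n)"
  unfolding std_res_def by (rule R.free_basis_closed)

lemma cycle_gen_in_basis: "z \<in> res_cycles R M n \<Longrightarrow> cycle_gen R z \<in> res_basis R M (Suc n)"
  by (simp only: res_basis_Suc imageI)

lemma std_res_hom_eqI:
  assumes "module R N" "module_map R (std_res R M n) N f" "module_map R (std_res R M n) N g"
    and "\<And>x. x \<in> res_basis R M n \<Longrightarrow> f (free_basis R x) = g (free_basis R x)" "h \<in> carrier (std_res R M n)"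
  shows "f h = g h"
  using R.module_map_free_eq[OF assms(1)] assms(2-) unfolding std_res_def by blast

text \<open>Freeness of degree j together with exactness: a basis element x goes to the generator
  labelled by the cycle to which \<rho> sends x.\<close>

lemma boundary_lifting:
  assumes \<rho>: "module_map R (std_res R M j) (std_res R M j) \<rho>"
    "\<And>h. h \<in> carrier (std_res R M j) \<Longrightarrow> \<rho> h \<in> res_cycles R M j"
  shows "\<exists>\<sigma>. module_map R (std_res R M j) (std_res R M (Suc j)) \<sigma> \<and>
    (\<forall>h \<in> carrier (std_res R M j). res_boundary R (\<sigma> h) = \<rho> h)"
proof (intro exI conjI ballI)
  interpret F: module R "std_res R M (Suc j)" by (rule std_res_module)
  let ?\<sigma> = "lin_ext R (std_res R M (Suc j)) (\<lambda>x. free_basis R (cycle_gen R (\<rho> (free_basis R x))))"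
  have cl: "free_basis R (cycle_gen R (\<rho> (free_basis R x))) \<in> carrier (std_res R M (Suc j))"
    if "x \<in> res_basis R M j" for x
    using that by (intro std_res_basis_closed cycle_gen_in_basis \<rho>(2))
  show hom: "module_map R (std_res R M j) (std_res R M (Suc j)) ?\<sigma>"
    unfolding std_res_def[of _ _ j] by (rule F.lin_ext_hom) (rule cl)
  show "res_boundary R (?\<sigma> h) = \<rho> h" if h: "h \<in> carrier (std_res R M j)" for h
  proof (rule std_res_hom_eqI[OF std_res_module module_map_comp[OF hom boundary_hom] \<rho>(1) _ h])
    show "res_boundary R (?\<sigma> (free_basis R x)) = \<rho> (free_basis R x)" if "x \<in> res_basis R M j" for x
      by (subst F.lin_ext_basis[where g = "\<lambda>x. free_basis R (cycle_gen R (\<rho> (free_basis R x)))", OF cl[OF that]]) (rule boundary_basis[where n = j], intro \<rho>(2) std_res_basis_closed that)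
  qed
qed

end

lemma module_map_diff:
  assumes M: "module R M" and N: "module R N" and f: "module_map R M N f" and x: "x \<in> carrier M" and y: "y \<in> carrier M"
  shows "f (x \<ominus>\<^bsub>M\<^esub> y) = f x \<ominus>\<^bsub>N\<^esub> f y"
proof -
  interpret M: module R M by fact
  interpret N: module R N by fact
  note D = module_mapD[OF f]
  have "f (x \<ominus>\<^bsub>M\<^esub> y) \<oplus>\<^bsub>N\<^esub> f y = f (x \<ominus>\<^bsub>M\<^esub> y \<oplus>\<^bsub>M\<^esub> y)" using D(2) x y by simp
  also have "x \<ominus>\<^bsub>M\<^esub> y \<oplus>\<^bsub>M\<^esub> y = x" using x y by (simp add: a_minus_def M.a_assoc M.l_neg)
  finally have e: "f (x \<ominus>\<^bsub>M\<^esub> y) \<oplus>\<^bsub>N\<^esub> f y = f x" .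
  have "f (x \<ominus>\<^bsub>M\<^esub> y) \<oplus>\<^bsub>N\<^esub> f y \<ominus>\<^bsub>N\<^esub> f y = f (x \<ominus>\<^bsub>M\<^esub> y)"
    using D(1) x y by (simp add: a_minus_def N.a_assoc N.r_neg)
  then show ?thesis unfolding e by simp
qed

section \<open>Functoriality of the standard resolution\<close>

locale module_map_pair = A: module R A + B: module R B
  for R :: "('r, 'a) ring_scheme" (structure) and A :: "('r, 'm, 'k) module_scheme"
    and B :: "('r, 'p, 'l) module_scheme" +
  fixes f :: "'m \<Rightarrow> 'p"
  assumes f: "module_map R A B f"
begin

abbreviation "lift_map \<equiv> std_res_map R f"

lemma lift_map_homI:
  assumes "\<And>b. b \<in> res_basis R A n \<Longrightarrow> res_gen_map R f n b \<in> res_basis R B n"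
  shows "module_map R (std_res R A n) (std_res R B n) (lift_map n)"
  unfolding std_res_def std_res_map_def by (rule A.free_map_hom) (use assms in auto)

lemma lift_map_zero:
  assumes "module_map R (std_res R A n) (std_res R B n) (lift_map n)"
  shows "lift_map n (\<lambda>_. \<zero>) = (\<lambda>_. \<zero>)"
  using module_map_zero[OF A.std_res_module B.std_res_module assms] by (simp add: std_res_def)

lemma res_gen_map_Suc_cycle_gen:
  assumes "z \<in> res_cycles R A n"
  shows "res_gen_map R f (Suc n) (cycle_gen R z) = cycle_gen R (lift_map n z)"
  using A.gen_cycle_res_basis[OF assms] by (simp add: std_res_map_def)

lemma lift_map_step:
  assumes bas: "\<forall>b \<in> res_basis R A n. res_gen_map R f n b \<in> res_basis R B n"
    and cyc: "\<forall>z \<in> res_cycles R A n. lift_map n z \<in> res_cycles R B n"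
  shows "\<forall>b \<in> res_basis R A (Suc n). res_gen_map R f (Suc n) b \<in> res_basis R B (Suc n)"
    and "h \<in> carrier (std_res R A (Suc n)) \<Longrightarrow>
      res_boundary R (lift_map (Suc n) h) = lift_map n (res_boundary R h)"
proof -
  show bas': "\<forall>b \<in> res_basis R A (Suc n). res_gen_map R f (Suc n) b \<in> res_basis R B (Suc n)"
    unfolding A.res_basis_Suc B.res_basis_Suc using res_gen_map_Suc_cycle_gen cyc by auto
  assume h: "h \<in> carrier (std_res R A (Suc n))"
  show "res_boundary R (lift_map (Suc n) h) = lift_map n (res_boundary R h)"
  proof (rule A.std_res_hom_eqI[OF B.std_res_module _ _ _ h])
    show "module_map R (std_res R A (Suc n)) (std_res R B n) (\<lambda>h. res_boundary R (lift_map (Suc n) h))"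
      by (rule module_map_comp[OF lift_map_homI B.boundary_hom]) (use bas' in blast)
    show "module_map R (std_res R A (Suc n)) (std_res R B n) (\<lambda>h. lift_map n (res_boundary R h))"
      by (rule module_map_comp[OF A.boundary_hom lift_map_homI]) (use bas in blast)
    fix x assume "x \<in> res_basis R A (Suc n)"
    then obtain z where z: "z \<in> res_cycles R A n" "x = cycle_gen R z" by (auto simp only: A.res_basis_Suc)
    have "lift_map (Suc n) (free_basis R x) = free_basis R (cycle_gen R (lift_map n z))"
      unfolding std_res_map_def A.free_map_basis z(2)
      by (rule arg_cong[OF res_gen_map_Suc_cycle_gen[OF z(1), unfolded std_res_map_def]])
    then show "res_boundary R (lift_map (Suc n) (free_basis R x)) = lift_map n (res_boundary R (free_basis R x))"
      using B.boundary_basis[OF bspec[OF cyc z(1)]] A.boundary_basis[OF z(1)] z(2) by simp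
  qed
qed

text \<open>Bases and cycles have to be treated together: the labels in degree n + 1 are cycles of
  degree n, and preservation of cycles in degree n + 1 rests on commutation with the boundary, which
  presupposes that bases go to bases.\<close>

lemma res_gen_map_closed_aux:
  "(\<forall>b \<in> res_basis R A n. res_gen_map R f n b \<in> res_basis R B n) \<and>
   (\<forall>z \<in> res_cycles R A n. lift_map n z \<in> res_cycles R B n)"
proof (induction n)
  case 0
  have b0: "\<forall>b \<in> res_basis R A 0. res_gen_map R f 0 b \<in> res_basis R B 0"
    using module_mapD(1)[OF f] by auto
  then have hom: "module_map R (std_res R A 0) (std_res R B 0) (lift_map 0)"
    by (intro lift_map_homI) blast
  have aug: "res_augmentation R B (lift_map 0 h) = f (res_augmentation R A h)"
    if "h \<in> carrier (std_res R A 0)" for h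
  proof (rule A.std_res_hom_eqI[OF B.module_axioms _ _ _ that])
    show "module_map R (std_res R A 0) B (\<lambda>h. res_augmentation R B (lift_map 0 h))"
      by (rule module_map_comp[OF hom B.augmentation_hom])
    show "module_map R (std_res R A 0) B (\<lambda>h. f (res_augmentation R A h))"
      by (rule module_map_comp[OF A.augmentation_hom f])
    fix x assume "x \<in> res_basis R A 0"
    then obtain a where a: "a \<in> carrier A" "x = Elem a" by auto
    then show "res_augmentation R B (lift_map 0 (free_basis R x)) = f (res_augmentation R A (free_basis R x))"
      using module_mapD(1)[OF f a(1)]
      by (simp add: std_res_map_def A.free_map_basis A.augmentation_basis B.augmentation_basis)
  qed
  have "\<forall>z \<in> res_cycles R A 0. lift_map 0 z \<in> res_cycles R B 0"
    using aug module_mapD(1)[OF hom] module_map_zero[OF A.module_axioms B.module_axioms f]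
    by (auto simp: res_cycles_def)
  then show ?case using b0 by blast
next
  case (Suc n)
  note S = lift_map_step[OF Suc.IH[THEN conjunct1] Suc.IH[THEN conjunct2]]
  have hom: "module_map R (std_res R A n) (std_res R B n) (lift_map n)"
    using Suc.IH by (intro lift_map_homI) blast
  have hom': "module_map R (std_res R A (Suc n)) (std_res R B (Suc n)) (lift_map (Suc n))"
    using S(1) by (intro lift_map_homI) blast
  have "lift_map (Suc n) z \<in> res_cycles R B (Suc n)" if z: "z \<in> res_cycles R A (Suc n)" for z
  proof -
    have zc: "z \<in> carrier (std_res R A (Suc n))" and z0: "res_boundary R z = (\<lambda>_. \<zero>)"
      using z by (auto simp: res_cycles_def)
    show ?thesis using S(2)[OF zc] z0 lift_map_zero[OF hom] module_mapD(1)[OF hom' zc]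
      by (simp add: res_cycles_def)
  qed
  then show ?case using S(1) by blast
qed

lemma lift_map_hom: "module_map R (std_res R A n) (std_res R B n) (lift_map n)"
  using res_gen_map_closed_aux by (intro lift_map_homI) blast

lemma lift_map_cycles: "z \<in> res_cycles R A n \<Longrightarrow> lift_map n z \<in> res_cycles R B n"
  using res_gen_map_closed_aux by blast

lemma lift_map_closed: "h \<in> carrier (std_res R A n) \<Longrightarrow> lift_map n h \<in> carrier (std_res R B n)"
  using module_mapD(1)[OF lift_map_hom] .

lemma boundary_lift_map:
  "h \<in> carrier (std_res R A (Suc n)) \<Longrightarrow> res_boundary R (lift_map (Suc n) h) = lift_map n (res_boundary R h)"
  using lift_map_step(2) res_gen_map_closed_aux by blast

end

text \<open>The equality is strict and not merely up to homotopy, because the resolution is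
  functorial by construction. The transition maps on cochains therefore compose exactly.\<close>

lemma std_res_map_comp:
  assumes A: "module R A" and B: "module R B" and C: "module R C"
    and f: "module_map R A B f" and g: "module_map R B C g"
    and h: "\<And>x. x \<in> carrier A \<Longrightarrow> h x = g (f x)" and u: "u \<in> carrier (std_res R A n)"
  shows "std_res_map R h n u = std_res_map R g n (std_res_map R f n u)"
proof -
  have h': "module_map R A C h"
    by (rule module_map_cong[OF A module_map_comp[OF f g]]) (rule h)
  interpret f: module_map_pair R A B f using A B f by (simp add: module_map_pair_def module_map_pair_axioms_def)
  interpret g: module_map_pair R B C g using C B g by (simp add: module_map_pair_def module_map_pair_axioms_def)
  interpret h: module_map_pair R A C h using A C h' by (simp add: module_map_pair_def module_map_pair_axioms_def)
  \<comment> \<open>Agreement on the labels of degree n gives agreement of the linear maps in degree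
    n, which fixes the labels of degree n + 1.\<close>
  have ext: "std_res_map R h n u = std_res_map R g n (std_res_map R f n u)"
    if gen: "\<And>b. b \<in> res_basis R A n \<Longrightarrow> res_gen_map R h n b = res_gen_map R g n (res_gen_map R f n b)"
      and u: "u \<in> carrier (std_res R A n)" for n u
  proof (rule f.A.std_res_hom_eqI[OF g.B.std_res_module h.lift_map_hom _ _ u])
    show "module_map R (std_res R A n) (std_res R C n) (\<lambda>u. std_res_map R g n (std_res_map R f n u))"
      by (rule module_map_comp[OF f.lift_map_hom g.lift_map_hom])
  qed (simp add: std_res_map_def f.A.free_map_basis gen)
  have "\<forall>b \<in> res_basis R A n. res_gen_map R h n b = res_gen_map R g n (res_gen_map R f n b)" for n
  proof (induction n)
    case 0 show ?case using h by auto
  next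
    case (Suc n)
    show ?case
    proof
      fix b assume "b \<in> res_basis R A (Suc n)"
      then obtain z where z: "z \<in> res_cycles R A n" "b = cycle_gen R z" by (auto simp only: f.A.res_basis_Suc)
      have zc: "z \<in> carrier (std_res R A n)" using z f.A.res_cycles_subset by blast
      have "std_res_map R h n z = std_res_map R g n (std_res_map R f n z)"
        by (rule ext[OF _ zc]) (use Suc.IH in blast)
      then show "res_gen_map R h (Suc n) b = res_gen_map R g (Suc n) (res_gen_map R f (Suc n) b)"
        unfolding z(2) h.res_gen_map_Suc_cycle_gen[OF z(1)] f.res_gen_map_Suc_cycle_gen[OF z(1)]
          g.res_gen_map_Suc_cycle_gen[OF f.lift_map_cycles[OF z(1)]] by simp
    qed
  qed
  then show ?thesis using ext[OF _ u] by blast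
qed

section \<open>Contraction of multiplication by an annihilating element\<close>

context module begin

text \<open>\<sigma> is a lift of \<rho> through the boundary \<partial>. As \<partial>h is a cycle,
  where \<rho> is multiplication by r, the boundary of rh - \<sigma>\<partial>h is r\<partial>h -
  r\<partial>h = 0.\<close>

lemma contraction_homotopy:
  assumes r: "r \<in> carrier R"
    and \<rho>: "module_map R (std_res R M j) (std_res R M j) \<rho>"
      "\<And>h. h \<in> carrier (std_res R M j) \<Longrightarrow> \<rho> h \<in> res_cycles R M j"
      "\<And>z. z \<in> res_cycles R M j \<Longrightarrow> \<rho> z = r \<odot>\<^bsub>std_res R M j\<^esub> z"
  obtains \<sigma> where "module_map R (std_res R M j) (std_res R M (Suc j)) \<sigma>"
    "\<And>h. h \<in> carrier (std_res R M (Suc j)) \<Longrightarrow>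
      r \<odot>\<^bsub>std_res R M (Suc j)\<^esub> h \<ominus>\<^bsub>std_res R M (Suc j)\<^esub> \<sigma> (res_boundary R h) \<in> res_cycles R M (Suc j)"
proof -
  interpret F: module R "std_res R M j" by (rule std_res_module)
  interpret G: module R "std_res R M (Suc j)" by (rule std_res_module)
  obtain \<sigma> where \<sigma>: "module_map R (std_res R M j) (std_res R M (Suc j)) \<sigma>"
    "\<And>h. h \<in> carrier (std_res R M j) \<Longrightarrow> res_boundary R (\<sigma> h) = \<rho> h"
    using boundary_lifting[OF \<rho>(1,2)] by blast
  note bd = module_mapD[OF boundary_hom[of j]]
  show thesis
  proof (rule that[OF \<sigma>(1)])
    fix h assume h: "h \<in> carrier (std_res R M (Suc j))"
    let ?d = "res_boundary R h"
    have dc: "?d \<in> carrier (std_res R M j)" and sc: "\<sigma> ?d \<in> carrier (std_res R M (Suc j))"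
      using bd(1)[OF h] module_mapD(1)[OF \<sigma>(1)] by auto
    have "res_boundary R (r \<odot>\<^bsub>std_res R M (Suc j)\<^esub> h \<ominus>\<^bsub>std_res R M (Suc j)\<^esub> \<sigma> ?d)
        = r \<odot>\<^bsub>std_res R M j\<^esub> ?d \<ominus>\<^bsub>std_res R M j\<^esub> \<rho> ?d"
      using module_map_diff[OF G.module_axioms F.module_axioms boundary_hom _ sc] bd(3)[OF r h] r h \<sigma>(2)[OF dc]
      by simp
    also have "\<dots> = \<zero>\<^bsub>std_res R M j\<^esub>"
      using \<rho>(3)[OF boundary_in_cycles[OF h]] r dc by (simp add: a_minus_def F.M.r_neg)
    also have "\<dots> = (\<lambda>_. \<zero>)" by (simp add: std_res_def)
    finally show "r \<odot>\<^bsub>std_res R M (Suc j)\<^esub> h \<ominus>\<^bsub>std_res R M (Suc j)\<^esub> \<sigma> ?d \<in> res_cycles R M (Suc j)"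
      using r h sc unfolding res_cycles_def by simp
  qed
qed

text \<open>\<open>\<rho>\<close> is \<open>r - \<sigma>\<partial>\<close> in degree \<open>j\<close>, where \<open>\<sigma>\<close> contracts multiplication by \<open>r\<close>, a lift of the zero map of \<open>M\<close>.\<close>

lemma annihilator_contraction:
  assumes r: "r \<in> annihilator R M"
  shows "\<exists>\<rho>. module_map R (std_res R M j) (std_res R M j) \<rho> \<and>
    (\<forall>h \<in> carrier (std_res R M j). \<rho> h \<in> res_cycles R M j) \<and>
    (\<forall>z \<in> res_cycles R M j. \<rho> z = r \<odot>\<^bsub>std_res R M j\<^esub> z)"
proof (induction j)
  have rc: "r \<in> carrier R" and r0: "\<And>x. x \<in> carrier M \<Longrightarrow> r \<odot>\<^bsub>M\<^esub> x = \<zero>\<^bsub>M\<^esub>"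
    using r by (auto simp: annihilator_def)
  {
    case 0
    interpret F: module R "std_res R M 0" by (rule std_res_module)
    show ?case
    proof (intro exI conjI ballI)
      \<comment> \<open>In degree 0, \<rho> is multiplication by r itself; it lands in the cycles
        because r kills M.\<close>
      show "module_map R (std_res R M 0) (std_res R M 0) (\<lambda>h. r \<odot>\<^bsub>std_res R M 0\<^esub> h)"
        by (rule F.module_map_smult[OF F.module_axioms _ rc]) (simp add: module_map_def)
      fix h assume h: "h \<in> carrier (std_res R M 0)"
      show "r \<odot>\<^bsub>std_res R M 0\<^esub> h \<in> res_cycles R M 0"
        using module_mapD[OF augmentation_hom] rc h r0 by (auto simp: res_cycles_def)
    qed simp
  next
    case (Suc j)
    interpret F: module R "std_res R M j" by (rule std_res_module)
    interpret G: module R "std_res R M (Suc j)" by (rule std_res_module)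
    obtain \<rho> where \<rho>: "module_map R (std_res R M j) (std_res R M j) \<rho>"
      "\<And>h. h \<in> carrier (std_res R M j) \<Longrightarrow> \<rho> h \<in> res_cycles R M j"
      "\<And>z. z \<in> res_cycles R M j \<Longrightarrow> \<rho> z = r \<odot>\<^bsub>std_res R M j\<^esub> z"
      using Suc.IH by blast
    obtain \<sigma> where \<sigma>: "module_map R (std_res R M j) (std_res R M (Suc j)) \<sigma>"
      "\<And>h. h \<in> carrier (std_res R M (Suc j)) \<Longrightarrow>
        r \<odot>\<^bsub>std_res R M (Suc j)\<^esub> h \<ominus>\<^bsub>std_res R M (Suc j)\<^esub> \<sigma> (res_boundary R h) \<in> res_cycles R M (Suc j)"
      using contraction_homotopy[OF rc \<rho>] by metis
    have rh: "module_map R (std_res R M (Suc j)) (std_res R M (Suc j)) (\<lambda>h. r \<odot>\<^bsub>std_res R M (Suc j)\<^esub> h)"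
      by (rule G.module_map_smult[OF G.module_axioms _ rc]) (simp add: module_map_def)
    have hom: "module_map R (std_res R M (Suc j)) (std_res R M (Suc j))
        (\<lambda>h. r \<odot>\<^bsub>std_res R M (Suc j)\<^esub> h \<ominus>\<^bsub>std_res R M (Suc j)\<^esub> \<sigma> (res_boundary R h))"
      by (rule G.module_map_minus[OF G.module_axioms rh module_map_comp[OF boundary_hom \<sigma>(1)]])
    show ?case
    proof (intro exI conjI ballI, rule hom)
      \<comment> \<open>On cycles the correction \<sigma>\<partial> vanishes and multiplication by r
        remains.\<close>
      fix z assume z: "z \<in> res_cycles R M (Suc j)"
      then have zc: "z \<in> carrier (std_res R M (Suc j))" and "res_boundary R z = \<zero>\<^bsub>std_res R M j\<^esub>"
        by (auto simp: res_cycles_def std_res_def)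
      then show "r \<odot>\<^bsub>std_res R M (Suc j)\<^esub> z \<ominus>\<^bsub>std_res R M (Suc j)\<^esub> \<sigma> (res_boundary R z) = r \<odot>\<^bsub>std_res R M (Suc j)\<^esub> z"
        using module_map_zero[OF F.module_axioms G.module_axioms \<sigma>(1)] rc by (simp add: a_minus_def)
    qed (rule \<sigma>(2))
  }
qed

end

section \<open>Vanishing modulo a submodule\<close>

text \<open>Abstracts from M/I^nM: an inverse system, with \<open>f m n\<close> going from
  \<open>A n\<close> down to \<open>A m\<close>, which the contravariance of Ext turns into a direct
  system.\<close>

locale module_system = N: module R N
  for R :: "('r, 'a) ring_scheme" (structure) and N :: "('r, 'n, 'l) module_scheme" +
  fixes A :: "nat \<Rightarrow> ('r, 'm, 'k) module_scheme" and f :: "nat \<Rightarrow> nat \<Rightarrow> 'm \<Rightarrow> 'm"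
  assumes A_module: "module R (A n)"
    and f_map: "m \<le> n \<Longrightarrow> module_map R (A n) (A m) (f m n)"
    and f_comp: "k \<le> m \<Longrightarrow> m \<le> n \<Longrightarrow> x \<in> carrier (A n) \<Longrightarrow> f k n x = f k m (f m n x)"
begin

abbreviation "F n j \<equiv> std_res R (A n) j"
abbreviation "S m n j \<equiv> std_res_map R (f m n) j"
abbreviation "cochain n j \<phi> \<equiv> module_map R (F n j) N \<phi>"

text \<open>Being zero in the cohomology of N/K. There are no cochains below degree 0, so in degree
  0 the values themselves must lie in K.\<close>

definition coboundary_mod :: "'n set \<Rightarrow> nat \<Rightarrow> nat \<Rightarrow> ((('r, 'm) res_gen \<Rightarrow> 'r) \<Rightarrow> 'n) \<Rightarrow> bool" where
  "coboundary_mod K n j \<chi> = (case j of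
     0 \<Rightarrow> \<forall>h \<in> carrier (F n 0). \<chi> h \<in> K
   | Suc i \<Rightarrow> \<exists>\<psi>. cochain n i \<psi> \<and> (\<forall>h \<in> carrier (F n (Suc i)). \<chi> h \<ominus>\<^bsub>N\<^esub> \<psi> (res_boundary R h) \<in> K))"

text \<open>The induction passes to quotients \<open>N/K\<close>. As the \<open>F n j\<close> are free, a cochain with values in \<open>N/K\<close>
  is represented by a cochain with values in \<open>N\<close>, and everything is read modulo \<open>K\<close>.
  Thus \<open>vanishes P K j\<close> says that the \<open>j\<close>-th cohomology of \<open>N/K\<close> in the limit vanishes locally at \<open>P\<close>.\<close>

definition vanishes :: "'r set \<Rightarrow> 'n set \<Rightarrow> nat \<Rightarrow> bool" where
  "vanishes P K j \<longleftrightarrow> (\<forall>n \<phi>. cochain n j \<phi> \<longrightarrow> (\<forall>h \<in> carrier (F n (Suc j)). \<phi> (res_boundary R h) \<in> K) \<longrightarrow>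
     (\<exists>m\<ge>n. \<exists>s \<in> carrier R - P. coboundary_mod K m j (\<lambda>h. s \<odot>\<^bsub>N\<^esub> \<phi> (S n m j h))))"

lemma S_pair: "m \<le> n \<Longrightarrow> module_map_pair R (A n) (A m) (f m n)"
  using A_module f_map by (simp add: module_map_pair_def module_map_pair_axioms_def)

lemma F_module: "module R (F n j)"
  by (rule module.std_res_module[OF A_module])

lemma S_map: "m \<le> n \<Longrightarrow> module_map R (F n j) (F m j) (S m n j)"
  by (rule module_map_pair.lift_map_hom[OF S_pair])

lemma S_boundary: "m \<le> n \<Longrightarrow> h \<in> carrier (F n (Suc j)) \<Longrightarrow>
    res_boundary R (S m n (Suc j) h) = S m n j (res_boundary R h)"
  by (rule module_map_pair.boundary_lift_map[OF S_pair])

lemma S_comp: "k \<le> m \<Longrightarrow> m \<le> n \<Longrightarrow> h \<in> carrier (F n j) \<Longrightarrow> S k n j h = S k m j (S m n j h)"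
  by (rule std_res_map_comp[OF A_module A_module A_module f_map f_map f_comp]) auto

lemma boundary_map: "module_map R (F n (Suc j)) (F n j) (res_boundary R)"
  by (rule module.boundary_hom[OF A_module])

lemma cochain_boundary_boundary:
  assumes "cochain n j \<phi>" "h \<in> carrier (F n (Suc (Suc j)))"
  shows "\<phi> (res_boundary R (res_boundary R h)) = \<zero>\<^bsub>N\<^esub>"
  using module.boundary_boundary[OF A_module assms(2)] module_map_zero[OF F_module N.module_axioms assms(1)]
  by (simp add: std_res_def)

text \<open>The element is the sum of s s0 (a - xc) and x (s s0 c - d). In the chase a, c, d are the
  values \<phi>\<partial>h, \<chi>h, \<theta>\<partial>h, up to transition maps.\<close>

lemma chase_cocycle:
  assumes K: "submodule K R N" and x: "x \<in> carrier R" and u: "s \<in> carrier R" "s0 \<in> carrier R"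
    and acd: "a \<in> carrier N" "c \<in> carrier N" "d \<in> carrier N"
    and ac: "a \<ominus>\<^bsub>N\<^esub> x \<odot>\<^bsub>N\<^esub> c \<in> K" and cd: "s \<odot>\<^bsub>N\<^esub> (s0 \<odot>\<^bsub>N\<^esub> c) \<ominus>\<^bsub>N\<^esub> d \<in> K"
  shows "(s \<otimes> s0) \<odot>\<^bsub>N\<^esub> a \<ominus>\<^bsub>N\<^esub> x \<odot>\<^bsub>N\<^esub> d \<in> K"
proof -
  note E = N.submoduleE[OF K]
  let ?b = "x \<odot>\<^bsub>N\<^esub> c"
  have "x \<odot>\<^bsub>N\<^esub> ((s \<otimes> s0) \<odot>\<^bsub>N\<^esub> c) = (s \<otimes> s0) \<odot>\<^bsub>N\<^esub> ?b" by (rule N.smult_commute) (use x u acd in auto)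
  then have 1: "x \<odot>\<^bsub>N\<^esub> (s \<odot>\<^bsub>N\<^esub> (s0 \<odot>\<^bsub>N\<^esub> c) \<ominus>\<^bsub>N\<^esub> d) = (s \<otimes> s0) \<odot>\<^bsub>N\<^esub> ?b \<ominus>\<^bsub>N\<^esub> x \<odot>\<^bsub>N\<^esub> d"
    using x u acd by (simp add: N.smult_minus N.smult_assoc1)
  have 2: "(s \<otimes> s0) \<odot>\<^bsub>N\<^esub> (a \<ominus>\<^bsub>N\<^esub> ?b) = (s \<otimes> s0) \<odot>\<^bsub>N\<^esub> a \<ominus>\<^bsub>N\<^esub> (s \<otimes> s0) \<odot>\<^bsub>N\<^esub> ?b"
    using x u acd by (intro N.smult_minus) auto
  have telescope: "(p \<ominus>\<^bsub>N\<^esub> q) \<oplus>\<^bsub>N\<^esub> (q \<ominus>\<^bsub>N\<^esub> r) = p \<ominus>\<^bsub>N\<^esub> r"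
    if "p \<in> carrier N" "q \<in> carrier N" "r \<in> carrier N" for p q r
  proof -
    have "(p \<ominus>\<^bsub>N\<^esub> q) \<oplus>\<^bsub>N\<^esub> (q \<ominus>\<^bsub>N\<^esub> r) = p \<oplus>\<^bsub>N\<^esub> ((\<ominus>\<^bsub>N\<^esub> q \<oplus>\<^bsub>N\<^esub> q) \<oplus>\<^bsub>N\<^esub> \<ominus>\<^bsub>N\<^esub> r)"
      using that by (simp add: a_minus_def N.a_assoc)
    then show ?thesis using that by (simp add: N.l_neg a_minus_def)
  qed
  have "(s \<otimes> s0) \<odot>\<^bsub>N\<^esub> a \<ominus>\<^bsub>N\<^esub> x \<odot>\<^bsub>N\<^esub> d = (s \<otimes> s0) \<odot>\<^bsub>N\<^esub> (a \<ominus>\<^bsub>N\<^esub> ?b) \<oplus>\<^bsub>N\<^esub> x \<odot>\<^bsub>N\<^esub> (s \<odot>\<^bsub>N\<^esub> (s0 \<odot>\<^bsub>N\<^esub> c) \<ominus>\<^bsub>N\<^esub> d)"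
    unfolding 1 2 by (rule telescope[symmetric]) (use x u acd in auto)
  also have "\<dots> \<in> K" using E(4,5) x u ac cd by auto
  finally show ?thesis .
qed

text \<open>Modulo K + xN the correction xd disappears. In the chase a and d are values of \<phi>
  and \<theta>, and e is a value of a coboundary, or 0 in degree 0.\<close>

lemma chase_coboundary:
  assumes K: "submodule K R N" and x: "x \<in> carrier R" and u: "t \<in> carrier R" "u \<in> carrier R"
    and ade: "a \<in> carrier N" "d \<in> carrier N" "e \<in> carrier N"
    and mem: "t \<odot>\<^bsub>N\<^esub> (u \<odot>\<^bsub>N\<^esub> a \<ominus>\<^bsub>N\<^esub> x \<odot>\<^bsub>N\<^esub> d) \<ominus>\<^bsub>N\<^esub> e \<in> K"
  shows "(t \<otimes> u) \<odot>\<^bsub>N\<^esub> a \<ominus>\<^bsub>N\<^esub> e \<in> add_mult N K x"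
proof -
  note B = N.add_mult_submodule[OF K x]
  have "x \<odot>\<^bsub>N\<^esub> (t \<odot>\<^bsub>N\<^esub> d) = t \<odot>\<^bsub>N\<^esub> (x \<odot>\<^bsub>N\<^esub> d)" by (rule N.smult_commute) (use x u ade in auto)
  then have "t \<odot>\<^bsub>N\<^esub> (u \<odot>\<^bsub>N\<^esub> a \<ominus>\<^bsub>N\<^esub> x \<odot>\<^bsub>N\<^esub> d) = (t \<otimes> u) \<odot>\<^bsub>N\<^esub> a \<ominus>\<^bsub>N\<^esub> x \<odot>\<^bsub>N\<^esub> (t \<odot>\<^bsub>N\<^esub> d)"
    using x u ade by (simp add: N.smult_minus N.smult_assoc1)
  then have eq: "((t \<otimes> u) \<odot>\<^bsub>N\<^esub> a \<ominus>\<^bsub>N\<^esub> e) \<oplus>\<^bsub>N\<^esub> \<ominus>\<^bsub>N\<^esub> (x \<odot>\<^bsub>N\<^esub> (t \<odot>\<^bsub>N\<^esub> d))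
      = t \<odot>\<^bsub>N\<^esub> (u \<odot>\<^bsub>N\<^esub> a \<ominus>\<^bsub>N\<^esub> x \<odot>\<^bsub>N\<^esub> d) \<ominus>\<^bsub>N\<^esub> e"
    using x u ade N.a_comm[of "\<ominus>\<^bsub>N\<^esub> e" "\<ominus>\<^bsub>N\<^esub> (x \<odot>\<^bsub>N\<^esub> (t \<odot>\<^bsub>N\<^esub> d))"] by (simp add: a_minus_def N.a_assoc)
  have "x \<odot>\<^bsub>N\<^esub> (t \<odot>\<^bsub>N\<^esub> d) \<in> add_mult N K x" by (rule B(3)) (use u ade in simp)
  then have neg: "\<ominus>\<^bsub>N\<^esub> (x \<odot>\<^bsub>N\<^esub> (t \<odot>\<^bsub>N\<^esub> d)) \<in> add_mult N K x" by (rule N.submoduleE(3)[OF B(1)])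
  show ?thesis
  proof (rule N.submodule_cancel[OF B(1) _ neg])
    show "(t \<otimes> u) \<odot>\<^bsub>N\<^esub> a \<ominus>\<^bsub>N\<^esub> e \<in> carrier N" using u ade by simp
  qed (unfold eq, rule subsetD[OF B(2) mem])
qed

text \<open>The chase behind the exact sequence \<open>H\<^sup>j(N/K) \<rightarrow> H\<^sup>j(N/(K + xN)) \<rightarrow> H\<^sup>j\<^sup>+\<^sup>1(N/K)\<close>.\<close>

lemma vanishes_add_mult:
  assumes P: "primeideal P R" and K: "submodule K R N" and x: "x \<in> carrier R" and s0: "s0 \<in> carrier R - P"
    and reg: "\<And>y. y \<in> carrier N \<Longrightarrow> x \<odot>\<^bsub>N\<^esub> y \<in> K \<Longrightarrow> s0 \<odot>\<^bsub>N\<^esub> y \<in> K"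
    and van: "vanishes P K j" "vanishes P K (Suc j)"
  shows "vanishes P (add_mult N K x) j"
  unfolding vanishes_def
proof (intro allI impI)
  fix n \<phi> assume \<phi>: "cochain n j \<phi>"
    and cyc: "\<forall>h \<in> carrier (F n (Suc j)). \<phi> (res_boundary R h) \<in> add_mult N K x"
  note E = N.submoduleE[OF K] and D = module_mapD
  interpret An: module R "A n" by (rule A_module)
  have \<phi>d: "cochain n (Suc j) (\<lambda>h. \<phi> (res_boundary R h))" by (rule module_map_comp[OF boundary_map \<phi>])
  \<comment> \<open>The connecting homomorphism: \<phi>\<partial> has values in K + xN, so modulo K
    it equals x\<chi>, with \<chi> chosen on basis elements and extended linearly.\<close>
  have "\<exists>y \<in> carrier N. \<phi> (res_boundary R (free_basis R b)) \<ominus>\<^bsub>N\<^esub> x \<odot>\<^bsub>N\<^esub> y \<in> K"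
    if b: "b \<in> res_basis R (A n) (Suc j)" for b
  proof -
    have "\<phi> (res_boundary R (free_basis R b)) \<in> add_mult N K x"
      using cyc An.std_res_basis_closed[OF b] by blast
    then obtain k y where y: "k \<in> K" "y \<in> carrier N" "\<phi> (res_boundary R (free_basis R b)) = k \<oplus>\<^bsub>N\<^esub> x \<odot>\<^bsub>N\<^esub> y"
      unfolding add_mult_def by blast
    then have "\<phi> (res_boundary R (free_basis R b)) \<ominus>\<^bsub>N\<^esub> x \<odot>\<^bsub>N\<^esub> y = k"
      using x E(1) by (auto simp: a_minus_def N.a_assoc N.r_neg)
    then have "\<phi> (res_boundary R (free_basis R b)) \<ominus>\<^bsub>N\<^esub> x \<odot>\<^bsub>N\<^esub> y \<in> K" using y(1) by simp
    then show ?thesis using y(2) by (rule_tac bexI)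
  qed
  then obtain g where g: "\<And>b. b \<in> res_basis R (A n) (Suc j) \<Longrightarrow> g b \<in> carrier N \<and>
      \<phi> (res_boundary R (free_basis R b)) \<ominus>\<^bsub>N\<^esub> x \<odot>\<^bsub>N\<^esub> g b \<in> K" by metis
  define \<chi> where "\<chi> = lin_ext R N g"
  have \<chi>: "cochain n (Suc j) \<chi>" unfolding \<chi>_def std_res_def by (rule N.lin_ext_hom) (use g in blast)
  have x\<chi>: "cochain n (Suc j) (\<lambda>h. x \<odot>\<^bsub>N\<^esub> \<chi> h)" by (rule N.module_map_smult[OF F_module \<chi> x])
  have \<phi>\<chi>: "\<phi> (res_boundary R h) \<ominus>\<^bsub>N\<^esub> x \<odot>\<^bsub>N\<^esub> \<chi> h \<in> K" if h: "h \<in> carrier (F n (Suc j))" for h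
    by (rule N.module_map_free_mem[OF N.module_axioms N.module_map_minus[OF F_module \<phi>d x\<chi>, unfolded std_res_def] K _ h[unfolded std_res_def]])
      (use g in \<open>simp add: \<chi>_def N.lin_ext_basis\<close>)
  \<comment> \<open>Modulo K, x\<chi>\<partial> is \<phi>\<partial>\<partial> = 0; regularity
    removes x at the price of s0, so s0 \<chi> is the connecting cocycle.\<close>
  have cyc\<chi>: "s0 \<odot>\<^bsub>N\<^esub> \<chi> (res_boundary R h) \<in> K" if h: "h \<in> carrier (F n (Suc (Suc j)))" for h
  proof (rule reg)
    have dh: "res_boundary R h \<in> carrier (F n (Suc j))" using D(1)[OF boundary_map h] .
    show c: "\<chi> (res_boundary R h) \<in> carrier N" using D(1)[OF \<chi> dh] .
    have "\<zero>\<^bsub>N\<^esub> \<ominus>\<^bsub>N\<^esub> x \<odot>\<^bsub>N\<^esub> \<chi> (res_boundary R h) \<in> K"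
      using \<phi>\<chi>[OF dh] cochain_boundary_boundary[OF \<phi> h] by simp
    then have "\<ominus>\<^bsub>N\<^esub> (x \<odot>\<^bsub>N\<^esub> \<chi> (res_boundary R h)) \<in> K" using c x by (simp add: a_minus_def)
    then have "\<ominus>\<^bsub>N\<^esub> (\<ominus>\<^bsub>N\<^esub> (x \<odot>\<^bsub>N\<^esub> \<chi> (res_boundary R h))) \<in> K" by (rule E(3))
    then show "x \<odot>\<^bsub>N\<^esub> \<chi> (res_boundary R h) \<in> K" using c x by simp
  qed
  have "cochain n (Suc j) (\<lambda>h. s0 \<odot>\<^bsub>N\<^esub> \<chi> h)" using s0 by (intro N.module_map_smult[OF F_module \<chi>]) auto
  from van(2)[unfolded vanishes_def, rule_format, OF this cyc\<chi>]
  obtain m s where m: "n \<le> m" and s: "s \<in> carrier R - P"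
    and "coboundary_mod K m (Suc j) (\<lambda>h. s \<odot>\<^bsub>N\<^esub> (s0 \<odot>\<^bsub>N\<^esub> \<chi> (S n m (Suc j) h)))" by blast
  then obtain \<theta> where \<theta>: "cochain m j \<theta>"
    "\<And>h. h \<in> carrier (F m (Suc j)) \<Longrightarrow>
      s \<odot>\<^bsub>N\<^esub> (s0 \<odot>\<^bsub>N\<^esub> \<chi> (S n m (Suc j) h)) \<ominus>\<^bsub>N\<^esub> \<theta> (res_boundary R h) \<in> K"
    unfolding coboundary_mod_def by auto
  have ss0: "s \<otimes> s0 \<in> carrier R - P" by (rule primeideal_notin_mult[OF P s s0])
  \<comment> \<open>\<theta> bounds s s0 \<chi> modulo K, so subtracting x\<theta> turns s s0 \<phi>
    into a cocycle modulo K without changing it modulo K + xN. Vanishing in degree j then applies to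
    it.\<close>
  let ?\<phi> = "\<lambda>h. (s \<otimes> s0) \<odot>\<^bsub>N\<^esub> \<phi> (S n m j h) \<ominus>\<^bsub>N\<^esub> x \<odot>\<^bsub>N\<^esub> \<theta> h"
  have c1: "cochain m j ?\<phi>"
    by (rule N.module_map_minus[OF F_module N.module_map_smult[OF F_module module_map_comp[OF S_map[OF m] \<phi>]]
          N.module_map_smult[OF F_module \<theta>(1) x]]) (use ss0 in auto)
  have c2: "?\<phi> (res_boundary R h) \<in> K" if h: "h \<in> carrier (F m (Suc j))" for h
  proof -
    have Sh: "S n m (Suc j) h \<in> carrier (F n (Suc j))" using D(1)[OF S_map[OF m] h] .
    show ?thesis unfolding S_boundary[OF m h, symmetric]
      by (rule chase_cocycle[OF K x _ _ _ _ _ \<phi>\<chi>[OF Sh] \<theta>(2)[OF h]])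
        (use s s0 D(1)[OF \<phi>d Sh] D(1)[OF \<chi> Sh] D(1)[OF \<theta>(1) D(1)[OF boundary_map h]] in auto)
  qed
  from van(1)[unfolded vanishes_def, rule_format, OF c1 c2]
  obtain l t where l: "m \<le> l" and t: "t \<in> carrier R - P"
    and cob: "coboundary_mod K l j (\<lambda>h. t \<odot>\<^bsub>N\<^esub> ?\<phi> (S m l j h))" by blast
  have tu: "t \<otimes> (s \<otimes> s0) \<in> carrier R - P" by (rule primeideal_notin_mult[OF P t ss0])
  have nl: "n \<le> l" using m l by simp
  have key: "(t \<otimes> (s \<otimes> s0)) \<odot>\<^bsub>N\<^esub> \<phi> (S n l j h) \<ominus>\<^bsub>N\<^esub> e \<in> add_mult N K x"
    if h: "h \<in> carrier (F l j)" and e: "e \<in> carrier N" "t \<odot>\<^bsub>N\<^esub> ?\<phi> (S m l j h) \<ominus>\<^bsub>N\<^esub> e \<in> K" for h e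
  proof -
    have Sh: "S m l j h \<in> carrier (F m j)" using D(1)[OF S_map[OF l] h] .
    show ?thesis unfolding S_comp[OF m l h]
      by (rule chase_coboundary[OF K x _ _ _ _ e(1) e(2)])
        (use t ss0 D(1)[OF \<phi> D(1)[OF S_map[OF m] Sh]] D(1)[OF \<theta>(1) Sh] in auto)
  qed
  have "coboundary_mod (add_mult N K x) l j (\<lambda>h. (t \<otimes> (s \<otimes> s0)) \<odot>\<^bsub>N\<^esub> \<phi> (S n l j h))"
  proof (cases j)
    case 0
    have "(t \<otimes> (s \<otimes> s0)) \<odot>\<^bsub>N\<^esub> \<phi> (S n l j h) \<in> add_mult N K x" if h: "h \<in> carrier (F l j)" for h
    proof -
      have a: "\<phi> (S n l j h) \<in> carrier N" using D(1)[OF \<phi> D(1)[OF S_map[OF nl] h]] .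
      have "t \<odot>\<^bsub>N\<^esub> ?\<phi> (S m l j h) \<in> K" using cob h 0 by (simp add: coboundary_mod_def)
      then have "t \<odot>\<^bsub>N\<^esub> ?\<phi> (S m l j h) \<ominus>\<^bsub>N\<^esub> \<zero>\<^bsub>N\<^esub> \<in> K" using N.submodule_diff[OF K _ N.submodule_zero[OF K]] by blast
      from key[OF h _ this] show ?thesis using a tu by (simp add: N.diff_zero)
    qed
    then show ?thesis by (simp add: coboundary_mod_def 0)
  next
    case (Suc i)
    obtain \<omega> where \<omega>: "cochain l i \<omega>"
      "\<And>h. h \<in> carrier (F l j) \<Longrightarrow> t \<odot>\<^bsub>N\<^esub> ?\<phi> (S m l j h) \<ominus>\<^bsub>N\<^esub> \<omega> (res_boundary R h) \<in> K"
      using cob unfolding Suc coboundary_mod_def by auto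
    have "(t \<otimes> (s \<otimes> s0)) \<odot>\<^bsub>N\<^esub> \<phi> (S n l j h) \<ominus>\<^bsub>N\<^esub> \<omega> (res_boundary R h) \<in> add_mult N K x"
      if h: "h \<in> carrier (F l j)" for h
      by (rule key[OF h D(1)[OF \<omega>(1) D(1)[OF boundary_map]] \<omega>(2)[OF h]]) (use h Suc in simp)
    then show ?thesis using \<omega>(1) unfolding Suc coboundary_mod_def by auto
  qed
  then show "\<exists>m\<ge>n. \<exists>s\<in>carrier R - P. coboundary_mod (add_mult N K x) m j (\<lambda>h. s \<odot>\<^bsub>N\<^esub> \<phi> (S n m j h))"
    using nl tu by blast
qed

text \<open>\<open>base\<close> isolates the nonvanishing in degree 0, which is where the inverse
  system has to be known concretely. Otherwise \<open>vanishes_add_mult\<close> is read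
  contrapositively: survival for K + xN in degree j gives survival for K in degree j or j +
  1.\<close>

lemma not_vanishes_chain:
  assumes "noetherian_ring R" "noetherian_module R N" and P: "primeideal P R" and J: "ideal J R" "J \<subseteq> P"
    and base: "\<And>K z. submodule K R N \<Longrightarrow> z \<in> carrier N \<Longrightarrow> primeideal (colon R N K z) R \<Longrightarrow>
      J \<subseteq> colon R N K z \<Longrightarrow> colon R N K z \<subseteq> P \<Longrightarrow> \<not> vanishes P K 0"
    and K: "submodule K R N" and KP: "colon_all R N K \<subseteq> P"
  shows "\<exists>j Q. (\<forall>i\<le>j. primeideal (Q i) R) \<and> (\<forall>i<j. Q i \<subset> Q (Suc i)) \<and>
    colon_all R N K \<subseteq> Q 0 \<and> Q j \<subseteq> P \<and> \<not> vanishes P K j"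
proof -
  interpret NN: noetherian_module R N by fact
  show ?thesis using K KP
  proof (induction rule: NN.submodule_induct)
    case (step K)
    note K = step(1) and KP = step(3)
    show ?case
    proof (rule NN.regular_or_assoc_prime[OF assms(1) K P J])
      fix z assume "z \<in> carrier N" "primeideal (colon R N K z) R" "J \<subseteq> colon R N K z" "colon R N K z \<subseteq> P"
      then have "\<not> vanishes P K 0" by (rule base[OF K])
      \<comment> \<open>Length 0: the chain consists of P alone, whichever associated prime was
        found.\<close>
      then show ?case using P KP by (intro exI[of _ 0] exI[of _ "\<lambda>_. P"]) auto
    next
      fix x s assume x: "x \<in> J" and s: "s \<in> carrier R - P"
        and reg: "\<And>y. y \<in> carrier N \<Longrightarrow> x \<odot>\<^bsub>N\<^esub> y \<in> K \<Longrightarrow> s \<odot>\<^bsub>N\<^esub> y \<in> K"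
      have xc: "x \<in> carrier R" using x ideal.Icarr[OF J(1)] by simp
      have xP: "x \<in> P" using x J by blast
      note B = N.add_mult_submodule[OF K xc]
      \<comment> \<open>If K contained xN, it would contain sN by regularity, and s would lie in (K
        : N) and in P.\<close>
      have ne: "K \<noteq> add_mult N K x"
      proof
        assume "K = add_mult N K x"
        then have "s \<in> colon_all R N K" using reg B(3) s by (auto simp: colon_all_def)
        then show False using KP s by blast
      qed
      have "colon_all R N (add_mult N K x) \<subseteq> P" by (rule NN.nakayama[OF K P KP xP])
      from step(2)[OF B(1) _ this] B(2) ne
      obtain j Q where Q: "\<forall>i\<le>j. primeideal (Q i) R" "\<forall>i<j. Q i \<subset> Q (Suc i)"
        "colon_all R N (add_mult N K x) \<subseteq> Q 0" "Q j \<subseteq> P" "\<not> vanishes P (add_mult N K x) j" by blast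
      have sub: "colon_all R N K \<subseteq> Q 0" using Q(3) B(2) by (auto simp: colon_all_def)
      show ?case
      proof (cases "vanishes P K j")
        case False
        then show ?thesis using Q sub by blast
      next
        case True
        then have nv: "\<not> vanishes P K (Suc j)" using vanishes_add_mult[OF P K xc s reg] Q(5) by blast
        have "Q 0 \<subseteq> Q i" if "i \<le> j" for i
          using that
        proof (induction i)
          case (Suc i)
          then have "Q 0 \<subseteq> Q i" "Q i \<subset> Q (Suc i)" using Q(2) by auto
          then show ?case by blast
        qed simp
        then have Q0P: "Q 0 \<subseteq> P" using Q(4) by blast
        have Q0: "primeideal (Q 0) R" using Q(1) by simp
        \<comment> \<open>Being outside P, s is outside \<open>Q 0\<close> too, so x is regular on
          N/K locally at \<open>Q 0\<close>, and the new prime can be found below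
          \<open>Q 0\<close>.\<close>
        have sQ: "s \<in> carrier R - Q 0" using s Q0P by blast
        obtain Q' where Q': "primeideal Q' R" "colon_all R N K \<subseteq> Q'" "Q' \<subseteq> Q 0" "x \<notin> Q'"
          using NN.smaller_prime_avoiding[OF assms(1) K Q0 xc sQ reg sub] by metis
        \<comment> \<open>x kills N/(K + xN), so it lies in \<open>Q 0\<close> but not in Q'. The
          inclusion is strict, and Q' lengthens the chain by one at the bottom, matching the degree
          j + 1.\<close>
        have "x \<in> Q 0" using Q(3) B(3) xc by (auto simp: colon_all_def)
        then have lt: "Q' \<subset> Q 0" using Q' by blast
        let ?Q = "\<lambda>i. case i of 0 \<Rightarrow> Q' | Suc i \<Rightarrow> Q i"
        show ?thesis
        proof (intro exI[of _ "Suc j"] exI[of _ ?Q] conjI allI impI)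
          show "primeideal (?Q i) R" if "i \<le> Suc j" for i using that Q(1) Q'(1) by (cases i) auto
          show "?Q i \<subset> ?Q (Suc i)" if "i < Suc j" for i using that Q(2) lt by (cases i) auto
        qed (use Q Q' nv in auto)
      qed
    qed
  qed
qed

end

section \<open>Quotients, localization and direct limits\<close>

lemma hom_module_module:
  assumes "module R L" "module R N"
  shows "module R (hom_module R L N)"
proof -
  interpret L: module R L by fact
  interpret N: module R N by fact
  let ?H = "hom_module R L N"
  have simps: "\<zero>\<^bsub>?H\<^esub> = (\<lambda>x\<in>carrier L. \<zero>\<^bsub>N\<^esub>)"
    "f \<oplus>\<^bsub>?H\<^esub> g = (\<lambda>x\<in>carrier L. f x \<oplus>\<^bsub>N\<^esub> g x)"
    "r \<odot>\<^bsub>?H\<^esub> f = (\<lambda>x\<in>carrier L. r \<odot>\<^bsub>N\<^esub> f x)" for f g r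
    by (simp_all add: hom_module_def)
  have I: "(\<lambda>x\<in>carrier L. f x) \<in> carrier ?H" if "module_map R L N f" for f
    unfolding hom_module_carrier_iff by (intro conjI module_map_cong[OF L.module_axioms that]) auto
  have V: "f x \<in> carrier N" if "f \<in> carrier ?H" "x \<in> carrier L" for f x
    using that module_mapD(1) by (auto simp: hom_module_carrier_iff)
  have X: "f = g" if "f \<in> carrier ?H" "g \<in> carrier ?H" "\<And>x. x \<in> carrier L \<Longrightarrow> f x = g x" for f g
    using that by (auto simp: hom_module_carrier_iff intro: extensionalityI)
  have add: "f \<oplus>\<^bsub>?H\<^esub> g \<in> carrier ?H" if "f \<in> carrier ?H" "g \<in> carrier ?H" for f g
    unfolding simps by (rule I) (use that in \<open>auto simp: hom_module_carrier_iff intro: N.module_map_add L.module_axioms\<close>)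
  have smult: "r \<odot>\<^bsub>?H\<^esub> f \<in> carrier ?H" if "r \<in> carrier R" "f \<in> carrier ?H" for r f
    unfolding simps by (rule I) (use that in \<open>auto simp: hom_module_carrier_iff intro: N.module_map_smult L.module_axioms\<close>)
  have zero: "\<zero>\<^bsub>?H\<^esub> \<in> carrier ?H" unfolding simps by (rule I) (simp add: module_map_def)
  show ?thesis
  proof (rule moduleI)
    show "abelian_group ?H"
    proof (rule abelian_groupI)
      show "f \<oplus>\<^bsub>?H\<^esub> g \<in> carrier ?H" if "f \<in> carrier ?H" "g \<in> carrier ?H" for f g by (rule add[OF that])
      show "\<zero>\<^bsub>?H\<^esub> \<in> carrier ?H" by (rule zero)
      show "f \<oplus>\<^bsub>?H\<^esub> g \<oplus>\<^bsub>?H\<^esub> h = f \<oplus>\<^bsub>?H\<^esub> (g \<oplus>\<^bsub>?H\<^esub> h)"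
        if "f \<in> carrier ?H" "g \<in> carrier ?H" "h \<in> carrier ?H" for f g h
        by (rule X[OF add[OF add[OF that(1,2)] that(3)] add[OF that(1) add[OF that(2,3)]]])
          (use that in \<open>simp add: simps V N.a_assoc\<close>)
      show "f \<oplus>\<^bsub>?H\<^esub> g = g \<oplus>\<^bsub>?H\<^esub> f" if "f \<in> carrier ?H" "g \<in> carrier ?H" for f g
        by (rule X[OF add[OF that] add[OF that(2,1)]]) (use that in \<open>simp add: simps V N.a_comm\<close>)
      show "\<zero>\<^bsub>?H\<^esub> \<oplus>\<^bsub>?H\<^esub> f = f" if "f \<in> carrier ?H" for f
        by (rule X[OF add[OF zero that] that]) (use that in \<open>simp add: simps V\<close>)
      show "\<exists>g\<in>carrier ?H. g \<oplus>\<^bsub>?H\<^esub> f = \<zero>\<^bsub>?H\<^esub>" if f: "f \<in> carrier ?H" for f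
      proof
        show g: "(\<ominus>\<^bsub>R\<^esub> \<one>\<^bsub>R\<^esub>) \<odot>\<^bsub>?H\<^esub> f \<in> carrier ?H" using smult f by simp
        show "(\<ominus>\<^bsub>R\<^esub> \<one>\<^bsub>R\<^esub>) \<odot>\<^bsub>?H\<^esub> f \<oplus>\<^bsub>?H\<^esub> f = \<zero>\<^bsub>?H\<^esub>"
          by (rule X[OF add[OF g f] zero]) (use f in \<open>simp add: simps V N.smult_l_minus N.l_neg\<close>)
      qed
    qed
    show "cring R" by (rule L.R.is_cring)
    show "r \<odot>\<^bsub>?H\<^esub> f \<in> carrier ?H" if "r \<in> carrier R" "f \<in> carrier ?H" for r f by (rule smult[OF that])
    show "\<one>\<^bsub>R\<^esub> \<odot>\<^bsub>?H\<^esub> f = f" if "f \<in> carrier ?H" for f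
      by (rule X[OF smult that]) (use that in \<open>simp_all add: simps V\<close>)
    fix a b f g assume ab: "a \<in> carrier R" "b \<in> carrier R" and f: "f \<in> carrier ?H" and g: "g \<in> carrier ?H"
    show "(a \<otimes>\<^bsub>R\<^esub> b) \<odot>\<^bsub>?H\<^esub> f = a \<odot>\<^bsub>?H\<^esub> (b \<odot>\<^bsub>?H\<^esub> f)"
      by (rule X[OF smult smult[OF _ smult]]) (use ab f in \<open>simp_all add: simps V N.smult_assoc1\<close>)
    show "(a \<oplus>\<^bsub>R\<^esub> b) \<odot>\<^bsub>?H\<^esub> f = a \<odot>\<^bsub>?H\<^esub> f \<oplus>\<^bsub>?H\<^esub> b \<odot>\<^bsub>?H\<^esub> f"
      by (rule X[OF smult add[OF smult smult]]) (use ab f in \<open>simp_all add: simps V N.smult_l_distr\<close>)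
    show "a \<odot>\<^bsub>?H\<^esub> (f \<oplus>\<^bsub>?H\<^esub> g) = a \<odot>\<^bsub>?H\<^esub> f \<oplus>\<^bsub>?H\<^esub> a \<odot>\<^bsub>?H\<^esub> g"
      by (rule X[OF smult[OF _ add] add[OF smult smult]]) (use ab f g in \<open>simp_all add: simps V N.smult_r_distr\<close>)
  qed
qed

section \<open>Quotient modules through cosets\<close>

context module begin

lemma submodule_abelian_subgroup:
  assumes "submodule H R M"
  shows "abelian_subgroup H M"
  by (intro abelian_subgroupI3 additive_subgroup.intro M.abelian_group_axioms submodule.axioms(1)[OF assms])

lemma coset_self:
  assumes "submodule H R M" "x \<in> carrier M"
  shows "x \<in> H +>\<^bsub>M\<^esub> x"
  using abelian_subgroup.a_rcos_self[OF submodule_abelian_subgroup[OF assms(1)]] assms(2) .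

lemma coset_mem_iff:
  assumes H: "submodule H R M" and x: "x \<in> carrier M" and y: "y \<in> carrier M"
  shows "y \<in> H +>\<^bsub>M\<^esub> x \<longleftrightarrow> y \<ominus>\<^bsub>M\<^esub> x \<in> H"
  using abelian_subgroup.a_rcos_module[OF submodule_abelian_subgroup[OF H] x y] by (simp add: a_minus_def)

lemma coset_eq_iff:
  assumes H: "submodule H R M" and x: "x \<in> carrier M" and y: "y \<in> carrier M"
  shows "H +>\<^bsub>M\<^esub> y = H +>\<^bsub>M\<^esub> x \<longleftrightarrow> y \<ominus>\<^bsub>M\<^esub> x \<in> H"
  using abelian_subgroup.a_repr_independence'[OF submodule_abelian_subgroup[OF H] _ x, of y]
    coset_mem_iff[OF assms] coset_self[OF H y] by blast

lemma coset_subset: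
  assumes "submodule H R M" "x \<in> carrier M" "y \<in> H +>\<^bsub>M\<^esub> x"
  shows "y \<in> carrier M"
  using abelian_subgroup.a_elemrcos_carrier[OF submodule_abelian_subgroup[OF assms(1)] assms(2,3)] .

lemma coset_zero:
  assumes "submodule H R M"
  shows "H +>\<^bsub>M\<^esub> \<zero>\<^bsub>M\<^esub> = H"
  by (rule M.a_coset_add_zero[OF submoduleE(1)[OF assms]])

lemma coset_eq_self_iff:
  assumes "submodule H R M" "x \<in> carrier M"
  shows "H +>\<^bsub>M\<^esub> x = H \<longleftrightarrow> x \<in> H"
  using coset_eq_iff[OF assms(1) M.zero_closed assms(2)] coset_zero[OF assms(1)] M.diff_zero[OF assms(2)] by simp

lemma quotient_carrier: "carrier (quotient_module M H) = {H +>\<^bsub>M\<^esub> x | x. x \<in> carrier M}"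
  by (auto simp: quotient_module_def A_RCOSETS_def')

lemma quotient_zero: "\<zero>\<^bsub>quotient_module M H\<^esub> = H"
  by (simp add: quotient_module_def)

lemma quotient_add:
  assumes "submodule H R M" "x \<in> carrier M" "y \<in> carrier M"
  shows "(H +>\<^bsub>M\<^esub> x) \<oplus>\<^bsub>quotient_module M H\<^esub> (H +>\<^bsub>M\<^esub> y) = H +>\<^bsub>M\<^esub> (x \<oplus>\<^bsub>M\<^esub> y)"
  using abelian_subgroup.a_rcos_sum[OF submodule_abelian_subgroup[OF assms(1)] assms(2,3)]
  by (simp add: quotient_module_def)

lemma quotient_smult:
  assumes H: "submodule H R M" and r: "r \<in> carrier R" and x: "x \<in> carrier M"
  shows "r \<odot>\<^bsub>quotient_module M H\<^esub> (H +>\<^bsub>M\<^esub> x) = H +>\<^bsub>M\<^esub> (r \<odot>\<^bsub>M\<^esub> x)"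
proof -
  have "H +>\<^bsub>M\<^esub> (r \<odot>\<^bsub>M\<^esub> y) = H +>\<^bsub>M\<^esub> (r \<odot>\<^bsub>M\<^esub> x)" if y: "y \<in> H +>\<^bsub>M\<^esub> x" for y
  proof -
    have yc: "y \<in> carrier M" by (rule coset_subset[OF H x y])
    then have "r \<odot>\<^bsub>M\<^esub> (y \<ominus>\<^bsub>M\<^esub> x) \<in> H"
      using y coset_mem_iff[OF H x] submoduleE(4)[OF H r] by blast
    then show ?thesis using coset_eq_iff[OF H] r x yc by (simp add: smult_minus)
  qed
  then have "(\<Union>y\<in>H +>\<^bsub>M\<^esub> x. H +>\<^bsub>M\<^esub> (r \<odot>\<^bsub>M\<^esub> y)) = H +>\<^bsub>M\<^esub> (r \<odot>\<^bsub>M\<^esub> x)"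
    using coset_self[OF H x] by fast
  then show ?thesis by (simp add: quotient_module_def)
qed

lemma quotient_module_module:
  assumes H: "submodule H R M"
  shows "module R (quotient_module M H)"
proof -
  let ?Q = "quotient_module M H"
  note E = submoduleE[OF H]
  have I: "H +>\<^bsub>M\<^esub> x \<in> carrier ?Q" if "x \<in> carrier M" for x using that by (auto simp: quotient_carrier)
  have ex: "\<exists>x \<in> carrier M. X = H +>\<^bsub>M\<^esub> x" if "X \<in> carrier ?Q" for X using that by (auto simp: quotient_carrier)
  note simps = quotient_add[OF H] quotient_smult[OF H]
  have z: "\<zero>\<^bsub>?Q\<^esub> = H +>\<^bsub>M\<^esub> \<zero>\<^bsub>M\<^esub>" by (simp add: quotient_zero coset_zero[OF H])
  show ?thesis
  proof (rule moduleI)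
    show "abelian_group ?Q"
    proof (rule abelian_groupI)
      show "\<zero>\<^bsub>?Q\<^esub> \<in> carrier ?Q" unfolding z by (rule I) simp
    next
      fix X assume "X \<in> carrier ?Q"
      then obtain x where x: "x \<in> carrier M" "X = H +>\<^bsub>M\<^esub> x" using ex by blast
      show "\<zero>\<^bsub>?Q\<^esub> \<oplus>\<^bsub>?Q\<^esub> X = X" unfolding z x(2) using x(1) by (simp add: simps)
      have "(H +>\<^bsub>M\<^esub> (\<ominus>\<^bsub>M\<^esub> x)) \<oplus>\<^bsub>?Q\<^esub> X = \<zero>\<^bsub>?Q\<^esub>" unfolding z x(2) using x(1) by (simp add: simps M.l_neg)
      then show "\<exists>Y\<in>carrier ?Q. Y \<oplus>\<^bsub>?Q\<^esub> X = \<zero>\<^bsub>?Q\<^esub>" using I[of "\<ominus>\<^bsub>M\<^esub> x"] x(1) by blast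
      fix Y assume "Y \<in> carrier ?Q"
      then obtain y where y: "y \<in> carrier M" "Y = H +>\<^bsub>M\<^esub> y" using ex by blast
      show "X \<oplus>\<^bsub>?Q\<^esub> Y \<in> carrier ?Q" unfolding x(2) y(2) using x(1) y(1) I by (simp add: simps)
      show "X \<oplus>\<^bsub>?Q\<^esub> Y = Y \<oplus>\<^bsub>?Q\<^esub> X" unfolding x(2) y(2) using x(1) y(1) by (simp add: simps M.a_comm)
      fix W assume "W \<in> carrier ?Q"
      then obtain w where w: "w \<in> carrier M" "W = H +>\<^bsub>M\<^esub> w" using ex by blast
      show "X \<oplus>\<^bsub>?Q\<^esub> Y \<oplus>\<^bsub>?Q\<^esub> W = X \<oplus>\<^bsub>?Q\<^esub> (Y \<oplus>\<^bsub>?Q\<^esub> W)" unfolding x(2) y(2) w(2)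
        using x(1) y(1) w(1) by (simp add: simps M.a_assoc)
    qed
  next
    fix X assume "X \<in> carrier ?Q"
    then obtain x where x: "x \<in> carrier M" "X = H +>\<^bsub>M\<^esub> x" using ex by blast
    show "\<one> \<odot>\<^bsub>?Q\<^esub> X = X" unfolding x(2) using x(1) by (simp add: simps)
    fix a assume a: "a \<in> carrier R"
    show "a \<odot>\<^bsub>?Q\<^esub> X \<in> carrier ?Q" unfolding x(2) using x(1) a I by (simp add: simps)
    {
      fix b assume b: "b \<in> carrier R"
      show "(a \<otimes> b) \<odot>\<^bsub>?Q\<^esub> X = a \<odot>\<^bsub>?Q\<^esub> (b \<odot>\<^bsub>?Q\<^esub> X)" unfolding x(2) using x(1) a b by (simp add: simps smult_assoc1)
      show "(a \<oplus> b) \<odot>\<^bsub>?Q\<^esub> X = a \<odot>\<^bsub>?Q\<^esub> X \<oplus>\<^bsub>?Q\<^esub> b \<odot>\<^bsub>?Q\<^esub> X"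
        unfolding x(2) using x(1) a b by (simp add: simps smult_l_distr)
    }
    fix Y assume "Y \<in> carrier ?Q"
    then obtain y where y: "y \<in> carrier M" "Y = H +>\<^bsub>M\<^esub> y" using ex by blast
    show "a \<odot>\<^bsub>?Q\<^esub> (X \<oplus>\<^bsub>?Q\<^esub> Y) = a \<odot>\<^bsub>?Q\<^esub> X \<oplus>\<^bsub>?Q\<^esub> a \<odot>\<^bsub>?Q\<^esub> Y"
      unfolding x(2) y(2) using x(1) y(1) a by (simp add: simps smult_r_distr)
  qed (rule R.is_cring)
qed

end

text \<open>Formulated for any scalar action with these laws, so that sums in a direct limit never
  have to be examined: triviality of the localization is a matter of scalars and zero.\<close>

lemma Supp_iff:
  fixes R :: "('r, 'a) ring_scheme" and L :: "('r, 'm, 'k) module_scheme"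
  assumes P: "primeideal P R" and zero: "\<zero>\<^bsub>L\<^esub> \<in> carrier L"
    and closed: "\<And>r x. r \<in> carrier R \<Longrightarrow> x \<in> carrier L \<Longrightarrow> r \<odot>\<^bsub>L\<^esub> x \<in> carrier L"
    and assoc: "\<And>r s x. r \<in> carrier R \<Longrightarrow> s \<in> carrier R \<Longrightarrow> x \<in> carrier L \<Longrightarrow> (r \<otimes>\<^bsub>R\<^esub> s) \<odot>\<^bsub>L\<^esub> x = r \<odot>\<^bsub>L\<^esub> (s \<odot>\<^bsub>L\<^esub> x)"
    and one: "\<And>x. x \<in> carrier L \<Longrightarrow> \<one>\<^bsub>R\<^esub> \<odot>\<^bsub>L\<^esub> x = x"
    and smult_zero: "\<And>r. r \<in> carrier R \<Longrightarrow> r \<odot>\<^bsub>L\<^esub> \<zero>\<^bsub>L\<^esub> = \<zero>\<^bsub>L\<^esub>"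
  shows "P \<in> Supp R L \<longleftrightarrow> (\<exists>x \<in> carrier L. \<forall>s \<in> carrier R - P. s \<odot>\<^bsub>L\<^esub> x \<noteq> \<zero>\<^bsub>L\<^esub>)"
proof -
  interpret P: primeideal P R by fact
  have one_P: "\<one>\<^bsub>R\<^esub> \<in> carrier R - P" by (rule primeideal_one_notin[OF P])
  let ?Q = "localization R P L"
  have carr: "carrier ?Q = {fraction R P L x s | x s. x \<in> carrier L \<and> s \<in> carrier R - P}"
    and zeroQ: "\<zero>\<^bsub>?Q\<^esub> = fraction R P L \<zero>\<^bsub>L\<^esub> \<one>\<^bsub>R\<^esub>" by (simp_all add: localization_def)
  have "carrier ?Q \<noteq> {\<zero>\<^bsub>?Q\<^esub>} \<longleftrightarrow> (\<exists>x \<in> carrier L. \<forall>s \<in> carrier R - P. s \<odot>\<^bsub>L\<^esub> x \<noteq> \<zero>\<^bsub>L\<^esub>)"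
  proof
    assume ne: "carrier ?Q \<noteq> {\<zero>\<^bsub>?Q\<^esub>}"
    show "\<exists>x \<in> carrier L. \<forall>s \<in> carrier R - P. s \<odot>\<^bsub>L\<^esub> x \<noteq> \<zero>\<^bsub>L\<^esub>"
    proof (rule ccontr)
      assume "\<not> ?thesis"
      then have kill: "\<exists>a \<in> carrier R - P. a \<odot>\<^bsub>L\<^esub> x = \<zero>\<^bsub>L\<^esub>" if "x \<in> carrier L" for x using that by blast
      \<comment> \<open>If every element is killed from outside P, any two fractions are equivalent,
        so each class consists of all pairs.\<close>
      have all: "fraction R P L x s = carrier L \<times> (carrier R - P)" if x: "x \<in> carrier L" and s: "s \<in> carrier R - P" for x s
      proof -
        have "\<exists>u \<in> carrier R - P. u \<odot>\<^bsub>L\<^esub> (t \<odot>\<^bsub>L\<^esub> x) = u \<odot>\<^bsub>L\<^esub> (s \<odot>\<^bsub>L\<^esub> y)"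
          if y: "y \<in> carrier L" and t: "t \<in> carrier R - P" for y t
        proof -
          obtain a where a: "a \<in> carrier R - P" "a \<odot>\<^bsub>L\<^esub> (t \<odot>\<^bsub>L\<^esub> x) = \<zero>\<^bsub>L\<^esub>" using kill[of "t \<odot>\<^bsub>L\<^esub> x"] closed t x by blast
          obtain b where b: "b \<in> carrier R - P" "b \<odot>\<^bsub>L\<^esub> (s \<odot>\<^bsub>L\<^esub> y) = \<zero>\<^bsub>L\<^esub>" using kill[of "s \<odot>\<^bsub>L\<^esub> y"] closed s y by blast
          have "(a \<otimes>\<^bsub>R\<^esub> b) \<odot>\<^bsub>L\<^esub> (s \<odot>\<^bsub>L\<^esub> y) = \<zero>\<^bsub>L\<^esub>" using a b s y by (simp add: assoc closed smult_zero)
          moreover have "(a \<otimes>\<^bsub>R\<^esub> b) \<odot>\<^bsub>L\<^esub> (t \<odot>\<^bsub>L\<^esub> x) = (b \<otimes>\<^bsub>R\<^esub> a) \<odot>\<^bsub>L\<^esub> (t \<odot>\<^bsub>L\<^esub> x)" using a b by (simp add: P.m_comm)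
          moreover have "\<dots> = \<zero>\<^bsub>L\<^esub>" using a b t x by (simp add: assoc closed smult_zero)
          ultimately show ?thesis using primeideal_notin_mult[OF P a(1) b(1)] by (metis (no_types))
        qed
        then show ?thesis unfolding fraction_def by auto
      qed
      have "fraction R P L \<zero>\<^bsub>L\<^esub> \<one>\<^bsub>R\<^esub> \<in> carrier ?Q" unfolding carr using zero one_P by blast
      moreover have "X = fraction R P L \<zero>\<^bsub>L\<^esub> \<one>\<^bsub>R\<^esub>" if "X \<in> carrier ?Q" for X
        using that all all[OF zero one_P] unfolding carr by blast
      ultimately show False using ne unfolding zeroQ by blast
    qed
  next
    assume "\<exists>x \<in> carrier L. \<forall>s \<in> carrier R - P. s \<odot>\<^bsub>L\<^esub> x \<noteq> \<zero>\<^bsub>L\<^esub>"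
    then obtain x where x: "x \<in> carrier L" "\<And>s. s \<in> carrier R - P \<Longrightarrow> s \<odot>\<^bsub>L\<^esub> x \<noteq> \<zero>\<^bsub>L\<^esub>" by blast
    have "(\<zero>\<^bsub>L\<^esub>, \<one>\<^bsub>R\<^esub>) \<in> fraction R P L \<zero>\<^bsub>L\<^esub> \<one>\<^bsub>R\<^esub>" using zero one_P by (auto simp: fraction_def)
    moreover have "(\<zero>\<^bsub>L\<^esub>, \<one>\<^bsub>R\<^esub>) \<notin> fraction R P L x \<one>\<^bsub>R\<^esub>"
      using x one_P by (auto simp: fraction_def one smult_zero)
    moreover have "fraction R P L x \<one>\<^bsub>R\<^esub> \<in> carrier ?Q" unfolding carr using x(1) one_P by blast
    ultimately show "carrier ?Q \<noteq> {\<zero>\<^bsub>?Q\<^esub>}" unfolding zeroQ by (metis singletonD)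
  qed
  then show ?thesis using P by (simp add: Supp_def)
qed

locale direct_system =
  fixes R :: "('r, 'a) ring_scheme" (structure) and X :: "nat \<Rightarrow> ('r, 'b, 'k) module_scheme" and t :: "nat \<Rightarrow> nat \<Rightarrow> 'b \<Rightarrow> 'b"
  assumes X_module: "module R (X n)"
    and t_closed: "m \<le> n \<Longrightarrow> x \<in> carrier (X m) \<Longrightarrow> t m n x \<in> carrier (X n)"
    and t_comp: "m \<le> n \<Longrightarrow> n \<le> l \<Longrightarrow> x \<in> carrier (X m) \<Longrightarrow> t n l (t m n x) = t m l x"
    and t_smult: "m \<le> n \<Longrightarrow> r \<in> carrier R \<Longrightarrow> x \<in> carrier (X m) \<Longrightarrow> t m n (r \<odot>\<^bsub>X m\<^esub> x) = r \<odot>\<^bsub>X n\<^esub> t m n x"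
    and t_zero: "m \<le> n \<Longrightarrow> t m n \<zero>\<^bsub>X m\<^esub> = \<zero>\<^bsub>X n\<^esub>"
begin

abbreviation "cls \<equiv> limit_class X t"
abbreviation "D \<equiv> direct_limit X t"

lemma cls_eq_iff:
  assumes x: "x \<in> carrier (X m)" and y: "y \<in> carrier (X n)"
  shows "cls m x = cls n y \<longleftrightarrow> (\<exists>k\<ge>max m n. t m k x = t n k y)"
proof
  assume "cls m x = cls n y"
  moreover have "(n, y) \<in> cls n y" using y by (auto simp: limit_class_def)
  ultimately have "(n, y) \<in> cls m x" by simp
  then show "\<exists>k\<ge>max m n. t m k x = t n k y" by (auto simp: limit_class_def)
next
  have sub: "cls m x \<subseteq> cls n y" if x: "x \<in> carrier (X m)" and y: "y \<in> carrier (X n)"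
    and k: "k \<ge> m" "k \<ge> n" "t m k x = t n k y" for x y m n k
  proof
    fix p assume "p \<in> cls m x"
    then obtain l z k' where z: "p = (l, z)" "z \<in> carrier (X l)" "k' \<ge> m" "k' \<ge> l" "t m k' x = t l k' z"
      by (auto simp: limit_class_def)
    let ?j = "max k k'"
    have "t n ?j y = t k ?j (t m k x)" using t_comp[of n k ?j y] k y by simp
    also have "\<dots> = t k' ?j (t m k' x)" using t_comp[of m k ?j x] t_comp[of m k' ?j x] k z x by simp
    also have "\<dots> = t l ?j z" using t_comp[of l k' ?j z] z by simp
    finally have "t n ?j y = t l ?j z" .
    moreover have "?j \<ge> max n l" using k z by auto
    ultimately show "p \<in> cls n y" using z(1,2) unfolding limit_class_def by blast
  qed
  assume "\<exists>k\<ge>max m n. t m k x = t n k y"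
  then obtain k where "k \<ge> m" "k \<ge> n" "t m k x = t n k y" by auto
  then show "cls m x = cls n y" using sub[OF x y, of k] sub[OF y x, of k] by auto
qed

lemma D_carrier: "carrier D = {cls m x | m x. x \<in> carrier (X m)}"
  by (simp add: direct_limit_def)

lemma cls_smult:
  assumes r: "r \<in> carrier R" and x: "x \<in> carrier (X m)"
  shows "r \<odot>\<^bsub>D\<^esub> cls m x = cls m (r \<odot>\<^bsub>X m\<^esub> x)"
proof -
  have "cls n (r \<odot>\<^bsub>X n\<^esub> y) = cls m (r \<odot>\<^bsub>X m\<^esub> x)" if "(n, y) \<in> cls m x" for n y
  proof -
    interpret m: module R "X m" by (rule X_module)
    interpret n: module R "X n" by (rule X_module)
    from that obtain k where k: "y \<in> carrier (X n)" "k \<ge> m" "k \<ge> n" "t m k x = t n k y" by (auto simp: limit_class_def)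
    have "t n k (r \<odot>\<^bsub>X n\<^esub> y) = t m k (r \<odot>\<^bsub>X m\<^esub> x)" using t_smult r x k by simp
    then show ?thesis
      by (subst cls_eq_iff) (use r x k in auto)
  qed
  moreover have "(m, x) \<in> cls m x" using x by (auto simp: limit_class_def)
  ultimately have "(\<Union>(n, y)\<in>cls m x. cls n (r \<odot>\<^bsub>X n\<^esub> y)) = cls m (r \<odot>\<^bsub>X m\<^esub> x)" by fast
  then show ?thesis by (simp add: direct_limit_def)
qed

lemma cls_eq_zero_iff:
  assumes x: "x \<in> carrier (X m)"
  shows "cls m x = \<zero>\<^bsub>D\<^esub> \<longleftrightarrow> (\<exists>k\<ge>m. t m k x = \<zero>\<^bsub>X k\<^esub>)"
proof -
  interpret z: module R "X 0" by (rule X_module)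
  have "\<zero>\<^bsub>D\<^esub> = cls 0 \<zero>\<^bsub>X 0\<^esub>" by (simp add: direct_limit_def)
  then show ?thesis using cls_eq_iff[OF x z.zero_closed] t_zero[of 0] by simp
qed

text \<open>An element of the limit is zero exactly if some transition map kills its representative;
  surviving at P means that no multiple by an s outside P ever dies.\<close>

lemma Supp_direct_limit_iff:
  assumes P: "primeideal P R"
  shows "P \<in> Supp R D \<longleftrightarrow> (\<exists>m. \<exists>x \<in> carrier (X m). \<forall>s \<in> carrier R - P. \<forall>k\<ge>m. t m k (s \<odot>\<^bsub>X m\<^esub> x) \<noteq> \<zero>\<^bsub>X k\<^esub>)"
proof -
  interpret z: module R "X 0" by (rule X_module)
  have ex: "\<exists>m. \<exists>x \<in> carrier (X m). Y = cls m x" if "Y \<in> carrier D" for Y using that by (auto simp: D_carrier)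
  have I: "cls m x \<in> carrier D" if "x \<in> carrier (X m)" for m x using that by (auto simp: D_carrier)
  have zero: "\<zero>\<^bsub>D\<^esub> = cls 0 \<zero>\<^bsub>X 0\<^esub>" by (simp add: direct_limit_def)
  have smult: "r \<odot>\<^bsub>X m\<^esub> x \<in> carrier (X m)" if "r \<in> carrier R" "x \<in> carrier (X m)" for r m x
    by (rule module.smult_closed[OF X_module that])
  have "P \<in> Supp R D \<longleftrightarrow> (\<exists>Y \<in> carrier D. \<forall>s \<in> carrier R - P. s \<odot>\<^bsub>D\<^esub> Y \<noteq> \<zero>\<^bsub>D\<^esub>)"
  proof (rule Supp_iff[OF P])
    show "\<zero>\<^bsub>D\<^esub> \<in> carrier D" unfolding zero by (rule I) simp
    show "r \<odot>\<^bsub>D\<^esub> \<zero>\<^bsub>D\<^esub> = \<zero>\<^bsub>D\<^esub>" if "r \<in> carrier R" for r unfolding zero using that by (simp add: cls_smult)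
    fix Y assume "Y \<in> carrier D"
    then obtain m x where x: "x \<in> carrier (X m)" "Y = cls m x" using ex by blast
    interpret m: module R "X m" by (rule X_module)
    show "r \<odot>\<^bsub>D\<^esub> Y \<in> carrier D" if "r \<in> carrier R" for r unfolding x(2) using that x(1) I by (simp add: cls_smult)
    show "(r \<otimes> s) \<odot>\<^bsub>D\<^esub> Y = r \<odot>\<^bsub>D\<^esub> (s \<odot>\<^bsub>D\<^esub> Y)" if "r \<in> carrier R" "s \<in> carrier R" for r s
      unfolding x(2) using that x(1) by (simp add: cls_smult m.smult_assoc1)
    show "\<one> \<odot>\<^bsub>D\<^esub> Y = Y" unfolding x(2) using x(1) by (simp add: cls_smult)
  qed
  also have "\<dots> \<longleftrightarrow> (\<exists>m. \<exists>x \<in> carrier (X m). \<forall>s \<in> carrier R - P. s \<odot>\<^bsub>D\<^esub> cls m x \<noteq> \<zero>\<^bsub>D\<^esub>)"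
    using ex I by metis
  also have "\<dots> \<longleftrightarrow> (\<exists>m. \<exists>x \<in> carrier (X m). \<forall>s \<in> carrier R - P. \<forall>k\<ge>m. t m k (s \<odot>\<^bsub>X m\<^esub> x) \<noteq> \<zero>\<^bsub>X k\<^esub>)"
    using smult by (auto simp: cls_smult cls_eq_zero_iff)
  finally show ?thesis .
qed

end

section \<open>Ext as classes of cocycles\<close>

lemma module_map_image_submodule:
  assumes "module R M" "module R N" "module_map R M N f"
  shows "submodule (f ` carrier M) R N"
proof -
  interpret M: module R M by fact
  interpret N: module R N by fact
  note D = module_mapD[OF assms(3)]
  show ?thesis
  proof (rule N.submoduleI_smult)
    show "f ` carrier M \<subseteq> carrier N" using D(1) by blast
    show "\<zero>\<^bsub>N\<^esub> \<in> f ` carrier M" using module_map_zero[OF assms] M.zero_closed by (metis imageI)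
    show "a \<oplus>\<^bsub>N\<^esub> b \<in> f ` carrier M" if ab: "a \<in> f ` carrier M" "b \<in> f ` carrier M" for a b
    proof -
      obtain x y where "x \<in> carrier M" "y \<in> carrier M" "a = f x" "b = f y" using ab by blast
      then show ?thesis using D(2)[of x y] M.a_closed by (metis imageI)
    qed
    show "a \<odot>\<^bsub>N\<^esub> b \<in> f ` carrier M" if ab: "a \<in> carrier R" "b \<in> f ` carrier M" for a b
    proof -
      obtain y where "y \<in> carrier M" "b = f y" using ab by blast
      then show ?thesis using D(3)[OF ab(1), of y] M.smult_closed[OF ab(1)] by (metis imageI)
    qed
  qed
qed

lemma (in module) submodule_restrict_carrier:
  assumes Z: "submodule Z R M" and B: "submodule B R M" and "B \<subseteq> Z"
  shows "submodule B R (M\<lparr>carrier := Z\<rparr>)"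
proof -
  interpret Z: module R "M\<lparr>carrier := Z\<rparr>" by (rule submodule.submodule_is_module[OF Z module_axioms])
  show ?thesis
    by (rule Z.submoduleI_smult) (use assms(3) submoduleE(4,5)[OF B] submodule_zero[OF B] in auto)
qed

lemma hom_module_simps:
  "\<zero>\<^bsub>hom_module R L N\<^esub> = (\<lambda>x\<in>carrier L. \<zero>\<^bsub>N\<^esub>)"
  "f \<oplus>\<^bsub>hom_module R L N\<^esub> g = (\<lambda>x\<in>carrier L. f x \<oplus>\<^bsub>N\<^esub> g x)"
  "r \<odot>\<^bsub>hom_module R L N\<^esub> f = (\<lambda>x\<in>carrier L. r \<odot>\<^bsub>N\<^esub> f x)"
  by (simp_all add: hom_module_def)

text \<open>Used twice: with g the boundary it gives the coboundary map, with g the chain map of a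
  homomorphism the induced map on cochains.\<close>

lemma hom_module_pullback:
  assumes "module R L'" and "module R L" and g: "module_map R L' L g"
  shows "module_map R (hom_module R L N) (hom_module R L' N) (\<lambda>\<phi>. \<lambda>x\<in>carrier L'. \<phi> (g x))"
proof -
  interpret L': module R L' by fact
  interpret L: module R L by fact
  note G = module_mapD[OF g]
  show ?thesis
    unfolding module_map_def
  proof (intro conjI ballI Pi_I)
    fix \<phi> assume \<phi>: "\<phi> \<in> carrier (hom_module R L N)"
    then have "module_map R L N \<phi>" by (simp add: hom_module_carrier_iff)
    then have "module_map R L' N (\<lambda>x. \<phi> (g x))" by (rule module_map_comp[OF g])
    then show "(\<lambda>x\<in>carrier L'. \<phi> (g x)) \<in> carrier (hom_module R L' N)"
      by (auto simp: hom_module_carrier_iff intro: module_map_cong[OF L'.module_axioms])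
  qed (auto simp: hom_module_simps G intro!: restrict_ext)
qed

locale Ext_modules = A: module R A + N: module R N
  for R :: "('r, 'a) ring_scheme" (structure) and A :: "('r, 'm, 'k) module_scheme"
    and N :: "('r, 'n, 'l) module_scheme"
begin

abbreviation "C \<equiv> ext_cochains R A N"
abbreviation "Z \<equiv> ext_cocycles R A N"
abbreviation "B \<equiv> ext_coboundaries R A N"
abbreviation "FA \<equiv> std_res R A"

lemma C_module: "module R (C j)"
  unfolding ext_cochains_def by (rule hom_module_module[OF A.std_res_module N.module_axioms])

lemma C_carrier_iff: "\<phi> \<in> carrier (C j) \<longleftrightarrow> module_map R (FA j) N \<phi> \<and> \<phi> \<in> extensional (carrier (FA j))"
  by (simp add: ext_cochains_def hom_module_carrier_iff)

lemma coboundary_map: "module_map R (C j) (C (Suc j)) (ext_coboundary R A j)"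
  unfolding ext_cochains_def ext_coboundary_def
  by (rule hom_module_pullback[OF A.std_res_module A.std_res_module A.boundary_hom])

lemma Z_iff: "\<phi> \<in> Z j \<longleftrightarrow> \<phi> \<in> carrier (C j) \<and> (\<forall>h \<in> carrier (FA (Suc j)). \<phi> (res_boundary R h) = \<zero>\<^bsub>N\<^esub>)"
  by (auto simp: ext_cocycles_def ext_coboundary_def ext_cochains_def hom_module_simps fun_eq_iff restrict_def)

lemma Z_submodule: "submodule (Z j) R (C j)"
  using module_map_submodule_vimage[OF C_module C_module coboundary_map module.zero_submodule[OF C_module], of j]
  by (simp add: ext_cocycles_def)

lemma B_submodule: "submodule (B j) R (C j)"
proof (cases j)
  case 0 then show ?thesis using module.zero_submodule[OF C_module] by simp
next
  case (Suc i) then show ?thesis using module_map_image_submodule[OF C_module C_module coboundary_map] by simp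
qed

lemma B_subset_Z: "B j \<subseteq> Z j"
proof (cases j)
  case 0
  then show ?thesis using module.submodule_zero[OF C_module Z_submodule, of 0] by simp
next
  case (Suc i)
  have "ext_coboundary R A i \<psi> \<in> Z (Suc i)" if \<psi>: "\<psi> \<in> carrier (C i)" for \<psi>
    unfolding Z_iff
  proof (intro conjI ballI)
    show "ext_coboundary R A i \<psi> \<in> carrier (C (Suc i))" by (rule module_mapD(1)[OF coboundary_map \<psi>])
    fix h assume h: "h \<in> carrier (FA (Suc (Suc i)))"
    have "module_map R (FA i) N \<psi>" using \<psi> by (simp add: C_carrier_iff)
    then have "\<psi> (\<lambda>_. \<zero>) = \<zero>\<^bsub>N\<^esub>"
      using module_map_zero[OF A.std_res_module N.module_axioms, of i \<psi>] by (simp add: std_res_def)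
    then show "ext_coboundary R A i \<psi> (res_boundary R h) = \<zero>\<^bsub>N\<^esub>"
      using A.boundary_closed[OF h] A.boundary_boundary[OF h] by (simp add: ext_coboundary_def)
  qed
  then show ?thesis using Suc by auto
qed

lemma Z_module: "module R ((C j)\<lparr>carrier := Z j\<rparr>)"
  by (rule submodule.submodule_is_module[OF Z_submodule C_module])

lemma B_submodule_Z: "submodule (B j) R ((C j)\<lparr>carrier := Z j\<rparr>)"
  by (rule module.submodule_restrict_carrier[OF C_module Z_submodule B_submodule B_subset_Z])

lemma Ext_module: "module R (Ext R j A N)"
  unfolding Ext_def by (rule module.quotient_module_module[OF Z_module B_submodule_Z])

abbreviation "ext_class j \<phi> \<equiv> B j +>\<^bsub>C j\<^esub> \<phi>"

text \<open>The coset formula ignores the carrier, so classes of cocycles can be formed in the full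
  cochain module.\<close>

lemma coset_restrict_carrier: "H +>\<^bsub>L\<lparr>carrier := W\<rparr>\<^esub> x = H +>\<^bsub>L\<^esub> x"
  by (simp add: a_r_coset_def r_coset_def)

lemma Ext_carrier: "carrier (Ext R j A N) = {ext_class j \<phi> | \<phi>. \<phi> \<in> Z j}"
  unfolding Ext_def module.quotient_carrier[OF Z_module] by (simp add: coset_restrict_carrier)

lemma Ext_smult: "r \<in> carrier R \<Longrightarrow> \<phi> \<in> Z j \<Longrightarrow> r \<odot>\<^bsub>Ext R j A N\<^esub> ext_class j \<phi> = ext_class j (r \<odot>\<^bsub>C j\<^esub> \<phi>)"
  unfolding Ext_def using module.quotient_smult[OF Z_module B_submodule_Z, of r \<phi> j] by (simp add: coset_restrict_carrier)

lemma Z_subset: "\<phi> \<in> Z j \<Longrightarrow> \<phi> \<in> carrier (C j)"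
  by (simp add: Z_iff)

lemma Z_smult: "r \<in> carrier R \<Longrightarrow> \<phi> \<in> Z j \<Longrightarrow> r \<odot>\<^bsub>C j\<^esub> \<phi> \<in> Z j"
  using module.submoduleE(4)[OF C_module Z_submodule] .

lemma ext_class_zero_iff: "\<phi> \<in> Z j \<Longrightarrow> ext_class j \<phi> = \<zero>\<^bsub>Ext R j A N\<^esub> \<longleftrightarrow> \<phi> \<in> B j"
  using module.coset_eq_self_iff[OF C_module B_submodule Z_subset] module.quotient_zero[OF Z_module]
  by (simp add: Ext_def)

lemma ext_class_zero: "ext_class j \<zero>\<^bsub>C j\<^esub> = \<zero>\<^bsub>Ext R j A N\<^esub>"
  using module.coset_zero[OF C_module B_submodule] module.quotient_zero[OF Z_module] by (simp add: Ext_def)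

text \<open>The bounding \<psi> may be any \<open>module_map\<close>; restricting it to the carrier
  gives the extensional cochain demanded by \<open>ext_coboundaries\<close>. In this form the
  condition matches \<open>coboundary_mod\<close> for K = 0.\<close>

lemma B_iff:
  assumes "\<chi> \<in> extensional (carrier (FA j))"
  shows "\<chi> \<in> B j \<longleftrightarrow> (case j of 0 \<Rightarrow> \<forall>h \<in> carrier (FA 0). \<chi> h = \<zero>\<^bsub>N\<^esub>
    | Suc i \<Rightarrow> \<exists>\<psi>. module_map R (FA i) N \<psi> \<and> (\<forall>h \<in> carrier (FA (Suc i)). \<chi> h = \<psi> (res_boundary R h)))"
proof (cases j)
  case 0
  show ?thesis using assms unfolding 0
    by (auto simp: ext_cochains_def hom_module_simps intro: extensionalityI)
next
  case (Suc i)
  have "(\<exists>\<psi> \<in> carrier (C i). \<chi> = ext_coboundary R A i \<psi>) \<longleftrightarrow>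
    (\<exists>\<psi>. module_map R (FA i) N \<psi> \<and> (\<forall>h \<in> carrier (FA (Suc i)). \<chi> h = \<psi> (res_boundary R h)))"
  proof
    assume "\<exists>\<psi> \<in> carrier (C i). \<chi> = ext_coboundary R A i \<psi>"
    then show "\<exists>\<psi>. module_map R (FA i) N \<psi> \<and> (\<forall>h \<in> carrier (FA (Suc i)). \<chi> h = \<psi> (res_boundary R h))"
      by (auto simp: C_carrier_iff ext_coboundary_def)
  next
    assume "\<exists>\<psi>. module_map R (FA i) N \<psi> \<and> (\<forall>h \<in> carrier (FA (Suc i)). \<chi> h = \<psi> (res_boundary R h))"
    then obtain \<psi> where \<psi>: "module_map R (FA i) N \<psi>" "\<forall>h \<in> carrier (FA (Suc i)). \<chi> h = \<psi> (res_boundary R h)" by blast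
    let ?\<psi> = "restrict \<psi> (carrier (FA i))"
    have "module_map R (FA i) N ?\<psi>" by (rule module_map_cong[OF A.std_res_module \<psi>(1)]) simp
    then have "?\<psi> \<in> carrier (C i)" by (simp add: C_carrier_iff)
    moreover have "\<chi> = ext_coboundary R A i ?\<psi>"
      by (rule extensionalityI[OF assms[unfolded Suc]])
        (use \<psi>(2) A.boundary_closed in \<open>auto simp: ext_coboundary_def\<close>)
    ultimately show "\<exists>\<psi> \<in> carrier (C i). \<chi> = ext_coboundary R A i \<psi>" by blast
  qed
  then show ?thesis unfolding Suc by (auto simp: image_iff)
qed

end

definition ext_pull ::
  "('r, 'a) ring_scheme \<Rightarrow> ('r, 'm, 'k) module_scheme \<Rightarrow> ('m \<Rightarrow> 'p) \<Rightarrow> nat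
    \<Rightarrow> ((('r, 'p) res_gen \<Rightarrow> 'r) \<Rightarrow> 'n) \<Rightarrow> ((('r, 'm) res_gen \<Rightarrow> 'r) \<Rightarrow> 'n)" where
  "ext_pull R A f j \<phi> = (\<lambda>h\<in>carrier (std_res R A j). \<phi> (std_res_map R f j h))"

locale Ext_pair = pair: module_map_pair R A B f + N: module R N
  for R :: "('r, 'a) ring_scheme" (structure) and A :: "('r, 'm, 'k) module_scheme"
    and B :: "('r, 'p, 'q) module_scheme" and f :: "'m \<Rightarrow> 'p" and N :: "('r, 'n, 'l) module_scheme"
begin

sublocale EA: Ext_modules R A N ..
sublocale EB: Ext_modules R B N ..

abbreviation "pull \<equiv> ext_pull R A f"

lemma pull_map: "module_map R (EB.C j) (EA.C j) (pull j)"
  unfolding ext_cochains_def ext_pull_def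
  by (rule hom_module_pullback[OF pair.A.std_res_module pair.B.std_res_module pair.lift_map_hom])

lemma pull_Z:
  assumes \<phi>: "\<phi> \<in> EB.Z j"
  shows "pull j \<phi> \<in> EA.Z j"
  unfolding EA.Z_iff
proof (intro conjI ballI)
  show "pull j \<phi> \<in> carrier (EA.C j)" by (rule module_mapD(1)[OF pull_map EB.Z_subset[OF \<phi>]])
  fix h assume h: "h \<in> carrier (EA.FA (Suc j))"
  show "pull j \<phi> (res_boundary R h) = \<zero>\<^bsub>N\<^esub>"
    using \<phi> pair.boundary_lift_map[OF h, symmetric] pair.lift_map_closed[OF h] pair.A.boundary_closed[OF h]
    by (simp add: ext_pull_def EB.Z_iff)
qed

lemma pull_B:
  assumes \<phi>: "\<phi> \<in> EB.B j"
  shows "pull j \<phi> \<in> EA.B j"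
proof (cases j)
  case 0
  then show ?thesis using \<phi> module_map_zero[OF EB.C_module EA.C_module pull_map, of 0] by simp
next
  case (Suc i)
  then obtain \<psi> where \<psi>: "\<psi> \<in> carrier (EB.C i)" "\<phi> = ext_coboundary R B i \<psi>" using \<phi> by auto
  have "pull (Suc i) \<phi> = ext_coboundary R A i (pull i \<psi>)"
    unfolding \<psi>(2) ext_coboundary_def ext_pull_def
    by (rule restrict_ext) (simp add: pair.lift_map_closed pair.A.boundary_closed pair.boundary_lift_map)
  then show ?thesis using Suc module_mapD(1)[OF pull_map \<psi>(1)] by auto
qed

text \<open>Representatives of a class differ by a coboundary, which pulls back to a coboundary; the
  union over representatives in \<open>Ext_map\<close> is thus a single class.\<close>

lemma Ext_map_class:
  assumes \<phi>: "\<phi> \<in> EB.Z j"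
  shows "Ext_map R j A f N (EB.ext_class j \<phi>) = EA.ext_class j (pull j \<phi>)"
proof -
  note \<phi>C = EB.Z_subset[OF \<phi>]
  have "EA.ext_class j (pull j \<psi>) = EA.ext_class j (pull j \<phi>)" if \<psi>: "\<psi> \<in> EB.ext_class j \<phi>" for \<psi>
  proof -
    have \<psi>C: "\<psi> \<in> carrier (EB.C j)" by (rule module.coset_subset[OF EB.C_module EB.B_submodule \<phi>C \<psi>])
    then have "\<psi> \<ominus>\<^bsub>EB.C j\<^esub> \<phi> \<in> EB.B j"
      using \<psi> module.coset_mem_iff[OF EB.C_module EB.B_submodule \<phi>C] by blast
    then have "pull j \<psi> \<ominus>\<^bsub>EA.C j\<^esub> pull j \<phi> \<in> EA.B j"
      using pull_B module_map_diff[OF EB.C_module EA.C_module pull_map \<psi>C \<phi>C] by metis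
    then show ?thesis
      using module.coset_eq_iff[OF EA.C_module EA.B_submodule] module_mapD(1)[OF pull_map] \<psi>C \<phi>C by blast
  qed
  moreover have "\<phi> \<in> EB.ext_class j \<phi>" by (rule module.coset_self[OF EB.C_module EB.B_submodule \<phi>C])
  ultimately have "(\<Union>\<psi>\<in>EB.ext_class j \<phi>. EA.ext_class j (pull j \<psi>)) = EA.ext_class j (pull j \<phi>)" by fast
  then show ?thesis by (simp add: Ext_map_def ext_pull_def)
qed

end

section \<open>Ext along the inverse system and the support of its limit\<close>

context module_system begin

lemma Ext_modules_A: "Ext_modules R (A n) N"
  by (intro Ext_modules.intro A_module N.module_axioms)

lemma Ext_pair_S: "m \<le> n \<Longrightarrow> Ext_pair R (A n) (A m) (f m n) N"
  by (intro Ext_pair.intro S_pair N.module_axioms)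

abbreviation "pl j m n \<equiv> ext_pull R (A n) (f m n) j"

abbreviation "Z j n \<equiv> ext_cocycles R (A n) N j"
abbreviation "class j n \<equiv> Ext_modules.ext_class R (A n) N j"

lemma Ext_map_class: "m \<le> n \<Longrightarrow> \<phi> \<in> Z j m \<Longrightarrow>
    Ext_map R j (A n) (f m n) N (class j m \<phi>) = class j n (pl j m n \<phi>)"
  by (rule Ext_pair.Ext_map_class[OF Ext_pair_S])

lemma pull_Z: "m \<le> n \<Longrightarrow> \<phi> \<in> Z j m \<Longrightarrow> pl j m n \<phi> \<in> Z j n"
  by (rule Ext_pair.pull_Z[OF Ext_pair_S])

lemma pull_pull:
  assumes "m \<le> n" "n \<le> l"
  shows "pl j n l (pl j m n \<phi>) = pl j m l \<phi>"
  unfolding ext_pull_def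
  by (rule restrict_ext) (simp add: module_mapD(1)[OF S_map[OF assms(2)]] S_comp[OF assms])

text \<open>Transition maps compose exactly already on cochains (\<open>pull_pull\<close>), thanks
  to the strict functoriality of the resolution.\<close>

lemma Ext_direct_system:
  "direct_system R (\<lambda>n. Ext R j (A n) N) (\<lambda>m n. Ext_map R j (A n) (f m n) N)"
proof (rule direct_system.intro)
  note carr = Ext_modules.Ext_carrier[OF Ext_modules_A]
  show "module R (Ext R j (A n) N)" for n by (rule Ext_modules.Ext_module[OF Ext_modules_A])
  fix m n :: nat assume mn: "m \<le> n"
  note pmap = Ext_pair.pull_map[OF Ext_pair_S[OF mn]]
  show "Ext_map R j (A n) (f m n) N \<zero>\<^bsub>Ext R j (A m) N\<^esub> = \<zero>\<^bsub>Ext R j (A n) N\<^esub>"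
  proof -
    have z: "\<zero>\<^bsub>ext_cochains R (A m) N j\<^esub> \<in> Z j m"
      by (rule module.submodule_zero[OF Ext_modules.C_module[OF Ext_modules_A] Ext_modules.Z_submodule[OF Ext_modules_A]])
    have "pl j m n \<zero>\<^bsub>ext_cochains R (A m) N j\<^esub> = \<zero>\<^bsub>ext_cochains R (A n) N j\<^esub>"
      by (rule module_map_zero[OF Ext_modules.C_module[OF Ext_modules_A] Ext_modules.C_module[OF Ext_modules_A] pmap])
    then show ?thesis using Ext_map_class[OF mn z] by (simp add: Ext_modules.ext_class_zero[OF Ext_modules_A])
  qed
  fix x assume "x \<in> carrier (Ext R j (A m) N)"
  then obtain \<phi> where \<phi>: "\<phi> \<in> Z j m" "x = class j m \<phi>" by (auto simp: carr)
  show "Ext_map R j (A n) (f m n) N x \<in> carrier (Ext R j (A n) N)"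
    using pull_Z[OF mn \<phi>(1)] unfolding \<phi>(2) Ext_map_class[OF mn \<phi>(1)] carr by blast
  show "Ext_map R j (A l) (f n l) N (Ext_map R j (A n) (f m n) N x) = Ext_map R j (A l) (f m l) N x"
    if nl: "n \<le> l" for l
    unfolding \<phi>(2) Ext_map_class[OF mn \<phi>(1)] Ext_map_class[OF nl pull_Z[OF mn \<phi>(1)]]
      Ext_map_class[OF le_trans[OF mn nl] \<phi>(1)] pull_pull[OF mn nl] ..
  show "Ext_map R j (A n) (f m n) N (r \<odot>\<^bsub>Ext R j (A m) N\<^esub> x) = r \<odot>\<^bsub>Ext R j (A n) N\<^esub> Ext_map R j (A n) (f m n) N x"
    if r: "r \<in> carrier R" for r
  proof -
    note \<phi>C = Ext_modules.Z_subset[OF Ext_modules_A \<phi>(1)]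
    show ?thesis
      unfolding \<phi>(2) Ext_map_class[OF mn \<phi>(1)] Ext_modules.Ext_smult[OF Ext_modules_A r \<phi>(1)]
        Ext_modules.Ext_smult[OF Ext_modules_A r pull_Z[OF mn \<phi>(1)]]
        Ext_map_class[OF mn Ext_modules.Z_smult[OF Ext_modules_A r \<phi>(1)]]
        module_mapD(3)[OF pmap r \<phi>C] ..
  qed
qed

lemma B_iff_coboundary_mod:
  assumes \<chi>: "cochain n j \<chi>"
  shows "restrict \<chi> (carrier (F n j)) \<in> ext_coboundaries R (A n) N j \<longleftrightarrow> coboundary_mod {\<zero>\<^bsub>N\<^esub>} n j \<chi>"
proof (cases j)
  case 0
  show ?thesis by (subst Ext_modules.B_iff[OF Ext_modules_A]) (auto simp: coboundary_mod_def 0)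
next
  case (Suc i)
  have "\<chi> h \<ominus>\<^bsub>N\<^esub> \<psi> (res_boundary R h) = \<zero>\<^bsub>N\<^esub> \<longleftrightarrow> \<chi> h = \<psi> (res_boundary R h)"
    if "cochain n i \<psi>" "h \<in> carrier (F n (Suc i))" for \<psi> h
  proof -
    have "\<chi> h \<in> carrier N" "\<psi> (res_boundary R h) \<in> carrier N"
      using module_mapD(1)[OF \<chi>[unfolded Suc] that(2)] module_mapD(1)[OF that(1) module_mapD(1)[OF boundary_map that(2)]] by auto
    then show ?thesis by (rule N.diff_eq_zero_iff)
  qed
  then show ?thesis
    by (subst Ext_modules.B_iff[OF Ext_modules_A]) (auto simp: coboundary_mod_def Suc)
qed

text \<open>Unfolded to cochains, a cocycle survives at P if no s outside P turns its image at a
  later stage into a coboundary, and \<open>vanishes\<close> at K = 0 denies exactly this.\<close>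

lemma Supp_iff_not_vanishes:
  assumes P: "primeideal P R"
  shows "P \<in> Supp R (direct_limit (\<lambda>n. Ext R j (A n) N) (\<lambda>m n. Ext_map R j (A n) (f m n) N))
    \<longleftrightarrow> \<not> vanishes P {\<zero>\<^bsub>N\<^esub>} j"
proof -
  note carr = Ext_modules.Ext_carrier[OF Ext_modules_A]
  have *: "Ext_map R j (A k) (f m k) N (s \<odot>\<^bsub>Ext R j (A m) N\<^esub> class j m \<phi>) = \<zero>\<^bsub>Ext R j (A k) N\<^esub>
      \<longleftrightarrow> coboundary_mod {\<zero>\<^bsub>N\<^esub>} k j (\<lambda>h. s \<odot>\<^bsub>N\<^esub> \<phi> (S m k j h))"
    if s: "s \<in> carrier R" and k: "m \<le> k" and \<phi>: "\<phi> \<in> Z j m" for s m k \<phi>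
  proof -
    have \<phi>c: "cochain m j \<phi>"
      using Ext_modules.Z_subset[OF Ext_modules_A \<phi>] Ext_modules.C_carrier_iff[OF Ext_modules_A] by blast
    have sZ: "s \<odot>\<^bsub>ext_cochains R (A m) N j\<^esub> \<phi> \<in> Z j m" by (rule Ext_modules.Z_smult[OF Ext_modules_A s \<phi>])
    have "pl j m k (s \<odot>\<^bsub>ext_cochains R (A m) N j\<^esub> \<phi>) = restrict (\<lambda>h. s \<odot>\<^bsub>N\<^esub> \<phi> (S m k j h)) (carrier (F k j))"
      unfolding ext_pull_def ext_cochains_def hom_module_simps
      by (rule restrict_ext) (simp add: module_mapD(1)[OF S_map[OF k]])
    moreover have "cochain k j (\<lambda>h. s \<odot>\<^bsub>N\<^esub> \<phi> (S m k j h))"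
      by (rule N.module_map_smult[OF F_module module_map_comp[OF S_map[OF k] \<phi>c] s])
    ultimately show ?thesis
      unfolding Ext_modules.Ext_smult[OF Ext_modules_A s \<phi>] Ext_map_class[OF k sZ]
        Ext_modules.ext_class_zero_iff[OF Ext_modules_A pull_Z[OF k sZ]]
      using B_iff_coboundary_mod by simp
  qed
  have "P \<in> Supp R (direct_limit (\<lambda>n. Ext R j (A n) N) (\<lambda>m n. Ext_map R j (A n) (f m n) N)) \<longleftrightarrow>
    (\<exists>m. \<exists>\<phi> \<in> Z j m. \<forall>s \<in> carrier R - P. \<forall>k\<ge>m. \<not> coboundary_mod {\<zero>\<^bsub>N\<^esub>} k j (\<lambda>h. s \<odot>\<^bsub>N\<^esub> \<phi> (S m k j h)))"
  proof -
    have "(\<exists>x \<in> carrier (Ext R j (A m) N). \<Psi> x) \<longleftrightarrow> (\<exists>\<phi> \<in> Z j m. \<Psi> (class j m \<phi>))" for m \<Psi>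
      unfolding carr by blast
    then show ?thesis
      unfolding direct_system.Supp_direct_limit_iff[OF Ext_direct_system P] by (simp add: * cong: conj_cong bex_cong)
  qed
  also have "\<dots> \<longleftrightarrow> \<not> vanishes P {\<zero>\<^bsub>N\<^esub>} j"
  proof
    assume "\<exists>m. \<exists>\<phi> \<in> Z j m. \<forall>s \<in> carrier R - P. \<forall>k\<ge>m. \<not> coboundary_mod {\<zero>\<^bsub>N\<^esub>} k j (\<lambda>h. s \<odot>\<^bsub>N\<^esub> \<phi> (S m k j h))"
    then obtain m \<phi> where \<phi>: "\<phi> \<in> Z j m"
      "\<forall>s \<in> carrier R - P. \<forall>k\<ge>m. \<not> coboundary_mod {\<zero>\<^bsub>N\<^esub>} k j (\<lambda>h. s \<odot>\<^bsub>N\<^esub> \<phi> (S m k j h))" by blast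
    then have "cochain m j \<phi>" "\<forall>h \<in> carrier (F m (Suc j)). \<phi> (res_boundary R h) \<in> {\<zero>\<^bsub>N\<^esub>}"
      using Ext_modules.Z_iff[OF Ext_modules_A] Ext_modules.C_carrier_iff[OF Ext_modules_A] by auto
    then show "\<not> vanishes P {\<zero>\<^bsub>N\<^esub>} j" using \<phi>(2) unfolding vanishes_def by blast
  next
    assume "\<not> vanishes P {\<zero>\<^bsub>N\<^esub>} j"
    then obtain m \<phi> where \<phi>: "cochain m j \<phi>" "\<forall>h \<in> carrier (F m (Suc j)). \<phi> (res_boundary R h) \<in> {\<zero>\<^bsub>N\<^esub>}"
      and no: "\<forall>k\<ge>m. \<forall>s \<in> carrier R - P. \<not> coboundary_mod {\<zero>\<^bsub>N\<^esub>} k j (\<lambda>h. s \<odot>\<^bsub>N\<^esub> \<phi> (S m k j h))"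
      unfolding vanishes_def by blast
    \<comment> \<open>Classes in \<open>Ext\<close> have extensional representatives, while
      \<open>vanishes\<close> speaks of arbitrary linear maps; restriction mediates.\<close>
    let ?\<phi> = "restrict \<phi> (carrier (F m j))"
    have "cochain m j ?\<phi>" by (rule module_map_cong[OF F_module \<phi>(1)]) simp
    then have "?\<phi> \<in> Z j m"
      using \<phi>(2) module_mapD(1)[OF boundary_map]
      by (simp add: Ext_modules.Z_iff[OF Ext_modules_A] Ext_modules.C_carrier_iff[OF Ext_modules_A])
    moreover have "coboundary_mod {\<zero>\<^bsub>N\<^esub>} k j (\<lambda>h. s \<odot>\<^bsub>N\<^esub> ?\<phi> (S m k j h)) \<longleftrightarrow>
        coboundary_mod {\<zero>\<^bsub>N\<^esub>} k j (\<lambda>h. s \<odot>\<^bsub>N\<^esub> \<phi> (S m k j h))" if "m \<le> k" for k s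
      using module_mapD(1)[OF S_map[OF that]] by (simp add: coboundary_mod_def split: nat.split)
    ultimately show "\<exists>m. \<exists>\<phi> \<in> Z j m. \<forall>s \<in> carrier R - P. \<forall>k\<ge>m. \<not> coboundary_mod {\<zero>\<^bsub>N\<^esub>} k j (\<lambda>h. s \<odot>\<^bsub>N\<^esub> \<phi> (S m k j h))"
      using no by blast
  qed
  finally show ?thesis .
qed

end

section \<open>Annihilators and dimension\<close>

lemma (in ideal) coset_in_image_iff:
  assumes Q: "ideal Q R" "I \<subseteq> Q" and a: "a \<in> carrier R"
  shows "I +> a \<in> (+>) I ` Q \<longleftrightarrow> a \<in> Q"
proof
  assume "I +> a \<in> (+>) I ` Q"
  then obtain q where q: "q \<in> Q" "I +> a = I +> q" by blast
  have "a \<in> I +> a" by (rule a_rcos_self[OF a])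
  then have "a \<in> I +> q" using q(2) by simp
  then obtain i where "i \<in> I" "a = i \<oplus> q" by (auto simp: a_r_coset_def')
  then show "a \<in> Q" using Q(2) q(1) additive_subgroup.a_closed[OF ideal.axioms(1)[OF Q(1)]] by blast
qed simp

lemma (in cring) primeideal_quotient:
  assumes I: "ideal I R" and Q: "primeideal Q R" "I \<subseteq> Q"
  shows "primeideal ((+>) I ` Q) (R Quot I)"
proof (rule primeidealI)
  interpret I: ideal I R by (rule I)
  interpret Q: primeideal Q R by (rule Q(1))
  note iff = I.coset_in_image_iff[OF Q.is_ideal Q(2)]
  have carr: "carrier (R Quot I) = {I +> a | a. a \<in> carrier R}" by (auto simp: FactRing_def A_RCOSETS_def')
  show "ideal ((+>) I ` Q) (R Quot I)" by (rule ring_ideal_imp_quot_ideal[OF I Q.is_ideal])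
  show "cring (R Quot I)" by (rule I.quotient_is_cring[OF is_cring])
  show "carrier (R Quot I) \<noteq> (+>) I ` Q"
  proof
    assume "carrier (R Quot I) = (+>) I ` Q"
    then have "I +> \<one> \<in> (+>) I ` Q" using one_closed unfolding carr by blast
    then show False using iff primeideal_one_notin[OF Q(1)] by simp
  qed
  fix X Y assume "X \<in> carrier (R Quot I)" "Y \<in> carrier (R Quot I)" and XY: "X \<otimes>\<^bsub>R Quot I\<^esub> Y \<in> (+>) I ` Q"
  then obtain a b where ab: "a \<in> carrier R" "b \<in> carrier R" "X = I +> a" "Y = I +> b" unfolding carr by blast
  have "I +> (a \<otimes> b) \<in> (+>) I ` Q" using XY I.rcoset_mult_add[OF ab(1,2)] unfolding ab(3,4) by (simp add: FactRing_def)
  then have "a \<otimes> b \<in> Q" using iff ab by simp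
  then show "X \<in> (+>) I ` Q \<or> Y \<in> (+>) I ` Q" using Q.I_prime[OF ab(1,2)] unfolding ab(3,4) by blast
qed

text \<open>The images of the primes in R/I are primes, and the chain stays strict because every
  member contains I.\<close>

lemma (in cring) chain_le_krull_dim_quotient:
  assumes I: "ideal I R" and Q: "\<And>i. i \<le> j \<Longrightarrow> primeideal (Q i) R" "\<And>i. i < j \<Longrightarrow> Q i \<subset> Q (Suc i)" and "I \<subseteq> Q 0"
  shows "ereal (real j) \<le> krull_dim (R Quot I)"
proof -
  interpret I: ideal I R by (rule I)
  have IQ: "I \<subseteq> Q i" if "i \<le> j" for i
    using that
  proof (induction i)
    case (Suc i)
    then have "I \<subseteq> Q i" "Q i \<subset> Q (Suc i)" using Q(2) by auto
    then show ?case by blast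
  qed (use assms in simp)
  have "(+>) I ` Q i \<subset> (+>) I ` Q (Suc i)" if i: "i < j" for i
  proof -
    obtain a where a: "a \<in> Q (Suc i)" "a \<notin> Q i" using Q(2)[OF i] by blast
    have P: "primeideal (Q i) R" "primeideal (Q (Suc i)) R" using Q(1) i by auto
    then have "a \<in> carrier R" using a(1) by (meson ideal.Icarr primeideal.axioms(1))
    then have "I +> a \<notin> (+>) I ` Q i"
      using I.coset_in_image_iff[OF primeideal.axioms(1)[OF P(1)] IQ] a(2) i by simp
    then show ?thesis using a(1) Q(2)[OF i] by blast
  qed
  moreover have "primeideal ((+>) I ` Q i) (R Quot I)" if "i \<le> j" for i
    by (rule primeideal_quotient[OF I Q(1)[OF that] IQ[OF that]])
  ultimately have "\<exists>P. (\<forall>i\<le>j. primeideal (P i) (R Quot I)) \<and> (\<forall>i<j. P i \<subset> P (Suc i))"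
    by (intro exI[of _ "\<lambda>i. (+>) I ` Q i"]) blast
  then show ?thesis unfolding krull_dim_def by (intro Sup_upper) blast
qed

lemma (in module) colon_all_zero: "colon_all R M {\<zero>\<^bsub>M\<^esub>} = annihilator R M"
  by (auto simp: colon_all_def annihilator_def)

lemma (in module) annihilator_ideal: "ideal (annihilator R M) R"
  using colon_all_ideal[OF zero_submodule] by (simp add: colon_all_zero)

section \<open>Annihilators acting on Ext, and survival in a bounded degree\<close>

context module_system begin

text \<open>By exactness a cycle is the boundary of a basis element, to which the cocycle condition
  applies.\<close>

lemma cocycle_vanishes_on_cycles:
  assumes cyc: "\<forall>h \<in> carrier (F n (Suc j)). \<phi> (res_boundary R h) = \<zero>\<^bsub>N\<^esub>" and z: "z \<in> res_cycles R (A n) j"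
  shows "\<phi> z = \<zero>\<^bsub>N\<^esub>"
proof -
  interpret An: module R "A n" by (rule A_module)
  show ?thesis
    using bspec[OF cyc An.std_res_basis_closed[OF An.cycle_gen_in_basis[OF z]]] An.boundary_basis[OF z] by simp
qed

text \<open>In degree i + 1 the contraction makes rh - \<sigma>\<partial>h a cycle, where \<phi>
  vanishes; so r\<phi> = \<phi>\<sigma>\<partial> is the coboundary of \<phi>\<sigma>. In degree 0,
  rh itself is a cycle.\<close>

lemma annihilator_coboundary:
  assumes \<phi>: "cochain n j \<phi>" and cyc: "\<forall>h \<in> carrier (F n (Suc j)). \<phi> (res_boundary R h) = \<zero>\<^bsub>N\<^esub>"
    and r: "r \<in> annihilator R (A n)"
  shows "coboundary_mod {\<zero>\<^bsub>N\<^esub>} n j (\<lambda>h. r \<odot>\<^bsub>N\<^esub> \<phi> h)"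
proof -
  interpret An: module R "A n" by (rule A_module)
  have rc: "r \<in> carrier R" using r by (auto simp: annihilator_def)
  note zero = cocycle_vanishes_on_cycles[OF cyc]
  show ?thesis
  proof (cases j)
    case 0
    have "r \<odot>\<^bsub>N\<^esub> \<phi> h = \<zero>\<^bsub>N\<^esub>" if h: "h \<in> carrier (F n 0)" for h
    proof -
      interpret G: module R "F n 0" by (rule F_module)
      have "r \<odot>\<^bsub>F n 0\<^esub> h \<in> res_cycles R (A n) 0"
        using r rc h module_mapD[OF An.augmentation_hom] by (auto simp: res_cycles_def annihilator_def)
      then have "\<phi> (r \<odot>\<^bsub>F n 0\<^esub> h) = \<zero>\<^bsub>N\<^esub>" using zero 0 by blast
      then show ?thesis using module_mapD(3)[OF \<phi>[unfolded 0] rc h] by simp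
    qed
    then show ?thesis by (simp add: coboundary_mod_def 0)
  next
    case (Suc i)
    interpret G: module R "F n (Suc i)" by (rule F_module)
    obtain \<rho> where \<rho>: "module_map R (F n i) (F n i) \<rho>"
      "\<And>h. h \<in> carrier (F n i) \<Longrightarrow> \<rho> h \<in> res_cycles R (A n) i"
      "\<And>z. z \<in> res_cycles R (A n) i \<Longrightarrow> \<rho> z = r \<odot>\<^bsub>F n i\<^esub> z"
      using An.annihilator_contraction[OF r, of i] by blast
    obtain \<sigma> where \<sigma>: "module_map R (F n i) (F n (Suc i)) \<sigma>"
      "\<And>h. h \<in> carrier (F n (Suc i)) \<Longrightarrow>
        r \<odot>\<^bsub>F n (Suc i)\<^esub> h \<ominus>\<^bsub>F n (Suc i)\<^esub> \<sigma> (res_boundary R h) \<in> res_cycles R (A n) (Suc i)"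
      using An.contraction_homotopy[OF rc \<rho>] by metis
    note \<phi>' = \<phi>[unfolded Suc]
    have "r \<odot>\<^bsub>N\<^esub> \<phi> h \<ominus>\<^bsub>N\<^esub> \<phi> (\<sigma> (res_boundary R h)) = \<zero>\<^bsub>N\<^esub>" if h: "h \<in> carrier (F n (Suc i))" for h
    proof -
      have s: "\<sigma> (res_boundary R h) \<in> carrier (F n (Suc i))"
        using module_mapD(1)[OF \<sigma>(1) module_mapD(1)[OF boundary_map h]] .
      have "\<phi> (r \<odot>\<^bsub>F n (Suc i)\<^esub> h \<ominus>\<^bsub>F n (Suc i)\<^esub> \<sigma> (res_boundary R h)) = \<zero>\<^bsub>N\<^esub>"
        using zero \<sigma>(2)[OF h] unfolding Suc by blast
      then show ?thesis
        using module_map_diff[OF F_module N.module_axioms \<phi>' _ s, of "r \<odot>\<^bsub>F n (Suc i)\<^esub> h"]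
          module_mapD(3)[OF \<phi>' rc h] rc h by simp
    qed
    then show ?thesis using module_map_comp[OF \<sigma>(1) \<phi>'] unfolding coboundary_mod_def Suc by auto
  qed
qed

lemma Supp_direct_limit_subset:
  assumes "P \<in> Supp R (direct_limit (\<lambda>n. Ext R j (A n) N) (\<lambda>m n. Ext_map R j (A n) (f m n) N))"
  shows "primeideal P R" and "annihilator R N \<subseteq> P" and "\<exists>n. annihilator R (A n) \<subseteq> P"
proof -
  show P: "primeideal P R" using assms by (simp add: Supp_def)
  then have "\<not> vanishes P {\<zero>\<^bsub>N\<^esub>} j" using assms Supp_iff_not_vanishes by blast
  then obtain n \<phi> where \<phi>: "cochain n j \<phi>" "\<forall>h \<in> carrier (F n (Suc j)). \<phi> (res_boundary R h) \<in> {\<zero>\<^bsub>N\<^esub>}"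
    and no: "\<forall>k\<ge>n. \<forall>s \<in> carrier R - P. \<not> coboundary_mod {\<zero>\<^bsub>N\<^esub>} k j (\<lambda>h. s \<odot>\<^bsub>N\<^esub> \<phi> (S n k j h))"
    unfolding vanishes_def by blast
  \<comment> \<open>Taking k = n in \<open>no\<close> leaves the chain map from stage n to itself;
    its composite with \<phi> is again a cocycle, which is all that the argument uses.\<close>
  let ?\<phi> = "\<lambda>h. \<phi> (S n n j h)"
  have \<phi>': "cochain n j ?\<phi>" by (rule module_map_comp[OF S_map[OF le_refl] \<phi>(1)])
  have cyc: "\<forall>h \<in> carrier (F n (Suc j)). ?\<phi> (res_boundary R h) = \<zero>\<^bsub>N\<^esub>"
    using \<phi>(2) S_boundary[OF le_refl, symmetric] module_mapD(1)[OF S_map[OF le_refl]] by simp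
  have no': "\<not> coboundary_mod {\<zero>\<^bsub>N\<^esub>} n j (\<lambda>h. s \<odot>\<^bsub>N\<^esub> ?\<phi> h)" if "s \<in> carrier R - P" for s
    using no that by blast
  have "annihilator R (A n) \<subseteq> P"
  proof
    fix r assume r: "r \<in> annihilator R (A n)"
    then show "r \<in> P" using no'[of r] annihilator_coboundary[OF \<phi>' cyc r] by (auto simp: annihilator_def)
  qed
  then show "\<exists>n. annihilator R (A n) \<subseteq> P" ..
  show "annihilator R N \<subseteq> P"
  proof
    fix r assume r: "r \<in> annihilator R N"
    then have rc: "r \<in> carrier R" and r0: "r \<odot>\<^bsub>N\<^esub> ?\<phi> h = \<zero>\<^bsub>N\<^esub>" if "h \<in> carrier (F n j)" for h
      using module_mapD(1)[OF \<phi>' that] by (auto simp: annihilator_def)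
    have "coboundary_mod {\<zero>\<^bsub>N\<^esub>} n j (\<lambda>h. r \<odot>\<^bsub>N\<^esub> ?\<phi> h)"
    proof (cases j)
      case 0 then show ?thesis using r0 by (simp add: coboundary_mod_def)
    next
      case (Suc i)
      have "cochain n i (\<lambda>_. \<zero>\<^bsub>N\<^esub>)" by (simp add: module_map_def)
      then show ?thesis using r0 unfolding coboundary_mod_def Suc
        by (auto simp: N.diff_zero intro!: exI[of _ "\<lambda>_. \<zero>\<^bsub>N\<^esub>"])
    qed
    then show "r \<in> P" using no'[of r] r by (auto simp: annihilator_def)
  qed
qed

text \<open>At K = 0 the chain lies above \<open>annihilator R N\<close>; its image is a chain of
  primes of length j in R/ann N, which bounds j by dim N.\<close>

lemma ex_Supp_direct_limit:
  assumes "noetherian_ring R" "noetherian_module R N" and P: "primeideal P R" and J: "ideal J R" "J \<subseteq> P"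
    and base: "\<And>K z. submodule K R N \<Longrightarrow> z \<in> carrier N \<Longrightarrow> primeideal (colon R N K z) R \<Longrightarrow>
      J \<subseteq> colon R N K z \<Longrightarrow> colon R N K z \<subseteq> P \<Longrightarrow> \<not> vanishes P K 0"
    and NP: "annihilator R N \<subseteq> P"
  shows "\<exists>j. ereal (real j) \<le> module_dim R N \<and>
    P \<in> Supp R (direct_limit (\<lambda>n. Ext R j (A n) N) (\<lambda>m n. Ext_map R j (A n) (f m n) N))"
proof -
  have nz: "colon_all R N {\<zero>\<^bsub>N\<^esub>} \<subseteq> P" using NP by (simp add: N.colon_all_zero)
  have "\<exists>j Q. (\<forall>i\<le>j. primeideal (Q i) R) \<and> (\<forall>i<j. Q i \<subset> Q (Suc i)) \<and>
      colon_all R N {\<zero>\<^bsub>N\<^esub>} \<subseteq> Q 0 \<and> Q j \<subseteq> P \<and> \<not> vanishes P {\<zero>\<^bsub>N\<^esub>} j"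
    by (rule not_vanishes_chain[OF assms(1,2) P J _ N.zero_submodule nz]) (rule base)
  then obtain j Q where Q: "\<forall>i\<le>j. primeideal (Q i) R" "\<forall>i<j. Q i \<subset> Q (Suc i)"
    "colon_all R N {\<zero>\<^bsub>N\<^esub>} \<subseteq> Q 0" "\<not> vanishes P {\<zero>\<^bsub>N\<^esub>} j" by blast
  have "ereal (real j) \<le> module_dim R N" unfolding module_dim_def
    by (rule N.R.chain_le_krull_dim_quotient[OF N.annihilator_ideal, of j Q]) (use Q in \<open>auto simp: N.colon_all_zero\<close>)
  then show ?thesis using Supp_iff_not_vanishes[OF P] Q(4) by blast
qed

end

section \<open>The quotients of a module by the powers of an ideal\<close>

lemma ideals_set_simps:
  "\<one>\<^bsub>ideals_set R\<^esub> = carrier R" "I \<otimes>\<^bsub>ideals_set R\<^esub> J = ideal_prod R I J"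
  by (simp_all add: ideals_set_def)

lemma ideal_nat_pow_Suc: "I [^]\<^bsub>ideals_set R\<^esub> Suc n = ideal_prod R (I [^]\<^bsub>ideals_set R\<^esub> n) I"
  by (simp add: nat_pow_def ideals_set_def)

lemma (in cring) ideal_nat_pow_ideal: "ideal I R \<Longrightarrow> ideal (I [^]\<^bsub>ideals_set R\<^esub> (n::nat)) R"
  by (induction n) (simp_all add: ideals_set_simps oneideal ideal_prod_is_ideal)

lemma (in cring) ideal_nat_pow_1: "ideal I R \<Longrightarrow> I [^]\<^bsub>ideals_set R\<^esub> (1::nat) = I"
  using ideal_prod_one ideal_prod_commute[OF _ oneideal] by (simp add: ideals_set_simps)

lemma regular_module_simps:
  "carrier (regular_module R) = carrier R" "a \<odot>\<^bsub>regular_module R\<^esub> b = a \<otimes>\<^bsub>R\<^esub> b"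
  "a \<oplus>\<^bsub>regular_module R\<^esub> b = a \<oplus>\<^bsub>R\<^esub> b" "\<zero>\<^bsub>regular_module R\<^esub> = \<zero>\<^bsub>R\<^esub>"
  by (simp_all add: regular_module_def)

lemma (in cring) regular_module_module: "module R (regular_module R)"
proof (rule moduleI)
  show "abelian_group (regular_module R)"
    by (rule abelian_groupI)
      (auto simp: regular_module_def a_ac intro!: bexI[of _ "\<ominus> x" for x] l_neg)
qed (auto simp: regular_module_def l_distr r_distr m_assoc is_cring)

context module begin

lemma ideal_smult_submodule:
  assumes "ideal I R"
  shows "submodule (ideal_smult R I M) R M"
  unfolding ideal_smult_def
  by (rule module_span_submodule) (use ideal.Icarr[OF assms] in auto)

lemma ideal_smult_mem: "a \<in> I \<Longrightarrow> x \<in> carrier M \<Longrightarrow> a \<odot>\<^bsub>M\<^esub> x \<in> ideal_smult R I M"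
  unfolding ideal_smult_def by (rule subsetD[OF module_span_superset]) blast

lemma ideal_smult_minimal:
  assumes "submodule H R M" "\<And>a x. a \<in> I \<Longrightarrow> x \<in> carrier M \<Longrightarrow> a \<odot>\<^bsub>M\<^esub> x \<in> H"
  shows "ideal_smult R I M \<subseteq> H"
  unfolding ideal_smult_def by (rule module_span_minimal) (use assms in auto)

lemma power_smult_submodule: "ideal I R \<Longrightarrow> submodule (power_smult R I M n) R M"
  unfolding power_smult_def by (rule ideal_smult_submodule[OF R.ideal_nat_pow_ideal])

lemma power_smult_1: "ideal I R \<Longrightarrow> power_smult R I M (Suc 0) = ideal_smult R I M"
  using R.ideal_nat_pow_1[of I] by (simp add: power_smult_def)

lemma power_smult_antimono:
  assumes I: "ideal I R" and "m \<le> n"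
  shows "power_smult R I M n \<subseteq> power_smult R I M m"
  using \<open>m \<le> n\<close>
proof (induction n rule: dec_induct)
  case (step n)
  have "I [^]\<^bsub>ideals_set R\<^esub> Suc n \<subseteq> I [^]\<^bsub>ideals_set R\<^esub> n"
    unfolding ideal_nat_pow_Suc using R.ideal_prod_inter[OF R.ideal_nat_pow_ideal[OF I] I] by blast
  then have "power_smult R I M (Suc n) \<subseteq> power_smult R I M n"
    unfolding power_smult_def[of _ _ _ "Suc n"]
    by (intro ideal_smult_minimal power_smult_submodule[OF I]) (auto simp: power_smult_def intro: ideal_smult_mem)
  then show ?case using step by blast
qed simp

lemma annihilator_quotient:
  assumes H: "submodule H R M"
  shows "annihilator R (quotient_module M H) = colon_all R M H"
proof -
  have "r \<odot>\<^bsub>quotient_module M H\<^esub> (H +>\<^bsub>M\<^esub> x) = H \<longleftrightarrow> r \<odot>\<^bsub>M\<^esub> x \<in> H"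
    if "r \<in> carrier R" "x \<in> carrier M" for r x
    using that by (simp add: quotient_smult[OF H] coset_eq_self_iff[OF H])
  then show ?thesis
    unfolding annihilator_def colon_all_def quotient_carrier quotient_zero by blast
qed

text \<open>From rM inside IM it follows that r sends I^kM into I^(k+1)M, and n such steps take M =
  I^0 M into I^nM.\<close>

lemma colon_all_power:
  assumes I: "ideal I R" and r: "r \<in> colon_all R M (ideal_smult R I M)"
  shows "r [^] (n::nat) \<in> colon_all R M (power_smult R I M n)"
proof -
  have rc: "r \<in> carrier R" and rI: "\<And>y. y \<in> carrier M \<Longrightarrow> r \<odot>\<^bsub>M\<^esub> y \<in> ideal_smult R I M"
    using r by (auto simp: colon_all_def)
  note W = power_smult_submodule[OF I]
  \<comment> \<open>Preimages under multiplication by a scalar are submodules, so both inclusions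
    below are checked only on the products that span I^kM and IM.\<close>
  have vim: "submodule {y \<in> carrier M. a \<odot>\<^bsub>M\<^esub> y \<in> H} R M" if "a \<in> carrier R" "submodule H R M" for a H
    by (rule module_map_submodule_vimage[OF module_axioms module_axioms _ that(2)])
      (use module_map_smult[OF module_axioms _ that(1), of "\<lambda>x. x"] in \<open>simp add: module_map_def\<close>)
  have step: "r \<odot>\<^bsub>M\<^esub> y \<in> power_smult R I M (Suc k)" if y: "y \<in> power_smult R I M k" for y k
  proof -
    let ?J = "I [^]\<^bsub>ideals_set R\<^esub> k"
    have J: "ideal ?J R" by (rule R.ideal_nat_pow_ideal[OF I])
    have "ideal_smult R ?J M \<subseteq> {y \<in> carrier M. r \<odot>\<^bsub>M\<^esub> y \<in> power_smult R I M (Suc k)}"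
    proof (rule ideal_smult_minimal[OF vim[OF rc W]])
      fix a x assume a: "a \<in> ?J" and x: "x \<in> carrier M"
      have ac: "a \<in> carrier R" by (rule ideal.Icarr[OF J a])
      have "ideal_smult R I M \<subseteq> {y \<in> carrier M. a \<odot>\<^bsub>M\<^esub> y \<in> power_smult R I M (Suc k)}"
      proof (rule ideal_smult_minimal[OF vim[OF ac W]])
        fix b z assume b: "b \<in> I" and z: "z \<in> carrier M"
        have bc: "b \<in> carrier R" by (rule ideal.Icarr[OF I b])
        have "a \<otimes> b \<in> I [^]\<^bsub>ideals_set R\<^esub> Suc k" unfolding ideal_nat_pow_Suc by (rule ideal_prod.prod[OF a b])
        then have "(a \<otimes> b) \<odot>\<^bsub>M\<^esub> z \<in> power_smult R I M (Suc k)" unfolding power_smult_def by (rule ideal_smult_mem[OF _ z])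
        then show "b \<odot>\<^bsub>M\<^esub> z \<in> {y \<in> carrier M. a \<odot>\<^bsub>M\<^esub> y \<in> power_smult R I M (Suc k)}"
          using ac bc z by (simp add: smult_assoc1)
      qed
      then have "a \<odot>\<^bsub>M\<^esub> (r \<odot>\<^bsub>M\<^esub> x) \<in> power_smult R I M (Suc k)" using rI[OF x] by blast
      then show "a \<odot>\<^bsub>M\<^esub> x \<in> {y \<in> carrier M. r \<odot>\<^bsub>M\<^esub> y \<in> power_smult R I M (Suc k)}"
        using smult_commute[OF ac rc x] ac x by simp
    qed
    then show ?thesis using y by (auto simp: power_smult_def[of _ _ _ k])
  qed
  have "r [^] n \<odot>\<^bsub>M\<^esub> y \<in> power_smult R I M n" if y: "y \<in> carrier M" for y
  proof (induction n)
    case 0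
    have "\<one> \<in> I [^]\<^bsub>ideals_set R\<^esub> (0::nat)" by (simp add: ideals_set_simps)
    then show ?case unfolding power_smult_def using ideal_smult_mem[OF _ y] by simp
  next
    case (Suc n)
    have "r [^] Suc n \<odot>\<^bsub>M\<^esub> y = r \<odot>\<^bsub>M\<^esub> (r [^] n \<odot>\<^bsub>M\<^esub> y)"
      using rc y smult_commute[of r "r [^] n" y] by (simp add: smult_assoc1)
    then show ?case using step[OF Suc] by simp
  qed
  then show ?thesis using rc by (simp add: colon_all_def)
qed

lemma quotient_projection_map:
  assumes "submodule H R M"
  shows "module_map R M (quotient_module M H) (\<lambda>x. H +>\<^bsub>M\<^esub> x)"
  unfolding module_map_def
  by (auto simp: quotient_add[OF assms] quotient_smult[OF assms] quotient_carrier)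

text \<open>This identifies the map written as a set sum with the natural projection from M/H to
  M/K.\<close>

lemma set_add_coset:
  assumes H: "submodule H R M" and K: "submodule K R M" and "H \<subseteq> K" and x: "x \<in> carrier M"
  shows "K <+>\<^bsub>M\<^esub> (H +>\<^bsub>M\<^esub> x) = K +>\<^bsub>M\<^esub> x"
proof -
  have "K <+>\<^bsub>M\<^esub> H = K"
  proof
    show "K <+>\<^bsub>M\<^esub> H \<subseteq> K" using assms(3) submoduleE(5)[OF K] by (auto simp: set_add_def')
    show "K \<subseteq> K <+>\<^bsub>M\<^esub> H"
    proof
      fix k assume k: "k \<in> K"
      then have "k = k \<oplus>\<^bsub>M\<^esub> \<zero>\<^bsub>M\<^esub>" using submoduleE(1)[OF K] by auto
      then show "k \<in> K <+>\<^bsub>M\<^esub> H" using k submodule_zero[OF H] unfolding set_add_def' by blast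
    qed
  qed
  then show ?thesis using M.a_setmult_rcos_assoc[OF submoduleE(1)[OF K] submoduleE(1)[OF H] x] by simp
qed

end

locale power_quotients = M: module R M + N: module R N
  for R :: "('r, 'a) ring_scheme" (structure) and M :: "('r, 'm, 'k) module_scheme"
    and N :: "('r, 'n, 'l) module_scheme" +
  fixes I :: "'r set"
  assumes I: "ideal I R"
begin

abbreviation "W n \<equiv> power_smult R I M n"

lemma W_submodule: "submodule (W n) R M"
  by (rule M.power_smult_submodule[OF I])

lemma projection_coset: "m \<le> n \<Longrightarrow> x \<in> carrier M \<Longrightarrow> W m <+>\<^bsub>M\<^esub> (W n +>\<^bsub>M\<^esub> x) = W m +>\<^bsub>M\<^esub> x"
  by (rule M.set_add_coset[OF W_submodule W_submodule M.power_smult_antimono[OF I]])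

lemma quotient_elem:
  assumes "X \<in> carrier (quotient_module M (W n))"
  obtains x where "x \<in> carrier M" "X = W n +>\<^bsub>M\<^esub> x"
  using assms by (auto simp: M.quotient_carrier)

sublocale module_system R N "\<lambda>n. quotient_module M (W n)" "\<lambda>m n X. W m <+>\<^bsub>M\<^esub> X"
proof (intro module_system.intro module_system_axioms.intro)
  show "module R N" by (rule N.module_axioms)
  show "module R (quotient_module M (W n))" for n by (rule M.quotient_module_module[OF W_submodule])
  fix m n :: nat assume mn: "m \<le> n"
  note q = M.quotient_carrier M.quotient_add[OF W_submodule] M.quotient_smult[OF W_submodule] projection_coset[OF mn]
  show "module_map R (quotient_module M (W n)) (quotient_module M (W m)) ((<+>\<^bsub>M\<^esub>) (W m))"
    unfolding module_map_def
  proof (intro conjI ballI Pi_I)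
    fix X assume "X \<in> carrier (quotient_module M (W n))"
    then obtain x where x: "x \<in> carrier M" "X = W n +>\<^bsub>M\<^esub> x" by (rule quotient_elem)
    show "W m <+>\<^bsub>M\<^esub> X \<in> carrier (quotient_module M (W m))" using x by (auto simp: q)
    show "W m <+>\<^bsub>M\<^esub> (r \<odot>\<^bsub>quotient_module M (W n)\<^esub> X) = r \<odot>\<^bsub>quotient_module M (W m)\<^esub> (W m <+>\<^bsub>M\<^esub> X)"
      if "r \<in> carrier R" for r using x that by (simp add: q)
    fix Y assume "Y \<in> carrier (quotient_module M (W n))"
    then obtain y where y: "y \<in> carrier M" "Y = W n +>\<^bsub>M\<^esub> y" by (rule quotient_elem)
    show "W m <+>\<^bsub>M\<^esub> (X \<oplus>\<^bsub>quotient_module M (W n)\<^esub> Y) = (W m <+>\<^bsub>M\<^esub> X) \<oplus>\<^bsub>quotient_module M (W m)\<^esub> (W m <+>\<^bsub>M\<^esub> Y)"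
      using x y by (simp add: q)
  qed
  fix k X assume km: "k \<le> m" and "X \<in> carrier (quotient_module M (W n))"
  then obtain x where x: "x \<in> carrier M" "X = W n +>\<^bsub>M\<^esub> x" by (elim quotient_elem)
  show "W k <+>\<^bsub>M\<^esub> X = W k <+>\<^bsub>M\<^esub> (W m <+>\<^bsub>M\<^esub> X)"
    using x by (simp add: projection_coset[OF mn] projection_coset[OF km] projection_coset[OF le_trans[OF km mn]])
qed

abbreviation "I\<^sub>M \<equiv> annihilator R (quotient_module M (ideal_smult R I M))"

lemma I\<^sub>M_eq: "I\<^sub>M = colon_all R M (ideal_smult R I M)"
  by (rule M.annihilator_quotient[OF M.ideal_smult_submodule[OF I]])

lemma I\<^sub>M_ideal: "ideal I\<^sub>M R"
  unfolding I\<^sub>M_eq by (rule M.colon_all_ideal[OF M.ideal_smult_submodule[OF I]])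

lemma I_subset_I\<^sub>M: "I \<subseteq> I\<^sub>M"
  unfolding I\<^sub>M_eq colon_all_def using M.ideal_smult_mem ideal.Icarr[OF I] by blast

lemma prime_contains_I\<^sub>M:
  assumes P: "primeideal P R" and n: "annihilator R (quotient_module M (W n)) \<subseteq> P"
  shows "I\<^sub>M \<subseteq> P"
proof
  interpret P: primeideal P R by fact
  fix r assume r: "r \<in> I\<^sub>M"
  have rc: "r \<in> carrier R" using r by (auto simp: annihilator_def)
  have "r [^] n \<in> P"
    using n M.annihilator_quotient[OF W_submodule] M.colon_all_power[OF I r[unfolded I\<^sub>M_eq], of n] by blast
  then show "r \<in> P"
  proof (induction n)
    case 0
    then show ?case using primeideal_one_notin[OF P] by simp
  next
    case (Suc n)
    then show ?case using P.I_prime[of "r [^] n" r] rc by auto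
  qed
qed

text \<open>\<open>M\<close> modulo a maximal submodule \<open>U\<close> with \<open>(U : M) \<subseteq> Q\<close> is torsion-free of rank one over \<open>R/Q\<close>;
  a nonzero map of it to \<open>R/Q\<close>, followed by \<open>R/Q \<rightarrow> N/K\<close>, \<open>r \<mapsto> rz\<close>, is a homomorphism from \<open>M/IM\<close>
  that stays nonzero locally at \<open>P\<close> on every \<open>M/I\<^sup>mM\<close>.\<close>

lemma not_vanishes_0:
  assumes "noetherian_module R M" and P: "primeideal P R" and K: "submodule K R N" and z: "z \<in> carrier N"
    and Q: "primeideal (colon R N K z) R" "I\<^sub>M \<subseteq> colon R N K z" "colon R N K z \<subseteq> P"
  shows "\<not> vanishes P K 0"
proof
  interpret MM: noetherian_module R M by fact
  let ?Q = "colon R N K z"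
  interpret Q: primeideal ?Q R by (rule Q(1))
  have "colon_all R M {\<zero>\<^bsub>M\<^esub>} \<subseteq> ?Q"
  proof -
    have "colon_all R M {\<zero>\<^bsub>M\<^esub>} \<subseteq> I\<^sub>M"
      unfolding I\<^sub>M_eq colon_all_def using M.submodule_zero[OF M.ideal_smult_submodule[OF I]] by auto
    then show ?thesis using Q(2) by blast
  qed
  then obtain U where U: "submodule U R M" "{\<zero>\<^bsub>M\<^esub>} \<subseteq> U" and UQ: "colon_all R M U \<subseteq> ?Q"
    and QM: "\<And>p y. p \<in> ?Q \<Longrightarrow> y \<in> carrier M \<Longrightarrow> p \<odot>\<^bsub>M\<^esub> y \<in> U"
    and tf: "\<And>u y. u \<in> carrier R - ?Q \<Longrightarrow> y \<in> carrier M \<Longrightarrow> u \<odot>\<^bsub>M\<^esub> y \<in> U \<Longrightarrow> y \<in> U"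
    and rank1: "\<And>m. m \<in> carrier M - U \<Longrightarrow>
      \<exists>u \<in> carrier R - ?Q. \<forall>y \<in> carrier M. \<exists>r \<in> carrier R. u \<odot>\<^bsub>M\<^esub> y \<ominus>\<^bsub>M\<^esub> r \<odot>\<^bsub>M\<^esub> m \<in> U"
    by (rule MM.maximal_avoiding_submodule[OF M.zero_submodule Q(1)]) blast
  note U = U(1)
  note UE = M.submoduleE[OF U] and KE = N.submoduleE[OF K]
  \<comment> \<open>I lies in \<open>I\<^sub>M\<close>, hence in Q, and Q sends M into U; so IM lies
    in U and M/U is a quotient of M/IM.\<close>
  have WU: "W 1 \<subseteq> U"
    using M.ideal_smult_minimal[OF U QM, of I] I_subset_I\<^sub>M Q(2) M.power_smult_1[OF I] by auto
  obtain m0 where m0: "m0 \<in> carrier M - U"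
  proof -
    have "\<one> \<notin> colon_all R M U" using UQ primeideal_one_notin[OF Q(1)] by blast
    then obtain y where "y \<in> carrier M" "\<one> \<odot>\<^bsub>M\<^esub> y \<notin> U" by (auto simp: colon_all_def)
    then show thesis using that[of y] by simp
  qed
  have m0c: "m0 \<in> carrier M" using m0 by simp
  \<comment> \<open>u is a common denominator: modulo U every uy is a multiple of m0. The
    coefficient g y is determined only modulo Q, so g is linear modulo Q but need not be linear as a
    map into R.\<close>
  obtain u where u: "u \<in> carrier R - ?Q" "\<forall>y \<in> carrier M. \<exists>r \<in> carrier R. u \<odot>\<^bsub>M\<^esub> y \<ominus>\<^bsub>M\<^esub> r \<odot>\<^bsub>M\<^esub> m0 \<in> U"
    using rank1[OF m0] by blast
  have uc: "u \<in> carrier R" using u(1) by simp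
  obtain g where g: "\<And>y. y \<in> carrier M \<Longrightarrow> g y \<in> carrier R \<and> u \<odot>\<^bsub>M\<^esub> y \<ominus>\<^bsub>M\<^esub> g y \<odot>\<^bsub>M\<^esub> m0 \<in> U"
    using bchoice[OF u(2)[unfolded Bex_def]] by blast
  have inQ: "r \<in> ?Q" if "r \<in> carrier R" "r \<odot>\<^bsub>M\<^esub> m0 \<in> U" for r
    using tf[of r m0] that m0 by blast
  define rep where "rep X = (SOME x. x \<in> carrier M \<and> X = W 1 +>\<^bsub>M\<^esub> x)" for X
  have rep: "rep X \<in> carrier M" "X = W 1 +>\<^bsub>M\<^esub> rep X" if "X \<in> carrier (quotient_module M (W 1))" for X
  proof -
    have "\<exists>x. x \<in> carrier M \<and> X = W 1 +>\<^bsub>M\<^esub> x" using that by (auto simp: M.quotient_carrier)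
    from someI_ex[OF this] show "rep X \<in> carrier M" "X = W 1 +>\<^bsub>M\<^esub> rep X" unfolding rep_def by auto
  qed
  interpret A1: module R "quotient_module M (W 1)" by (rule A_module)
  interpret RR: module R "regular_module R" by (rule M.R.regular_module_module)
  let ?F = "F 1 0"
  have bas: "gen_elem b \<in> carrier (quotient_module M (W 1))" if "b \<in> res_basis R (quotient_module M (W 1)) 0" for b
    using that by auto
  \<comment> \<open>On the free module \<open>F 1 0\<close> representatives and coefficients are
    fixed on the basis and extended linearly: \<theta> lifts the augmentation to M, and \<tau> lifts
    the coefficient map to R.\<close>
  define \<theta> :: "(('r, 'm set) res_gen \<Rightarrow> 'r) \<Rightarrow> 'm" where "\<theta> = lin_ext R M (\<lambda>b. rep (gen_elem b))"
  define \<tau> :: "(('r, 'm set) res_gen \<Rightarrow> 'r) \<Rightarrow> 'r" where "\<tau> = lin_ext R (regular_module R) (\<lambda>b. g (rep (gen_elem b)))"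
  have \<theta>: "module_map R ?F M \<theta>" unfolding \<theta>_def std_res_def by (rule M.lin_ext_hom) (use rep(1) bas in blast)
  have \<tau>: "module_map R ?F (regular_module R) \<tau>" unfolding \<tau>_def std_res_def
    by (rule RR.lin_ext_hom) (use rep(1) bas g in \<open>simp add: regular_module_simps\<close>)
  have \<tau>y: "module_map R ?F L (\<lambda>h. \<tau> h \<odot>\<^bsub>L\<^esub> y)" if L: "module R L" and y: "y \<in> carrier L" for L :: "('r, 'x, 'y) module_scheme" and y
  proof (rule module_map_comp[OF \<tau>])
    interpret L: module R L by (rule L)
    show "module_map R (regular_module R) L (\<lambda>r. r \<odot>\<^bsub>L\<^esub> y)"
      using y by (auto simp: module_map_def regular_module_simps L.smult_l_distr L.smult_assoc1)
  qed
  have \<theta>b: "\<theta> (free_basis R b) = rep (gen_elem b)" and \<tau>b: "\<tau> (free_basis R b) = g (rep (gen_elem b))"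
    if "b \<in> res_basis R (quotient_module M (W 1)) 0" for b
    using rep(1)[OF bas[OF that]] g unfolding \<theta>_def \<tau>_def
    by (simp_all add: M.lin_ext_basis RR.lin_ext_basis regular_module_simps)
  have \<theta>\<tau>: "u \<odot>\<^bsub>M\<^esub> \<theta> h \<ominus>\<^bsub>M\<^esub> \<tau> h \<odot>\<^bsub>M\<^esub> m0 \<in> U" if h: "h \<in> carrier ?F" for h
    by (rule M.R.module_map_free_mem[OF M.module_axioms M.module_map_minus[OF F_module
            M.module_map_smult[OF F_module \<theta> uc] \<tau>y[OF M.module_axioms m0c], unfolded std_res_def] U _ h[unfolded std_res_def]])
      (use \<theta>b \<tau>b g rep(1) bas in simp)
  have aug: "res_augmentation R (quotient_module M (W 1)) h = W 1 +>\<^bsub>M\<^esub> \<theta> h" if h: "h \<in> carrier ?F" for h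
    by (rule A1.std_res_hom_eqI[OF A1.module_axioms A1.augmentation_hom
          module_map_comp[OF \<theta> M.quotient_projection_map[OF W_submodule]] _ h])
      (use \<theta>b A1.augmentation_basis rep(2) in auto)
  let ?\<phi> = "\<lambda>h. \<tau> h \<odot>\<^bsub>N\<^esub> z"
  have \<phi>: "cochain 1 0 ?\<phi>" by (rule \<tau>y[OF N.module_axioms z])
  \<comment> \<open>On a boundary \<theta> falls into \<open>W 1\<close>, hence into U, so \<tau>
    falls into Q = (K : z) and its multiple of z into K.\<close>
  have cyc: "?\<phi> (res_boundary R h) \<in> K" if h: "h \<in> carrier (F 1 (Suc 0))" for h
  proof -
    let ?d = "res_boundary R h"
    have d: "?d \<in> carrier ?F" using A1.boundary_closed[OF h] .
    have \<tau>d: "\<tau> ?d \<in> carrier R" using module_mapD(1)[OF \<tau> d] by (simp add: regular_module_simps)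
    have \<theta>d: "\<theta> ?d \<in> carrier M" using module_mapD(1)[OF \<theta> d] .
    have "W 1 +>\<^bsub>M\<^esub> \<theta> ?d = W 1"
      using aug[OF d] A1.boundary_in_cycles[OF h] by (simp add: res_cycles_def M.quotient_zero)
    then have "\<theta> ?d \<in> U" using M.coset_eq_self_iff[OF W_submodule \<theta>d] WU by blast
    then have u\<theta>: "u \<odot>\<^bsub>M\<^esub> \<theta> ?d \<in> U" using UE(4) uc by blast
    have e: "u \<odot>\<^bsub>M\<^esub> \<theta> ?d \<ominus>\<^bsub>M\<^esub> (u \<odot>\<^bsub>M\<^esub> \<theta> ?d \<ominus>\<^bsub>M\<^esub> \<tau> ?d \<odot>\<^bsub>M\<^esub> m0) = \<tau> ?d \<odot>\<^bsub>M\<^esub> m0"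
      using M.diff_diff_cancel[of "u \<odot>\<^bsub>M\<^esub> \<theta> ?d" "\<tau> ?d \<odot>\<^bsub>M\<^esub> m0"] uc \<theta>d \<tau>d m0c by simp
    have "\<tau> ?d \<odot>\<^bsub>M\<^esub> m0 \<in> U" using M.submodule_diff[OF U u\<theta> \<theta>\<tau>[OF d]] unfolding e .
    then have "\<tau> ?d \<in> ?Q" using inQ \<tau>d by blast
    then show ?thesis unfolding colon_def by blast
  qed
  assume "vanishes P K 0"
  from this[unfolded vanishes_def, rule_format, OF \<phi> cyc]
  obtain m s where m: "1 \<le> m" and s: "s \<in> carrier R - P"
    and cob: "coboundary_mod K m 0 (\<lambda>h. s \<odot>\<^bsub>N\<^esub> ?\<phi> (S 1 m 0 h))" by blast
  interpret Am: module R "quotient_module M (W m)" by (rule A_module)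
  \<comment> \<open>m0 is the test element: the projection sends its class at stage m to its class
    at stage 1, so the pulled-back cochain takes the same value on it at every stage.\<close>
  let ?X = "W m +>\<^bsub>M\<^esub> m0" and ?Y = "W 1 +>\<^bsub>M\<^esub> m0"
  have Xb: "Elem ?X \<in> res_basis R (quotient_module M (W m)) 0" using m0c by (auto simp: M.quotient_carrier)
  have Y: "?Y \<in> carrier (quotient_module M (W 1))" using m0c by (auto simp: M.quotient_carrier)
  have Yb: "Elem ?Y \<in> res_basis R (quotient_module M (W 1)) 0" using Y by simp
  let ?x = "rep ?Y"
  have x: "?x \<in> carrier M" "?Y = W 1 +>\<^bsub>M\<^esub> ?x" using rep[OF Y] by auto
  have gc: "g ?x \<in> carrier R" using g[OF x(1)] by simp
  have "S 1 m 0 (free_basis R (Elem ?X)) = free_basis R (Elem ?Y)"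
    unfolding std_res_map_def M.R.free_map_basis by (simp add: projection_coset[OF m m0c, simplified])
  then have \<phi>X: "?\<phi> (S 1 m 0 (free_basis R (Elem ?X))) = g ?x \<odot>\<^bsub>N\<^esub> z" using \<tau>b[OF Yb] by simp
  have "\<forall>h \<in> carrier (F m 0). s \<odot>\<^bsub>N\<^esub> ?\<phi> (S 1 m 0 h) \<in> K"
    using cob unfolding coboundary_mod_def by (simp only: nat.case)
  from bspec[OF this Am.std_res_basis_closed[OF Xb]] have "s \<odot>\<^bsub>N\<^esub> (g ?x \<odot>\<^bsub>N\<^esub> z) \<in> K" unfolding \<phi>X .
  moreover have sc: "s \<in> carrier R" "s \<notin> ?Q" using s Q(3) by auto
  ultimately have "s \<otimes> g ?x \<in> ?Q" using N.smult_assoc1[OF sc(1) gc z] gc unfolding colon_def by simp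
  \<comment> \<open>The representative \<open>?x\<close> of m0 has its coefficient in Q, so u sends
    it into U; by torsion-freeness \<open>?x\<close> lies in U, and with it m0, contrary to the
    choice of m0.\<close>
  then have gQ: "g ?x \<in> ?Q" using Q.I_prime[OF sc(1) gc] sc(2) by blast
  have "m0 \<ominus>\<^bsub>M\<^esub> ?x \<in> U" using M.coset_eq_iff[OF W_submodule x(1) m0c] x(2) WU by blast
  then have "u \<odot>\<^bsub>M\<^esub> (m0 \<ominus>\<^bsub>M\<^esub> ?x) \<in> U" using UE(4) uc by blast
  moreover have "u \<odot>\<^bsub>M\<^esub> ?x \<in> U"
  proof -
    have "g ?x \<odot>\<^bsub>M\<^esub> m0 \<in> U" by (rule QM[OF gQ m0c])
    moreover have "u \<odot>\<^bsub>M\<^esub> ?x \<ominus>\<^bsub>M\<^esub> g ?x \<odot>\<^bsub>M\<^esub> m0 \<in> U" using g[OF x(1)] by blast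
    ultimately have "(u \<odot>\<^bsub>M\<^esub> ?x \<ominus>\<^bsub>M\<^esub> g ?x \<odot>\<^bsub>M\<^esub> m0) \<oplus>\<^bsub>M\<^esub> g ?x \<odot>\<^bsub>M\<^esub> m0 \<in> U" using UE(5) by blast
    then show ?thesis using M.diff_add_cancel[of "u \<odot>\<^bsub>M\<^esub> ?x" "g ?x \<odot>\<^bsub>M\<^esub> m0"] uc x(1) gc m0c by simp
  qed
  then have "?x \<in> U" using tf u(1) x(1) by blast
  then have "(m0 \<ominus>\<^bsub>M\<^esub> ?x) \<oplus>\<^bsub>M\<^esub> ?x \<in> U" using UE(5) \<open>m0 \<ominus>\<^bsub>M\<^esub> ?x \<in> U\<close> by blast
  then show False using M.diff_add_cancel[OF m0c x(1)] m0 by simp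
qed

section \<open>The support of generalized local cohomology\<close>

lemma Supp_gen_local_cohomology_subset:
  assumes "P \<in> Supp R (gen_local_cohomology R I j M N)"
  shows "primeideal P R \<and> I\<^sub>M \<subseteq> P \<and> annihilator R N \<subseteq> P"
proof -
  note S = Supp_direct_limit_subset[OF assms[unfolded gen_local_cohomology_def]]
  then show ?thesis using prime_contains_I\<^sub>M by blast
qed

lemma ex_Supp_gen_local_cohomology:
  assumes "noetherian_ring R" "noetherian_module R M" "noetherian_module R N"
    and P: "primeideal P R" and "I\<^sub>M \<subseteq> P" "annihilator R N \<subseteq> P"
  shows "\<exists>j. ereal (real j) \<le> module_dim R N \<and> P \<in> Supp R (gen_local_cohomology R I j M N)"
  unfolding gen_local_cohomology_def
  by (rule ex_Supp_direct_limit[OF assms(1,3) P I\<^sub>M_ideal assms(5) not_vanishes_0[OF assms(2) P] assms(6)])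

end

text \<open>The index set is left open because every prime on the right is reached in some degree at
  most dim N; all degrees and the degrees up to dim N are two choices of \<open>J\<close>, and M = R
  covers ordinary local cohomology.\<close>

lemma Supp_gen_local_cohomology_Union:
  assumes "noetherian_ring R" "ideal I R" and M: "fin_gen_module R M" and N: "fin_gen_module R N"
    and J: "{j :: nat. ereal (real j) \<le> module_dim R N} \<subseteq> J"
  shows "(\<Union>j\<in>J. Supp R (gen_local_cohomology R I j M N)) =
    {P. primeideal P R \<and> annihilator R (quotient_module M (ideal_smult R I M)) \<subseteq> P \<and> annihilator R N \<subseteq> P}"
proof -
  interpret M: module R M using M by (simp add: fin_gen_module_def)
  interpret N: module R N using N by (simp add: fin_gen_module_def)
  interpret power_quotients R M N I
    by (intro power_quotients.intro power_quotients_axioms.intro M.module_axioms N.module_axioms assms(2))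
  show ?thesis
  proof (intro equalityI subsetI)
    fix P assume "P \<in> (\<Union>j\<in>J. Supp R (gen_local_cohomology R I j M N))"
    then show "P \<in> {P. primeideal P R \<and> I\<^sub>M \<subseteq> P \<and> annihilator R N \<subseteq> P}"
      using Supp_gen_local_cohomology_subset by blast
  next
    fix P assume "P \<in> {P. primeideal P R \<and> I\<^sub>M \<subseteq> P \<and> annihilator R N \<subseteq> P}"
    then have "\<exists>j. ereal (real j) \<le> module_dim R N \<and> P \<in> Supp R (gen_local_cohomology R I j M N)"
      by (intro ex_Supp_gen_local_cohomology[OF assms(1) M.noetherian_moduleI[OF assms(1) M]
            N.noetherian_moduleI[OF assms(1) N]]) auto
    then show "P \<in> (\<Union>j\<in>J. Supp R (gen_local_cohomology R I j M N))" using J by blast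
  qed
qed

lemma (in cring) annihilator_regular_quotient:
  assumes I: "ideal I R"
  shows "annihilator R (quotient_module (regular_module R) (ideal_smult R I (regular_module R))) = I"
proof -
  interpret RR: module R "regular_module R" by (rule regular_module_module)
  interpret I: ideal I R by (rule I)
  have sub: "submodule I R (regular_module R)"
    by (rule RR.submoduleI_smult) (auto simp: regular_module_simps I.I_l_closed I.Icarr)
  have "ideal_smult R I (regular_module R) = I"
  proof
    show "ideal_smult R I (regular_module R) \<subseteq> I"
      by (rule RR.ideal_smult_minimal[OF sub]) (simp add: regular_module_simps I.I_r_closed)
    show "I \<subseteq> ideal_smult R I (regular_module R)"
    proof
      fix a assume a: "a \<in> I"
      then show "a \<in> ideal_smult R I (regular_module R)"
        using RR.ideal_smult_mem[OF a, of \<one>] I.Icarr[OF a] by (simp add: regular_module_simps)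
    qed
  qed
  moreover have "colon_all R (regular_module R) I = I"
  proof
    show "colon_all R (regular_module R) I \<subseteq> I"
    proof
      fix r assume "r \<in> colon_all R (regular_module R) I"
      then have r: "r \<in> carrier R" "\<forall>y \<in> carrier R. r \<otimes> y \<in> I" by (simp_all add: colon_all_def regular_module_simps)
      show "r \<in> I" using bspec[OF r(2) one_closed] r(1) by simp
    qed
    show "I \<subseteq> colon_all R (regular_module R) I" using I.I_r_closed I.Icarr by (auto simp: colon_all_def regular_module_simps)
  qed
  ultimately show ?thesis using RR.annihilator_quotient[OF sub] by simp
qed

lemma (in cring) fin_gen_regular_module: "fin_gen_module R (regular_module R)"
proof -
  interpret RR: module R "regular_module R" by (rule regular_module_module)
  have one: "\<one> \<in> carrier (regular_module R)" by (simp add: regular_module_def)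
  have "module_span R (regular_module R) {\<one>} = carrier (regular_module R)"
  proof
    have S: "submodule (module_span R (regular_module R) {\<one>}) R (regular_module R)"
      by (rule RR.module_span_submodule) (use one in simp)
    show "module_span R (regular_module R) {\<one>} \<subseteq> carrier (regular_module R)" by (rule RR.submoduleE(1)[OF S])
    show "carrier (regular_module R) \<subseteq> module_span R (regular_module R) {\<one>}"
    proof
      fix r assume r: "r \<in> carrier (regular_module R)"
      have "\<one> \<in> module_span R (regular_module R) {\<one>}" using RR.module_span_superset[of "{\<one>}"] by simp
      then have "r \<odot>\<^bsub>regular_module R\<^esub> \<one> \<in> module_span R (regular_module R) {\<one>}"
        using RR.submoduleE(4)[OF S] r by (simp add: regular_module_simps(1))
      then show "r \<in> module_span R (regular_module R) {\<one>}" using r by (simp add: regular_module_simps(1,2))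
    qed
  qed
  then show ?thesis unfolding fin_gen_module_def
    using RR.module_axioms one by (intro conjI exI[of _ "{\<one>}"]) simp_all
qed

theorem corollary2p9:
  fixes R :: "('r, 'a) ring_scheme"
    and \<mm> I I\<^sub>M :: "'r set"
    and M :: "('r, 'm, 'k) module_scheme"
    and N :: "('r, 'n, 'l) module_scheme"
    and n :: ereal
  assumes "noetherian_local_ring R \<mm>"
    and "ideal I R"
    and "fin_gen_module R M"
    and "fin_gen_module R N"
    and "I\<^sub>M = annihilator R (quotient_module M (ideal_smult R I M))"
    and "n = module_dim R N"
  shows "(\<Union>j. Supp R (gen_local_cohomology R I j M N))
           = (\<Union>j \<in> {j :: nat. ereal (real j) \<le> n}. Supp R (local_cohomology R I\<^sub>M j N)) \<and>
         (\<Union>j \<in> {j :: nat. ereal (real j) \<le> n}. Supp R (local_cohomology R I\<^sub>M j N))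
           = (\<Union>j \<in> {j :: nat. ereal (real j) \<le> n}. Supp R (gen_local_cohomology R I j M N))"
proof -
  have R: "cring R" and noeth: "noetherian_ring R" using assms(1) by (auto simp: noetherian_local_ring_def)
  interpret R: cring R by (rule R)
  interpret M: module R M using assms(3) by (simp add: fin_gen_module_def)
  have ideal: "ideal I\<^sub>M R"
    unfolding assms(5) M.annihilator_quotient[OF M.ideal_smult_submodule[OF assms(2)]]
    by (rule M.colon_all_ideal[OF M.ideal_smult_submodule[OF assms(2)]])
  note union = Supp_gen_local_cohomology_Union[OF noeth _ _ assms(4)]
  have "(\<Union>j. Supp R (gen_local_cohomology R I j M N)) = {P. primeideal P R \<and> I\<^sub>M \<subseteq> P \<and> annihilator R N \<subseteq> P}"
    using union[OF assms(2,3), of UNIV] by (simp add: assms(5))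
  moreover have "(\<Union>j \<in> {j :: nat. ereal (real j) \<le> n}. Supp R (gen_local_cohomology R I j M N))
      = {P. primeideal P R \<and> I\<^sub>M \<subseteq> P \<and> annihilator R N \<subseteq> P}"
    using union[OF assms(2,3) subset_refl] by (simp add: assms(5,6))
  moreover have "(\<Union>j \<in> {j :: nat. ereal (real j) \<le> n}. Supp R (local_cohomology R I\<^sub>M j N))
      = {P. primeideal P R \<and> I\<^sub>M \<subseteq> P \<and> annihilator R N \<subseteq> P}"
    using union[OF ideal R.fin_gen_regular_module subset_refl]
    unfolding local_cohomology_def assms(6) R.annihilator_regular_quotient[OF ideal] .
  ultimately show ?thesis by simp
qed

end
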